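(* Let $L>0$, $\nu>0$, $\beta\in\mathbb R$, $\gamma\in\mathbb R\setminus\{0\}$, and let $f\in V'$ be time independent. Let $S(t)$, $t\ge 0$, be the solution semigroup on $H$ of $$u_t-\nu u_{xx}+uu_x-\beta u+\gamma u_{xxx}=f,\quad x\in\mathbb T=[-\tfrac L2,\tfrac L2],$$ with $L$-periodic boundary conditions. Then for any $t'>0$ there exists $r(t')>0$ such that $|S(t)u_0|<r(t')$ for all $u_0\in H$ and all $t\ge t'$.
   Context: $L^2_{per}(\mathbb T)$ is the space of $L$-periodic, locally square integrable real functions, with norm $|\cdot|$. $H=\{\varphi\in L^2_{per}(\mathbb T):\int_{\mathbb T}\varphi\,dx=0\}$, $V=\{\varphi\in H:\varphi_x\in L^2_{per}(\mathbb T)\}$, and $V'$ is the dual of $V$. $S(t)u_0$ denotes the value at time $t$ of the (unique, weak) solution $u\in C([0,\infty);H)\cap L^2_{loc}([0,\infty);V)$ with $u(0)=u_0$. *)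

theory Defs
  imports "HOL-Analysis.Analysis"
begin

text \<open>
  Functions on the torus are represented by \<open>L\<close>-periodic functions on the real line, and elements of
  \<open>L\<^sup>2\<close>-type spaces by arbitrary representatives: functions that agree almost everywhere are not
  identified, but every notion below is invariant under changes on null sets.
\<close>

definition torus_integral :: "real \<Rightarrow> (real \<Rightarrow> real) \<Rightarrow> real" where
  "torus_integral L g = (LINT x:{- L / 2..L / 2}|lebesgue. g x)"

text \<open>For periodic functions, square integrability over one period is local square integrability.\<close>

definition L2_per :: "real \<Rightarrow> (real \<Rightarrow> real) set" where
  "L2_per L = {\<phi>. (\<forall>x. \<phi> (x + L) = \<phi> x) \<and> \<phi> \<in> borel_measurable lebesgue \<and>
     set_integrable lebesgue {- L / 2..L / 2} (\<lambda>x. (\<phi> x)\<^sup>2)}"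

definition L2_inner :: "real \<Rightarrow> (real \<Rightarrow> real) \<Rightarrow> (real \<Rightarrow> real) \<Rightarrow> real" where
  "L2_inner L \<phi> \<psi> = torus_integral L (\<lambda>x. \<phi> x * \<psi> x)"

definition L2_norm :: "real \<Rightarrow> (real \<Rightarrow> real) \<Rightarrow> real" where
  "L2_norm L \<phi> = sqrt (L2_inner L \<phi> \<phi>)"

definition smooth_per :: "real \<Rightarrow> (real \<Rightarrow> real) set" where
  "smooth_per L = {\<psi>. (\<forall>x. \<psi> (x + L) = \<psi> x) \<and>
     (\<forall>k x. ((deriv ^^ k) \<psi>) differentiable (at x))}"

definition weak_deriv_per :: "real \<Rightarrow> (real \<Rightarrow> real) \<Rightarrow> (real \<Rightarrow> real) \<Rightarrow> bool" where
  "weak_deriv_per L \<phi> g \<longleftrightarrow> g \<in> L2_per L \<and>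
     (\<forall>\<psi>\<in>smooth_per L. L2_inner L \<phi> (deriv \<psi>) = - L2_inner L g \<psi>)"

text \<open>The weak derivative is unique up to null sets; \<open>dx\<close> picks a representative.\<close>

definition dx :: "real \<Rightarrow> (real \<Rightarrow> real) \<Rightarrow> real \<Rightarrow> real" where
  "dx L \<phi> = (SOME g. weak_deriv_per L \<phi> g)"

definition space_H :: "real \<Rightarrow> (real \<Rightarrow> real) set" where
  "space_H L = {\<phi> \<in> L2_per L. torus_integral L \<phi> = 0}"

definition space_V :: "real \<Rightarrow> (real \<Rightarrow> real) set" where
  "space_V L = {\<phi> \<in> space_H L. \<exists>g. weak_deriv_per L \<phi> g}"

definition V_norm :: "real \<Rightarrow> (real \<Rightarrow> real) \<Rightarrow> real" where
  "V_norm L \<phi> = sqrt ((L2_norm L \<phi>)\<^sup>2 + (L2_norm L (dx L \<phi>))\<^sup>2)"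

text \<open>
  Bounded linear functionals on \<open>V\<close>. Boundedness makes them constant on almost-everywhere classes;
  their values outside \<open>V\<close> are irrelevant.
\<close>

definition dual_V :: "real \<Rightarrow> ((real \<Rightarrow> real) \<Rightarrow> real) set" where
  "dual_V L = {f.
     (\<forall>\<phi>\<in>space_V L. \<forall>\<psi>\<in>space_V L. f (\<lambda>x. \<phi> x + \<psi> x) = f \<phi> + f \<psi>) \<and>
     (\<forall>c. \<forall>\<phi>\<in>space_V L. f (\<lambda>x. c * \<phi> x) = c * f \<phi>) \<and>
     (\<exists>C. \<forall>\<phi>\<in>space_V L. \<bar>f \<phi>\<bar> \<le> C * V_norm L \<phi>)}"

definition continuous_into_H :: "real \<Rightarrow> (real \<Rightarrow> real \<Rightarrow> real) \<Rightarrow> bool" where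
  "continuous_into_H L u \<longleftrightarrow> (\<forall>t\<ge>0. u t \<in> space_H L) \<and>
     (\<forall>t\<ge>0. ((\<lambda>s. L2_norm L (\<lambda>x. u s x - u t x)) \<longlongrightarrow> 0) (at t within {0..}))"

text \<open>
  \<open>L\<^sup>2\<^sub>l\<^sub>o\<^sub>c([0,\<infinity>); V)\<close>: since \<open>V\<close> is separable, strong (Bochner) measurability is the same as weak
  measurability, by Pettis' theorem.
\<close>

definition L2_loc_V :: "real \<Rightarrow> (real \<Rightarrow> real \<Rightarrow> real) \<Rightarrow> bool" where
  "L2_loc_V L u \<longleftrightarrow>
     (AE t in lebesgue. t \<ge> 0 \<longrightarrow> u t \<in> space_V L) \<and>
     (\<forall>l\<in>dual_V L. (\<lambda>t. l (u t)) \<in> borel_measurable (lebesgue_on {0..})) \<and>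
     (\<forall>T>0. set_integrable lebesgue {0..T} (\<lambda>t. (V_norm L (u t))\<^sup>2))"

text \<open>
  Weak solutions of \<open>u\<^sub>t - \<nu> u\<^sub>x\<^sub>x + u u\<^sub>x - \<beta> u + \<gamma> u\<^sub>x\<^sub>x\<^sub>x = f\<close>: the equation is paired with a smooth
  test function \<open>\<psi>\<close>, the derivatives beyond the first are moved onto \<open>\<psi>\<close>
  (\<open>-\<langle>u\<^sub>x\<^sub>x, \<psi>\<rangle> = (u\<^sub>x, \<psi>\<^sub>x)\<close> and \<open>\<langle>u\<^sub>x\<^sub>x\<^sub>x, \<psi>\<rangle> = (u\<^sub>x, \<psi>\<^sub>x\<^sub>x)\<close>), and the result is integrated over
  \<open>[0, t]\<close>. Test functions have mean zero because \<open>f\<close> acts on \<open>V\<close> only; for \<open>u\<close> in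
  \<open>C([0,\<infinity>); H) \<inter> L\<^sup>2\<^sub>l\<^sub>o\<^sub>c([0,\<infinity>); V)\<close> the time integrand is integrable.
\<close>

definition weak_solution ::
  "real \<Rightarrow> real \<Rightarrow> real \<Rightarrow> real \<Rightarrow> ((real \<Rightarrow> real) \<Rightarrow> real) \<Rightarrow> (real \<Rightarrow> real \<Rightarrow> real) \<Rightarrow> bool" where
  "weak_solution L \<nu> \<beta> \<gamma> f u \<longleftrightarrow> continuous_into_H L u \<and> L2_loc_V L u \<and>
     (\<forall>\<psi>\<in>smooth_per L. torus_integral L \<psi> = 0 \<longrightarrow> (\<forall>t\<ge>0.
        L2_inner L (u t) \<psi> - L2_inner L (u 0) \<psi> +
        (LINT s:{0..t}|lebesgue.
            \<nu> * L2_inner L (dx L (u s)) (deriv \<psi>)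
          + L2_inner L (\<lambda>x. u s x * dx L (u s) x) \<psi>
          - \<beta> * L2_inner L (u s) \<psi>
          + \<gamma> * L2_inner L (dx L (u s)) (deriv (deriv \<psi>)))
        = t * f \<psi>))"

text \<open>
  \<open>S t u\<^sub>0\<close> is the value at time \<open>t\<close> of the weak solution starting at \<open>u\<^sub>0\<close>. As weak solutions are unique,
  this determines \<open>S t u\<^sub>0\<close> up to null sets for \<open>t \<ge> 0\<close> and entails the semigroup law.
\<close>

definition solution_semigroup ::
  "real \<Rightarrow> real \<Rightarrow> real \<Rightarrow> real \<Rightarrow> ((real \<Rightarrow> real) \<Rightarrow> real) \<Rightarrow>
    (real \<Rightarrow> (real \<Rightarrow> real) \<Rightarrow> (real \<Rightarrow> real)) \<Rightarrow> bool" where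
  "solution_semigroup L \<nu> \<beta> \<gamma> f S \<longleftrightarrow> (\<forall>u0\<in>space_H L.
     weak_solution L \<nu> \<beta> \<gamma> f (\<lambda>t. S t u0) \<and> (AE x in lebesgue. S 0 u0 x = u0 x))"

end

theory Submission
  imports Defs
begin

text \<open>
  Testing the equation with \<open>u\<close> itself is justified by projecting onto finitely many Fourier modes,
  which commutes with \<open>u\<^sub>x\<^sub>x\<^sub>x\<close>; it only bounds \<open>|u|\<close> and \<open>\<nu> \<integral> |u\<^sub>x|\<^sup>2\<close> over short times. Decay comes
  from a background profile \<open>\<phi>\<close> with \<open>\<phi>\<^sub>x = 1 - L b\<close>, where the bump \<open>b \<ge> 0\<close> has mass \<open>1\<close> and first
  moment \<open>m\<close>. Let \<open>M t\<close> be the maximum over \<open>s\<close> of \<open>(u t, \<phi>(\<cdot> - s))\<close>. At a maximising \<open>s\<close> the mean of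
  \<open>u\<close> with respect to \<open>b(\<cdot> - s)\<close> vanishes, so that \<open>(u\<^sup>2, b(\<cdot> - s)) \<le> m |u\<^sub>x|\<^sup>2\<close>, and the nonlinearity
  makes \<open>M\<close> grow at least at rate \<open>|u|\<^sup>2 / 2 - L m |u\<^sub>x|\<^sup>2 / 2\<close>, up to terms linear in \<open>|u|\<close>. Since
  \<open>M\<close> is itself of order \<open>|u|\<close>, a solution of size at most \<open>128 A\<close> must drop to size \<open>A\<close> within time \<open>\<tau>\<close>, as
  soon as \<open>m\<close> is a small multiple of \<open>\<tau>\<close> and \<open>A\<close> is large compared with a power of \<open>1 / \<tau>\<close>.
  With \<open>A = \<rho> 128\<^sup>j\<close> and \<open>\<tau> = c / 2\<^sup>j\<close> these times are summable over \<open>j\<close>, whatever the initial size.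
\<close>

section \<open>Square integrable functions over one period\<close>

text \<open>Testing with \<open>u\<close> alone cannot suffice: nonlinearity and dispersion do no
  work, so the energy inequality is linear in \<open>|u|^2\<close>. No linear inequality bounds
  \<open>u\<close> at a positive time independently of the initial datum, and for large positive
  \<beta> this one even permits growth. The superlinear gain must come from a cross term:
  \<open>M\<close> has the size of \<open>|u|\<close> but grows like \<open>|u|^2\<close>. Its
  defect \<open>L (u^2, b) / 2\<close> cannot be absorbed into \<open>|u|^2\<close>, because
  \<open>b\<close> is tall. It is paid from the dissipation, whose time integral is only known to be
  of order \<open>A^2\<close>; this is why \<open>m\<close> has to be proportional to \<tau>.
  Maximising over translates takes the place of a symmetry assumption on \<open>u\<close>: it
  removes the mean of \<open>u\<close> under \<open>b\<close>, the one part of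
  \<open>(u^2, b)\<close> that \<open>|u_x|^2\<close> does not control with a small factor.
  Concentration costs derivatives. A bump of width \<open>2^-j\<close>, realised as the power
  \<open>4^j\<close> of \<open>1 + cos\<close>, has a profile whose third derivative is at most of
  order \<open>(4^j)^3\<close>. The bound \<open>|M| <= |u| |\<phi>|\<close>, compared with a growth
  of order \<tau> \<open>A^2\<close>, asks for one more factor \<open>2^j\<close>; the product is
  \<open>128^j\<close>.\<close>

locale torus =
  fixes L :: real
  assumes L_pos: "0 < L"
begin

text \<open>Restricting the measure instead of the integrand turns \<open>torus_integral\<close> and
  set integrability into plain integrals over a finite measure.\<close>

definition mu :: "real measure" where "mu = lebesgue_on {- L / 2..L / 2}"
abbreviation ip where "ip \<equiv> L2_inner L"
abbreviation nm where "nm \<equiv> L2_norm L"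

text \<open>Periodicity is deliberately absent: only the values on one period matter here, so that
  weights such as the absolute value of \<open>x\<close> belong to the space too.\<close>

definition sq_int :: "(real \<Rightarrow> real) set" where
  "sq_int = {\<phi> \<in> borel_measurable mu. integrable mu (\<lambda>x. (\<phi> x)\<^sup>2)}"

sublocale mu: finite_measure mu
  unfolding mu_def by (rule finite_measure_lebesgue_on) auto

lemma torus_integral_eq: "torus_integral L g = integral\<^sup>L mu g"
  unfolding torus_integral_def set_lebesgue_integral_def mu_def
  by (rule integral_restrict_space[symmetric]) auto

lemma measurable_lebesgue_mu: "\<phi> \<in> borel_measurable lebesgue \<Longrightarrow> \<phi> \<in> borel_measurable mu"
  unfolding mu_def by (rule measurable_restrict_space1)

lemma ip_eq: "ip \<phi> \<psi> = (\<integral>x. \<phi> x * \<psi> x \<partial>mu)"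
  by (simp add: L2_inner_def torus_integral_eq)

lemma torus_integral_eq_ip_one: "torus_integral L g = ip g (\<lambda>x. 1)"
  by (simp add: ip_eq torus_integral_eq)

lemma set_integrable_eq:
  fixes g :: "real \<Rightarrow> real"
  shows "set_integrable lebesgue {- L / 2..L / 2} g \<longleftrightarrow> integrable mu g"
  unfolding set_integrable_def mu_def by (rule integrable_restrict_space[symmetric]) auto

lemma L2_per_sq_int: "\<phi> \<in> L2_per L \<Longrightarrow> \<phi> \<in> sq_int"
  unfolding L2_per_def sq_int_def set_integrable_eq by (auto intro: measurable_lebesgue_mu)

lemma space_H_sq_int: "\<phi> \<in> space_H L \<Longrightarrow> \<phi> \<in> sq_int"
  by (simp add: space_H_def L2_per_sq_int)

lemma space_V_sq_int: "\<phi> \<in> space_V L \<Longrightarrow> \<phi> \<in> sq_int"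
  by (simp add: space_V_def space_H_sq_int)

lemma sq_int_mult_integrable:
  assumes "\<phi> \<in> sq_int" "\<psi> \<in> sq_int"
  shows "integrable mu (\<lambda>x. \<phi> x * \<psi> x)"
proof (rule Bochner_Integration.integrable_bound)
  show "integrable mu (\<lambda>x. (\<phi> x)\<^sup>2 + (\<psi> x)\<^sup>2)"
    using assms by (auto simp: sq_int_def)
  show "(\<lambda>x. \<phi> x * \<psi> x) \<in> borel_measurable mu"
    using assms by (auto simp: sq_int_def)
  have "\<bar>a * b\<bar> \<le> a\<^sup>2 + b\<^sup>2" for a b :: real
    using sum_squares_bound[of a b] sum_squares_bound[of "-a" b] zero_le_power2[of a]
      zero_le_power2[of b] by (simp add: abs_le_iff)
  then show "AE x in mu. norm (\<phi> x * \<psi> x) \<le> norm ((\<phi> x)\<^sup>2 + (\<psi> x)\<^sup>2)"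
    by auto
qed

lemma sq_int_add [simp]:
  assumes "\<phi> \<in> sq_int" "\<psi> \<in> sq_int"
  shows "(\<lambda>x. \<phi> x + \<psi> x) \<in> sq_int"
proof -
  have "integrable mu (\<lambda>x. (\<phi> x)\<^sup>2 + (\<psi> x)\<^sup>2 + 2 * (\<phi> x * \<psi> x))"
    using assms sq_int_mult_integrable[OF assms] by (auto simp: sq_int_def)
  then have "integrable mu (\<lambda>x. (\<phi> x + \<psi> x)\<^sup>2)"
    by (simp add: power2_sum mult.assoc)
  then show ?thesis
    using assms by (auto simp: sq_int_def)
qed

lemma sq_int_cmult [simp]:
  assumes "\<phi> \<in> sq_int"
  shows "(\<lambda>x. c * \<phi> x) \<in> sq_int"
  using assms by (auto simp: sq_int_def power_mult_distrib)

lemma sq_int_minus [simp]: "\<phi> \<in> sq_int \<Longrightarrow> (\<lambda>x. - \<phi> x) \<in> sq_int"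
  using sq_int_cmult[of \<phi> "-1"] by simp

lemma sq_int_diff [simp]:
  assumes "\<phi> \<in> sq_int" "\<psi> \<in> sq_int"
  shows "(\<lambda>x. \<phi> x - \<psi> x) \<in> sq_int"
  using sq_int_add[OF assms(1) sq_int_minus[OF assms(2)]] by simp

lemma sq_int_bounded_mult:
  assumes "\<phi> \<in> sq_int" "\<psi> \<in> borel_measurable mu" "AE x in mu. \<bar>\<psi> x\<bar> \<le> B"
  shows "(\<lambda>x. \<phi> x * \<psi> x) \<in> sq_int"
proof -
  have "integrable mu (\<lambda>x. (\<phi> x * \<psi> x)\<^sup>2)"
  proof (rule Bochner_Integration.integrable_bound)
    show "integrable mu (\<lambda>x. B\<^sup>2 * (\<phi> x)\<^sup>2)"
      using assms by (auto simp: sq_int_def)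
    show "(\<lambda>x. (\<phi> x * \<psi> x)\<^sup>2) \<in> borel_measurable mu"
      using assms by (auto simp: sq_int_def)
    show "AE x in mu. norm ((\<phi> x * \<psi> x)\<^sup>2) \<le> norm (B\<^sup>2 * (\<phi> x)\<^sup>2)"
      using assms(3)
    proof eventually_elim
      case (elim x)
      then have "(\<psi> x)\<^sup>2 \<le> B\<^sup>2" by (rule power2_le_iff_abs_le[THEN iffD2, rotated]) (use elim in linarith)
      then show ?case
        by (simp add: power_mult_distrib mult.commute[of "B\<^sup>2"] mult_left_mono)
    qed
  qed
  then show ?thesis
    using assms by (auto simp: sq_int_def)
qed

lemma sq_int_const [simp, intro]: "(\<lambda>x. c) \<in> sq_int"
  by (simp add: sq_int_def)

lemma sq_int_bounded:
  assumes "\<psi> \<in> borel_measurable mu" "AE x in mu. \<bar>\<psi> x\<bar> \<le> B"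
  shows "\<psi> \<in> sq_int"
  using sq_int_bounded_mult[OF sq_int_const[of 1] assms] by simp

lemma sq_int_sum [simp]:
  assumes "finite K" "\<And>k. k \<in> K \<Longrightarrow> \<phi> k \<in> sq_int"
  shows "(\<lambda>x. \<Sum>k\<in>K. \<phi> k x) \<in> sq_int"
  using assms by (induction K rule: finite_induct) auto

lemma ip_sym: "ip \<phi> \<psi> = ip \<psi> \<phi>"
  by (simp add: ip_eq mult.commute)

lemma ip_add_left:
  assumes "\<phi> \<in> sq_int" "\<xi> \<in> sq_int" "\<psi> \<in> sq_int"
  shows "ip (\<lambda>x. \<phi> x + \<xi> x) \<psi> = ip \<phi> \<psi> + ip \<xi> \<psi>"
  using assms by (simp add: ip_eq distrib_right sq_int_mult_integrable)

lemma ip_diff_left: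
  assumes "\<phi> \<in> sq_int" "\<xi> \<in> sq_int" "\<psi> \<in> sq_int"
  shows "ip (\<lambda>x. \<phi> x - \<xi> x) \<psi> = ip \<phi> \<psi> - ip \<xi> \<psi>"
  using assms by (simp add: ip_eq left_diff_distrib sq_int_mult_integrable)

lemma ip_cmult_left [simp]: "ip (\<lambda>x. c * \<phi> x) \<psi> = c * ip \<phi> \<psi>"
  by (simp add: ip_eq mult.assoc)

lemma ip_cmult_right [simp]: "ip \<psi> (\<lambda>x. c * \<phi> x) = c * ip \<psi> \<phi>"
  by (metis ip_cmult_left ip_sym)

lemma ip_add_right:
  assumes "\<phi> \<in> sq_int" "\<xi> \<in> sq_int" "\<psi> \<in> sq_int"
  shows "ip \<psi> (\<lambda>x. \<phi> x + \<xi> x) = ip \<psi> \<phi> + ip \<psi> \<xi>"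
  using ip_add_left[OF assms] by (metis ip_sym)

lemma ip_diff_right:
  assumes "\<phi> \<in> sq_int" "\<xi> \<in> sq_int" "\<psi> \<in> sq_int"
  shows "ip \<psi> (\<lambda>x. \<phi> x - \<xi> x) = ip \<psi> \<phi> - ip \<psi> \<xi>"
  using ip_diff_left[OF assms] by (metis ip_sym)

lemma ip_sum_left:
  assumes "finite K" "\<And>k. k \<in> K \<Longrightarrow> \<phi> k \<in> sq_int" "\<psi> \<in> sq_int"
  shows "ip (\<lambda>x. \<Sum>k\<in>K. \<phi> k x) \<psi> = (\<Sum>k\<in>K. ip (\<phi> k) \<psi>)"
  using assms
proof (induction K rule: finite_induct)
  case empty
  then show ?case by (simp add: ip_eq)
next
  case (insert k K)
  then show ?case by (simp add: ip_add_left sq_int_sum)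
qed

lemma ip_sum_right:
  assumes "finite K" "\<And>k. k \<in> K \<Longrightarrow> \<phi> k \<in> sq_int" "\<psi> \<in> sq_int"
  shows "ip \<psi> (\<lambda>x. \<Sum>k\<in>K. \<phi> k x) = (\<Sum>k\<in>K. ip \<psi> (\<phi> k))"
  using ip_sum_left[OF assms] by (simp add: ip_sym[of \<psi>])

lemma ip_self_nonneg [simp]: "0 \<le> ip \<phi> \<phi>"
  by (simp add: ip_eq)

lemma nm_nonneg [simp]: "0 \<le> nm \<phi>"
  by (simp add: L2_norm_def)

lemma nm_sq: "(nm \<phi>)\<^sup>2 = ip \<phi> \<phi>"
  by (simp add: L2_norm_def)

lemma nm_sq_integral: "(nm \<phi>)\<^sup>2 = (\<integral>x. (\<phi> x)\<^sup>2 \<partial>mu)"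
  unfolding nm_sq ip_eq by (simp add: power2_eq_square)

lemma nm_minus_commute: "nm (\<lambda>x. \<phi> x - \<psi> x) = nm (\<lambda>x. \<psi> x - \<phi> x)"
  by (simp add: L2_norm_def ip_eq algebra_simps)

lemma nm_sq_add:
  assumes "\<phi> \<in> sq_int" "\<psi> \<in> sq_int"
  shows "(nm (\<lambda>x. \<phi> x + \<psi> x))\<^sup>2 = (nm \<phi>)\<^sup>2 + 2 * ip \<phi> \<psi> + (nm \<psi>)\<^sup>2"
  using assms by (simp add: nm_sq ip_add_left ip_add_right sq_int_add ip_sym)

text \<open>On representatives \<open>ip\<close> is only positive semidefinite, hence the separate
  case of a null function \<psi>; otherwise the usual discriminant argument applies.\<close>

lemma cauchy_schwarz:
  assumes "\<phi> \<in> sq_int" "\<psi> \<in> sq_int"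
  shows "\<bar>ip \<phi> \<psi>\<bar> \<le> nm \<phi> * nm \<psi>"
proof -
  have quad: "0 \<le> a\<^sup>2 * ip \<phi> \<phi> + 2 * a * b * ip \<phi> \<psi> + b\<^sup>2 * ip \<psi> \<psi>" for a b
  proof -
    have "0 \<le> ip (\<lambda>x. a * \<phi> x + b * \<psi> x) (\<lambda>x. a * \<phi> x + b * \<psi> x)" by simp
    also have "\<dots> = a\<^sup>2 * ip \<phi> \<phi> + 2 * a * b * ip \<phi> \<psi> + b\<^sup>2 * ip \<psi> \<psi>"
      using assms by (simp add: ip_add_left ip_add_right sq_int_add sq_int_cmult ip_sym[of \<psi> \<phi>]
          algebra_simps power2_eq_square)
    finally show ?thesis .
  qed
  have "(ip \<phi> \<psi>)\<^sup>2 \<le> ip \<phi> \<phi> * ip \<psi> \<psi>"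
  proof (cases "ip \<psi> \<psi> = 0")
    case True
    have "ip \<phi> \<psi> = 0"
    proof (rule ccontr)
      assume nz: "ip \<phi> \<psi> \<noteq> 0"
      \<comment> \<open>With \<psi> null the form is affine in its second coefficient; this choice
        gives it the value -1.\<close>
      have "0 \<le> ip \<phi> \<phi> + 2 * (- (ip \<phi> \<phi> + 1) / (2 * ip \<phi> \<psi>)) * ip \<phi> \<psi>"
        using quad[of 1 "- (ip \<phi> \<phi> + 1) / (2 * ip \<phi> \<psi>)"] True by simp
      with nz show False by (simp add: field_simps)
    qed
    then show ?thesis using True by simp
  next
    case False
    then have pos: "0 < ip \<psi> \<psi>" using ip_self_nonneg[of \<psi>] by linarith
    have "0 \<le> (ip \<psi> \<psi>)\<^sup>2 * ip \<phi> \<phi> + 2 * ip \<psi> \<psi> * (- ip \<phi> \<psi>) * ip \<phi> \<psi> + (- ip \<phi> \<psi>)\<^sup>2 * ip \<psi> \<psi>"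
      by (rule quad)
    also have "\<dots> = ip \<psi> \<psi> * (ip \<phi> \<phi> * ip \<psi> \<psi> - (ip \<phi> \<psi>)\<^sup>2)"
      by (simp add: algebra_simps power2_eq_square)
    finally show ?thesis using pos by (simp add: zero_le_mult_iff)
  qed
  then have "sqrt ((ip \<phi> \<psi>)\<^sup>2) \<le> sqrt (ip \<phi> \<phi> * ip \<psi> \<psi>)"
    by (rule real_sqrt_le_mono)
  then show ?thesis
    by (simp add: L2_norm_def real_sqrt_mult)
qed

lemma nm_triangle:
  assumes "\<phi> \<in> sq_int" "\<psi> \<in> sq_int"
  shows "nm (\<lambda>x. \<phi> x + \<psi> x) \<le> nm \<phi> + nm \<psi>"
proof (rule power2_le_imp_le)
  show "(nm (\<lambda>x. \<phi> x + \<psi> x))\<^sup>2 \<le> (nm \<phi> + nm \<psi>)\<^sup>2"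
    using nm_sq_add[OF assms] cauchy_schwarz[OF assms] by (simp add: power2_sum)
qed simp

lemma nm_triangle_diff:
  assumes "\<phi> \<in> sq_int" "\<psi> \<in> sq_int" "\<xi> \<in> sq_int"
  shows "nm (\<lambda>x. \<phi> x - \<xi> x) \<le> nm (\<lambda>x. \<phi> x - \<psi> x) + nm (\<lambda>x. \<psi> x - \<xi> x)"
  using nm_triangle[of "\<lambda>x. \<phi> x - \<psi> x" "\<lambda>x. \<psi> x - \<xi> x"] assms by (simp add: sq_int_diff)

lemma nm_bounded_mult:
  assumes "\<phi> \<in> sq_int" "\<psi> \<in> borel_measurable mu" "AE x in mu. \<bar>\<psi> x\<bar> \<le> B" "0 \<le> B"
  shows "nm (\<lambda>x. \<phi> x * \<psi> x) \<le> B * nm \<phi>"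
proof (rule power2_le_imp_le)
  have "(\<integral>x. (\<phi> x * \<psi> x)\<^sup>2 \<partial>mu) \<le> (\<integral>x. B\<^sup>2 * (\<phi> x)\<^sup>2 \<partial>mu)"
  proof (rule integral_mono_AE)
    show "integrable mu (\<lambda>x. (\<phi> x * \<psi> x)\<^sup>2)"
      using sq_int_bounded_mult[OF assms(1-3)] by (simp add: sq_int_def)
    show "integrable mu (\<lambda>x. B\<^sup>2 * (\<phi> x)\<^sup>2)"
      using assms(1) by (simp add: sq_int_def)
    show "AE x in mu. (\<phi> x * \<psi> x)\<^sup>2 \<le> B\<^sup>2 * (\<phi> x)\<^sup>2"
      using assms(3)
    proof eventually_elim
      case (elim x)
      then have "(\<psi> x)\<^sup>2 \<le> B\<^sup>2" using assms(4) by (simp add: power2_le_iff_abs_le)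
      then show ?case
        by (simp add: power_mult_distrib mult.commute[of "B\<^sup>2"] mult_left_mono)
    qed
  qed
  then show "(nm (\<lambda>x. \<phi> x * \<psi> x))\<^sup>2 \<le> (B * nm \<phi>)\<^sup>2"
    by (simp add: nm_sq_integral power_mult_distrib)
  show "0 \<le> B * nm \<phi>" using assms(4) by simp
qed

lemma measure_mu: "measure mu (space mu) = L"
  using L_pos by (simp add: mu_def space_restrict_space measure_restrict_space)

lemma nm_one: "nm (\<lambda>x. 1) = sqrt L"
  using measure_mu by (simp add: L2_norm_def ip_eq)

lemma nm_bounded:
  assumes "\<psi> \<in> borel_measurable mu" "AE x in mu. \<bar>\<psi> x\<bar> \<le> B" "0 \<le> B"
  shows "nm \<psi> \<le> B * sqrt L"
  using nm_bounded_mult[OF sq_int_const[of 1] assms] by (simp add: nm_one)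

lemma continuous_measurable_mu:
  fixes \<psi> :: "real \<Rightarrow> real"
  assumes "continuous_on UNIV \<psi>"
  shows "\<psi> \<in> borel_measurable mu"
proof -
  have "\<psi> \<in> borel_measurable lborel"
    using borel_measurable_continuous_onI[OF assms] by simp
  then show ?thesis
    by (intro measurable_lebesgue_mu measurable_completion)
qed

lemma continuous_sq_int:
  fixes \<psi> :: "real \<Rightarrow> real"
  assumes "continuous_on UNIV \<psi>"
  shows "\<psi> \<in> sq_int"
proof -
  have "continuous_on {-L/2..L/2} (\<lambda>x. (\<psi> x)\<^sup>2)"
    using assms continuous_on_subset by (intro continuous_intros) blast
  then show ?thesis
    using continuous_measurable_mu[OF assms] continuous_imp_integrable_real
    unfolding sq_int_def mu_def by auto
qed

end

section \<open>Trigonometric polynomials\<close>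

context torus
begin

text \<open>Besides integration by parts, this yields the vanishing cubic term of a trigonometric
  polynomial and the recursion for the masses of the bumps.\<close>

lemma integral_deriv_periodic:
  fixes F F' :: "real \<Rightarrow> real"
  assumes "\<And>x. (F has_real_derivative F' x) (at x)" "continuous_on UNIV F'" "\<And>x. F (x + L) = F x"
  shows "(\<integral>x. F' x \<partial>mu) = 0"
proof -
  have "integrable mu F'"
    unfolding mu_def using assms(2) continuous_on_subset
    by (intro continuous_imp_integrable_real) blast
  then have "(\<integral>x. F' x \<partial>mu) = integral {- L / 2..L / 2} F'"
    unfolding mu_def by (rule lebesgue_integral_eq_integral) auto
  also have "(F' has_integral (F (L / 2) - F (- L / 2))) {- L / 2..L / 2}"
    using L_pos assms(1)
    by (intro fundamental_theorem_of_calculus)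
      (auto simp: has_real_derivative_iff_has_vector_derivative[symmetric] intro: has_field_derivative_at_within)
  then have "integral {- L / 2..L / 2} F' = F (L / 2) - F (- L / 2)"
    by (rule integral_unique)
  also have "\<dots> = 0"
    using assms(3)[of "- L / 2"] by simp
  finally show ?thesis .
qed

lemma ip_by_parts:
  assumes "\<And>x. (F has_real_derivative F' x) (at x)" "continuous_on UNIV F'" "\<And>x. F (x + L) = F x"
    and "\<And>x. (G has_real_derivative G' x) (at x)" "continuous_on UNIV G'" "\<And>x. G (x + L) = G x"
  shows "ip F G' = - ip F' G"
proof -
  have cont: "continuous_on UNIV F" "continuous_on UNIV G"
    by (rule DERIV_continuous_on, rule has_field_derivative_at_within, rule assms)+
  have "(\<integral>x. (F' x * G x + F x * G' x) \<partial>mu) = 0"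
  proof (rule integral_deriv_periodic)
    show "((\<lambda>x. F x * G x) has_real_derivative F' x * G x + F x * G' x) (at x)" for x
      using DERIV_mult[OF assms(1,4)] by (simp add: mult.commute add.commute)
    show "continuous_on UNIV (\<lambda>x. F' x * G x + F x * G' x)"
      by (intro continuous_intros assms cont)
  qed (simp add: assms)
  moreover have "F \<in> sq_int" "F' \<in> sq_int" "G \<in> sq_int" "G' \<in> sq_int"
    using assms cont by (auto intro: continuous_sq_int)
  ultimately show ?thesis
    by (simp add: ip_eq sq_int_mult_integrable)
qed

section \<open>The real Fourier basis and its orthonormality\<close>

definition om :: real where "om = 2 * pi / L"

lemma om_pos: "0 < om"
  using L_pos by (simp add: om_def)

lemma om_L: "om * L = 2 * pi"
  using L_pos by (simp add: om_def)

text \<open>Cosines sit at positive indices, sines at negative ones. Keeping the negative frequency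
  inside the sine makes \<open>e k' = k om e (-k)\<close> hold without cases. Index 0 gives the zero
  function, as everything lives in mean zero.\<close>

definition e :: "int \<Rightarrow> real \<Rightarrow> real" where
  "e k x = sqrt (2 / L) * (if 0 < k then cos (of_int k * om * x) else sin (of_int k * om * x))"

lemma cos_per: "cos (of_int k * om * (x + L)) = cos (of_int k * om * x)"
  and sin_per: "sin (of_int k * om * (x + L)) = sin (of_int k * om * x)"
proof -
  have *: "of_int k * om * (x + L) = of_int k * om * x + (2 * pi) * of_int k"
    using om_L by (simp add: algebra_simps)
  show "cos (of_int k * om * (x + L)) = cos (of_int k * om * x)"
    unfolding * by (simp add: cos_add cos_int_2pin sin_int_2pin del: mult.assoc)
  show "sin (of_int k * om * (x + L)) = sin (of_int k * om * x)"
    unfolding * by (simp add: sin_add cos_int_2pin sin_int_2pin del: mult.assoc)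
qed

lemma e_per: "e k (x + L) = e k x"
  by (simp add: e_def cos_per sin_per)

lemma e_0 [simp]: "e 0 x = 0"
  by (simp add: e_def)

lemma e_deriv: "(e k has_real_derivative of_int k * om * e (- k) x) (at x)"
proof (cases k "0::int" rule: linorder_cases)
  case less
  then have "e k = (\<lambda>x. sqrt (2 / L) * sin (of_int k * om * x))"
    by (auto simp: e_def)
  then show ?thesis
    using less by (auto intro!: derivative_eq_intros simp: e_def)
next
  case equal
  then have "e k = (\<lambda>x. 0)" by auto
  then show ?thesis using equal by simp
next
  case greater
  then have "e k = (\<lambda>x. sqrt (2 / L) * cos (of_int k * om * x))"
    by (auto simp: e_def)
  then show ?thesis
    using greater by (auto intro!: derivative_eq_intros simp: e_def)
qed

lemma e_cont [continuous_intros]: "continuous_on S (e k)"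
  by (rule DERIV_continuous_on, rule has_field_derivative_at_within, rule e_deriv)

lemma e_sq_int [simp, intro]: "e k \<in> sq_int"
  by (simp add: continuous_sq_int e_cont)

lemma ip_e_by_parts: "of_int l * ip (e k) (e (- l)) = - (of_int k * ip (e (- k)) (e l))"
proof -
  have "ip (e k) (\<lambda>x. of_int l * om * e (- l) x) = - ip (\<lambda>x. of_int k * om * e (- k) x) (e l)"
    by (rule ip_by_parts) (auto intro!: continuous_intros e_deriv simp: e_per)
  then have "om * (of_int l * ip (e k) (e (- l))) = om * - (of_int k * ip (e (- k)) (e l))"
    by (simp add: mult.assoc mult.left_commute)
  then show ?thesis
    using om_pos by (metis less_irrefl mult_left_cancel)
qed

text \<open>Integrating by parts twice gives \<open>(l^2 - k^2) (e k, e l) = 0\<close>. Between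
  \<open>k\<close> and \<open>-k\<close> the same identity gives both orthogonality and equality of
  the two norms, and these norms are computed from \<open>cos^2 + sin^2 = 1\<close>.\<close>

lemma ip_e:
  assumes "k \<noteq> 0" "l \<noteq> 0"
  shows "ip (e k) (e l) = (if k = l then 1 else 0)"
proof -
  have sq: "of_int (l\<^sup>2) * ip (e k) (e l) = of_int (k\<^sup>2) * ip (e k) (e l)"
    using ip_e_by_parts[of "-l" k] ip_e_by_parts[of l "-k"] 
    by (simp add: power2_eq_square mult.assoc)
  have opp: "ip (e k) (e (- k)) = 0"
    using ip_e_by_parts[of k k] assms(1) ip_sym[of "e k" "e (- k)"] by (simp add: mult_eq_0_iff)
  have swap: "ip (e k) (e k) = ip (e (- k)) (e (- k))"
    using ip_e_by_parts[of "- k" k] assms(1) by simp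
  have "ip (e k) (e k) + ip (e (- k)) (e (- k)) = (\<integral>x. e k x * e k x + e (- k) x * e (- k) x \<partial>mu)"
    by (simp add: ip_eq sq_int_mult_integrable)
  also have "\<dots> = (\<integral>x. 2 / L \<partial>mu)"
  proof (rule Bochner_Integration.integral_cong)
    fix x
    have "(sqrt (2 / L) * a) * (sqrt (2 / L) * a) + (sqrt (2 / L) * b) * (sqrt (2 / L) * b) = 2 / L * (a\<^sup>2 + b\<^sup>2)" for a b
      using L_pos by (simp add: power2_eq_square algebra_simps)
    from this[of "cos (of_int k * om * x)" "sin (of_int k * om * x)"]
    show "e k x * e k x + e (- k) x * e (- k) x = 2 / L"
      using assms(1) by (cases "0 < k") (auto simp: e_def add.commute)
  qed simp
  also have "\<dots> = 2"
    using measure_mu L_pos by simp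
  finally have one: "ip (e k) (e k) = 1"
    using swap by simp
  consider "k = l" | "l = - k" | "k\<^sup>2 \<noteq> l\<^sup>2"
    using power2_eq_iff[of k l] by (metis minus_minus)
  then show ?thesis
  proof cases
    case 2
    then show ?thesis using opp assms by simp
  next
    case 3
    have "(of_int (l\<^sup>2) - of_int (k\<^sup>2)) * ip (e k) (e l) = 0"
      using sq by (simp add: algebra_simps)
    with 3 have "ip (e k) (e l) = 0"
      by (metis eq_iff_diff_eq_0 mult_eq_0_iff of_int_eq_iff)
    with 3 show ?thesis by auto
  qed (use one in simp)
qed

lemma ip_one_e: "ip (\<lambda>x. 1) (e k) = 0"
proof (cases "k = 0")
  case False
  have "ip (\<lambda>x. 1) (\<lambda>x. of_int (- k) * om * e (- (- k)) x) = - ip (\<lambda>x. 0) (e (- k))"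
  proof (rule ip_by_parts)
    show "(e (- k) has_real_derivative of_int (- k) * om * e (- (- k)) x) (at x)" for x
      by (rule e_deriv)
  qed (auto intro!: continuous_intros simp: e_per)
  with False om_pos show ?thesis
    by (simp add: ip_eq del: ip_cmult_right)
qed (simp add: ip_eq)

section \<open>Finite Fourier sums and the orthogonal projections onto them\<close>

definition K :: "nat \<Rightarrow> int set" where "K N = {- int N..int N} - {0}"

definition ts :: "nat \<Rightarrow> (int \<Rightarrow> real) \<Rightarrow> real \<Rightarrow> real" where
  "ts N a x = (\<Sum>k\<in>K N. a k * e k x)"

text \<open>The action of d/dx on coefficients. The index is reflected because \<open>e k'\<close>
  is a multiple of \<open>e (-k)\<close>; the cutoff \<open>N\<close> is unchanged, so all
  derivatives stay in the same finite-dimensional space.\<close>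

definition dcoef :: "(int \<Rightarrow> real) \<Rightarrow> int \<Rightarrow> real" where
  "dcoef a k = - of_int k * om * a (- k)"

definition cf :: "(real \<Rightarrow> real) \<Rightarrow> int \<Rightarrow> real" where
  "cf \<phi> k = ip \<phi> (e k)"

lemma finite_K [simp, intro]: "finite (K N)"
  by (simp add: K_def)

lemma zero_notin_K [simp]: "0 \<notin> K N"
  by (simp add: K_def)

lemma K_mono: "M \<le> N \<Longrightarrow> K M \<subseteq> K N"
  by (auto simp: K_def)

lemma sum_K_neg: "(\<Sum>k\<in>K N. g (- k)) = (\<Sum>k\<in>K N. g k)"
  by (rule sum.reindex_bij_witness[of _ uminus uminus]) (auto simp: K_def)

lemma ts_per: "ts N a (x + L) = ts N a x"
  by (simp add: ts_def e_per)

lemma ts_deriv: "(ts N a has_real_derivative ts N (dcoef a) x) (at x)"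
proof -
  have "((\<lambda>x. \<Sum>k\<in>K N. a k * e k x) has_real_derivative (\<Sum>k\<in>K N. a k * (of_int k * om * e (- k) x))) (at x)"
    by (intro DERIV_sum DERIV_cmult e_deriv)
  also have "(\<Sum>k\<in>K N. a k * (of_int k * om * e (- k) x)) = ts N (dcoef a) x"
    unfolding ts_def dcoef_def
    using sum_K_neg[of "\<lambda>k. a k * (of_int k * om * e (- k) x)" N] by (simp add: mult_ac)
  finally show ?thesis
    by (simp add: ts_def[abs_def])
qed

lemma deriv_ts: "deriv (ts N a) = ts N (dcoef a)"
  by (rule ext) (rule DERIV_imp_deriv, rule ts_deriv)

lemma ts_cont [continuous_intros]: "continuous_on S (ts N a)"
  by (rule DERIV_continuous_on, rule has_field_derivative_at_within, rule ts_deriv)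

lemma ts_sq_int [simp, intro]: "ts N a \<in> sq_int"
  by (simp add: continuous_sq_int ts_cont)

lemma ts_smooth: "ts N a \<in> smooth_per L"
proof -
  have "(deriv ^^ j) (ts N a) = ts N ((dcoef ^^ j) a)" for j
    by (induction j arbitrary: a) (simp_all add: deriv_ts funpow_swap1)
  then show ?thesis
    by (auto simp: smooth_per_def ts_per real_differentiable_def intro: ts_deriv)
qed

lemma ip_ts: 
  assumes "\<phi> \<in> sq_int"
  shows "ip \<phi> (ts N a) = (\<Sum>k\<in>K N. a k * cf \<phi> k)"
  unfolding ts_def[abs_def] using assms by (subst ip_sum_right) (auto simp: cf_def)

lemma cf_ts: "k \<noteq> 0 \<Longrightarrow> cf (ts N a) k = (if k \<in> K N then a k else 0)"
proof -
  assume k: "k \<noteq> 0"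
  have "cf (ts N a) k = (\<Sum>l\<in>K N. a l * ip (e l) (e k))"
    unfolding cf_def ts_def[abs_def] by (subst ip_sum_left) auto
  also have "\<dots> = (\<Sum>l\<in>K N. if l = k then a l else 0)"
  proof (rule sum.cong)
    fix l assume "l \<in> K N"
    then have "l \<noteq> 0" by (metis zero_notin_K)
    then show "a l * ip (e l) (e k) = (if l = k then a l else 0)" using k by (simp add: ip_e)
  qed simp
  finally show ?thesis by simp
qed

lemma ip_ts_ts: "ip (ts N a) (ts N b) = (\<Sum>k\<in>K N. a k * b k)"
proof (subst ip_ts)
  show "(\<Sum>k\<in>K N. b k * cf (ts N a) k) = (\<Sum>k\<in>K N. a k * b k)"
  proof (rule sum.cong)
    fix k assume "k \<in> K N"
    moreover from this have "k \<noteq> 0" by (metis zero_notin_K)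
    ultimately show "b k * cf (ts N a) k = a k * b k" by (simp add: cf_ts)
  qed simp
qed simp

lemma ip_one_ts: "ip (\<lambda>x. 1) (ts N a) = 0"
  by (subst ip_ts) (auto simp: cf_def ip_one_e)

lemma ip_ts_by_parts: "ip (ts N a) (ts M (dcoef b)) = - ip (ts N (dcoef a)) (ts M b)"
  by (rule ip_by_parts) (auto intro!: ts_deriv ts_cont simp: ts_per)

text \<open>The orthogonal projection onto the modes with \<open>0 < |k| <= N\<close>.\<close>

abbreviation P where "P N \<phi> \<equiv> ts N (cf \<phi>)"

lemma ip_P_eq: "\<phi> \<in> sq_int \<Longrightarrow> ip \<phi> (P N \<phi>) = (nm (P N \<phi>))\<^sup>2"
  by (simp add: ip_ts nm_sq ip_ts_ts)

lemma ip_diff_P: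
  assumes "\<phi> \<in> sq_int"
  shows "ip (\<lambda>x. \<phi> x - P N \<phi> x) (ts N a) = 0"
  using assms by (simp add: ip_diff_left ip_ts_ts ip_ts mult.commute)

lemma nm_P_le:
  assumes "\<phi> \<in> sq_int"
  shows "nm (P N \<phi>) \<le> nm \<phi>"
proof -
  have "(nm (P N \<phi>))\<^sup>2 \<le> nm \<phi> * nm (P N \<phi>)"
    using cauchy_schwarz[of \<phi> "P N \<phi>"] ip_P_eq[of \<phi> N] assms by (simp add: abs_le_iff)
  then show ?thesis
    using nm_nonneg[of "P N \<phi>"] nm_nonneg[of \<phi>]
    by (cases "nm (P N \<phi>) = 0") (auto simp: power2_eq_square)
qed

text \<open>Pythagoras. The competitor may carry a constant \<open>c\<close>, because constants are
  orthogonal to the mean-zero remainder; density of trigonometric polynomials with constant term is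
  then enough for \<open>P N\<close> to converge.\<close>

lemma best_approx:
  assumes "\<phi> \<in> sq_int" "ip \<phi> (\<lambda>x. 1) = 0"
  shows "nm (\<lambda>x. \<phi> x - P N \<phi> x) \<le> nm (\<lambda>x. \<phi> x - (c + ts N a x))"
proof (rule power2_le_imp_le)
  let ?r = "\<lambda>x. \<phi> x - P N \<phi> x" and ?q = "\<lambda>x. ts N (\<lambda>k. cf \<phi> k - a k) x + (- c)"
  have r: "?r \<in> sq_int" and q: "?q \<in> sq_int"
    using assms(1) sq_int_diff[of \<phi>] sq_int_add[OF ts_sq_int sq_int_const] by auto
  have "ip (P N \<phi>) (\<lambda>x. 1) = 0"
    by (subst ip_sym) (rule ip_one_ts)
  then have "ip ?r (\<lambda>x. 1) = 0"
    using assms by (simp add: ip_diff_left)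
  then have "ip ?r (\<lambda>x. - c) = 0"
    using ip_cmult_right[of ?r "- c" "\<lambda>x. 1"] by simp
  then have "ip ?r ?q = 0"
    unfolding ip_add_right[OF ts_sq_int sq_int_const r] ip_diff_P[OF assms(1)] by simp
  then have "(nm (\<lambda>x. ?r x + ?q x))\<^sup>2 = (nm ?r)\<^sup>2 + (nm ?q)\<^sup>2"
    using nm_sq_add[OF r q] by simp
  moreover have "(\<lambda>x. ?r x + ?q x) = (\<lambda>x. \<phi> x - (c + ts N a x))"
    by (auto simp: ts_def left_diff_distrib sum_subtractf)
  ultimately show "(nm ?r)\<^sup>2 \<le> (nm (\<lambda>x. \<phi> x - (c + ts N a x)))\<^sup>2"
    by simp
qed simp

section \<open>The algebra of trigonometric polynomials, constants included\<close>

inductive_set TP :: "(real \<Rightarrow> real) set" where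
  TP_cos: "(\<lambda>x. cos (of_int k * om * x)) \<in> TP"
| TP_sin: "(\<lambda>x. sin (of_int k * om * x)) \<in> TP"
| TP_add: "f \<in> TP \<Longrightarrow> g \<in> TP \<Longrightarrow> (\<lambda>x. f x + g x) \<in> TP"
| TP_cmult: "f \<in> TP \<Longrightarrow> (\<lambda>x. c * f x) \<in> TP"

lemma TP_const: "(\<lambda>x. c) \<in> TP"
  using TP_cmult[OF TP_cos[of 0], of c] by simp

lemma TP_diff: "f \<in> TP \<Longrightarrow> g \<in> TP \<Longrightarrow> (\<lambda>x. f x - g x) \<in> TP"
  using TP_add[OF _ TP_cmult[of g "-1"], of f] by simp

lemma TP_mult_cos:
  assumes "f \<in> TP" shows "(\<lambda>x. cos (of_int k * om * x) * f x) \<in> TP"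
  using assms
proof induction
  case (TP_cos l)
  have "(\<lambda>x. (1/2) * (cos (of_int (k - l) * om * x) + cos (of_int (k + l) * om * x))) \<in> TP"
    by (intro TP.intros)
  then show ?case
    by (simp add: cos_times_cos left_diff_distrib distrib_right)
next
  case (TP_sin l)
  have "(\<lambda>x. (1/2) * (sin (of_int (k + l) * om * x) - sin (of_int (k - l) * om * x))) \<in> TP"
    by (intro TP_diff TP.intros)
  then show ?case
    by (simp add: cos_times_sin left_diff_distrib distrib_right)
next
  case (TP_add f g)
  then show ?case by (simp add: distrib_left TP.TP_add)
next
  case (TP_cmult f c)
  then show ?case by (simp add: mult.left_commute[of _ c] TP.TP_cmult)
qed

lemma TP_mult_sin:
  assumes "f \<in> TP" shows "(\<lambda>x. sin (of_int k * om * x) * f x) \<in> TP"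
  using assms
proof induction
  case (TP_cos l)
  have "(\<lambda>x. (1/2) * (sin (of_int (k + l) * om * x) + sin (of_int (k - l) * om * x))) \<in> TP"
    by (intro TP.intros)
  then show ?case
    by (simp add: sin_times_cos left_diff_distrib distrib_right)
next
  case (TP_sin l)
  have "(\<lambda>x. (1/2) * (cos (of_int (k - l) * om * x) - cos (of_int (k + l) * om * x))) \<in> TP"
    by (intro TP_diff TP.intros)
  then show ?case
    by (simp add: sin_times_sin left_diff_distrib distrib_right)
next
  case (TP_add f g)
  then show ?case by (simp add: distrib_left TP.TP_add)
next
  case (TP_cmult f c)
  then show ?case by (simp add: mult.left_commute[of _ c] TP.TP_cmult)
qed

lemma TP_mult:
  assumes "f \<in> TP" "g \<in> TP" shows "(\<lambda>x. f x * g x) \<in> TP"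
  using assms(1)
proof induction
  case (TP_add f h)
  then show ?case by (simp add: distrib_right TP.TP_add)
next
  case (TP_cmult f c)
  then show ?case by (simp add: mult.assoc TP.TP_cmult)
qed (intro TP_mult_cos TP_mult_sin assms)+

lemma TP_power: "f \<in> TP \<Longrightarrow> (\<lambda>x. f x ^ n) \<in> TP"
  by (induction n) (simp_all add: TP_const TP_mult)

lemma TP_shift:
  assumes "f \<in> TP" shows "(\<lambda>x. f (x + s)) \<in> TP"
  using assms
proof induction
  case (TP_cos k)
  have "(\<lambda>x. cos (of_int k * om * s) * cos (of_int k * om * x) - sin (of_int k * om * s) * sin (of_int k * om * x)) \<in> TP"
    by (intro TP_diff TP.intros)
  then show ?case
    by (simp add: algebra_simps cos_add)
next
  case (TP_sin k)
  have "(\<lambda>x. cos (of_int k * om * s) * sin (of_int k * om * x) + sin (of_int k * om * s) * cos (of_int k * om * x)) \<in> TP"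
    by (intro TP.intros)
  then show ?case
    by (simp add: algebra_simps sin_add)
qed (simp_all add: TP_add TP_cmult)

text \<open>The inductive form of \<open>TP\<close> is suited to products and translates, the normal
  form to derivatives and integrals. The support condition lets two representations be lifted to a
  common cutoff when they are added.\<close>

lemma TP_sum_rep:
  assumes "f \<in> TP"
  shows "\<exists>N c a. (\<forall>k. k \<notin> K N \<longrightarrow> a k = 0) \<and> f = (\<lambda>x. c + ts N a x)"
  using assms
proof induction
  case (TP_cos k)
  show ?case
  proof (cases "k = 0")
    case True
    then show ?thesis
      by (intro exI[of _ 0] exI[of _ 1] exI[of _ "\<lambda>_. 0"]) (auto simp: ts_def)
  next
    case False
    have "ts (nat \<bar>k\<bar>) (\<lambda>l. if l = \<bar>k\<bar> then sqrt (L / 2) else 0) x = cos (of_int k * om * x)" for x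
    proof -
      have "ts (nat \<bar>k\<bar>) (\<lambda>l. if l = \<bar>k\<bar> then sqrt (L / 2) else 0) x = (\<Sum>l\<in>K (nat \<bar>k\<bar>). if l = \<bar>k\<bar> then sqrt (L / 2) * e l x else 0)"
        unfolding ts_def by (intro sum.cong) auto
      also have "\<dots> = sqrt (L / 2) * e \<bar>k\<bar> x"
        using False by (simp add: K_def)
      also have "\<dots> = cos (of_int k * om * x)"
        using False L_pos by (cases "0 < k") (auto simp: e_def real_sqrt_mult[symmetric] mult.assoc[symmetric])
      finally show ?thesis .
    qed
    then show ?thesis
      using False
      by (intro exI[of _ "nat \<bar>k\<bar>"] exI[of _ 0] exI[of _ "\<lambda>l. if l = \<bar>k\<bar> then sqrt (L / 2) else 0"]) (auto simp: K_def)
  qed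
next
  case (TP_sin k)
  show ?case
  proof (cases "k = 0")
    case True
    then show ?thesis
      by (intro exI[of _ 0] exI[of _ 0] exI[of _ "\<lambda>_. 0"]) (auto simp: ts_def)
  next
    case False
    \<comment> \<open>\<open>e\<close> at the index \<open>-|k|\<close> is a sine of negative
      frequency, so the sign flips exactly for positive \<open>k\<close>.\<close>
    let ?s = "if 0 < k then - sqrt (L / 2) else sqrt (L / 2)"
    have "ts (nat \<bar>k\<bar>) (\<lambda>l. if l = - \<bar>k\<bar> then ?s else 0) x = sin (of_int k * om * x)" for x
    proof -
      have "ts (nat \<bar>k\<bar>) (\<lambda>l. if l = - \<bar>k\<bar> then ?s else 0) x = (\<Sum>l\<in>K (nat \<bar>k\<bar>). if l = - \<bar>k\<bar> then ?s * e l x else 0)"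
        unfolding ts_def by (intro sum.cong) auto
      also have "\<dots> = ?s * e (- \<bar>k\<bar>) x"
        using False by (simp add: K_def)
      also have "\<dots> = sin (of_int k * om * x)"
        using False L_pos by (cases "0 < k") (auto simp: e_def real_sqrt_mult[symmetric] mult.assoc[symmetric])
      finally show ?thesis .
    qed
    then show ?thesis
      using False
      by (intro exI[of _ "nat \<bar>k\<bar>"] exI[of _ 0] exI[of _ "\<lambda>l. if l = - \<bar>k\<bar> then ?s else 0"]) (auto simp: K_def)
  qed
next
  case (TP_add f g)
  then obtain N c a M d b where
    f: "\<forall>k. k \<notin> K N \<longrightarrow> a k = 0" "f = (\<lambda>x. c + ts N a x)" and
    g: "\<forall>k. k \<notin> K M \<longrightarrow> b k = 0" "g = (\<lambda>x. d + ts M b x)"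
    by blast
  let ?R = "max N M"
  have "ts N a x = ts ?R a x" "ts M b x = ts ?R b x" for x
    unfolding ts_def using f(1) g(1) by (auto intro!: sum.mono_neutral_left simp: K_def)
  then have "(\<lambda>x. f x + g x) = (\<lambda>x. (c + d) + ts ?R (\<lambda>k. a k + b k) x)"
    by (auto simp: f(2) g(2) ts_def distrib_right sum.distrib)
  moreover have "\<forall>k. k \<notin> K ?R \<longrightarrow> a k + b k = 0"
  proof (intro allI impI)
    fix k assume "k \<notin> K ?R"
    then have "k \<notin> K N" "k \<notin> K M"
      using K_mono[of N ?R] K_mono[of M ?R] by (meson max.cobounded1 max.cobounded2 subsetD)+
    then show "a k + b k = 0" using f(1) g(1) by simp
  qed
  ultimately show ?case
    by (intro exI[of _ ?R] exI[of _ "c + d"] exI[of _ "\<lambda>k. a k + b k"] conjI)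
next
  case (TP_cmult f d)
  then obtain N c a where
    f: "\<forall>k. k \<notin> K N \<longrightarrow> a k = 0" "f = (\<lambda>x. c + ts N a x)"
    by blast
  then show ?case
    by (intro exI[of _ N] exI[of _ "d * c"] exI[of _ "\<lambda>k. d * a k"])
      (auto simp: ts_def distrib_left sum_distrib_left mult.assoc)
qed

lemma TP_rep:
  assumes "f \<in> TP"
  obtains N0 c a where "\<And>N. N0 \<le> N \<Longrightarrow> f = (\<lambda>x. c + ts N a x)"
proof -
  obtain N c a where *: "\<forall>k. k \<notin> K N \<longrightarrow> a k = 0" "f = (\<lambda>x. c + ts N a x)"
    using TP_sum_rep[OF assms] by blast
  have "ts N a x = ts M a x" if "N \<le> M" for M x
    unfolding ts_def using *(1) K_mono[OF that] by (intro sum.mono_neutral_left) auto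
  with * that show ?thesis by metis
qed

lemma TP_const_ts: "(\<lambda>x. c + ts N a x) \<in> TP"
proof -
  have e: "e k \<in> TP" for k
    unfolding e_def[abs_def] by (cases "0 < k") (auto intro: TP.intros)
  have "(\<lambda>x. \<Sum>k\<in>A. a k * e k x) \<in> TP" if "finite A" for A
    using that
  proof (induction A rule: finite_induct)
    case (insert k A)
    then show ?case using TP_add[OF TP_cmult[OF e[of k], of "a k"]] by simp
  qed (simp add: TP_const)
  then show ?thesis
    unfolding ts_def[abs_def] by (intro TP_add TP_const) auto
qed

lemma ts_TP: "ts N a \<in> TP"
  using TP_const_ts[of 0 N a] by simp

end

section \<open>Completeness of the trigonometric system\<close>

context torus
begin

lemma AE_mu_negligible:
  assumes "negligible N" "\<And>x. x \<in> {- L / 2..L / 2} \<Longrightarrow> x \<notin> N \<Longrightarrow> Q x"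
  shows "AE x in mu. Q x"
proof -
  have "AE x in lebesgue. x \<notin> N"
    using assms(1) by (simp add: negligible_iff_null_sets AE_not_in)
  then have "AE x in lebesgue. x \<in> {- L / 2..L / 2} \<longrightarrow> Q x"
    by eventually_elim (use assms(2) in blast)
  then show ?thesis
    unfolding mu_def by (subst AE_restrict_space_iff) auto
qed

lemma AE_mu_I: "(\<And>x. x \<in> {- L / 2..L / 2} \<Longrightarrow> Q x) \<Longrightarrow> AE x in mu. Q x"
  by (rule AE_mu_negligible[of "{}"]) auto

lemma nm_tendsto_0:
  assumes \<phi>: "\<phi> \<in> borel_measurable mu" and s: "\<And>n::nat. s n \<in> borel_measurable mu"
    and lim: "AE x in mu. (\<lambda>n. s n x) \<longlonglongrightarrow> \<phi> x"
    and dom: "w \<in> sq_int" "\<And>n. AE x in mu. \<bar>\<phi> x - s n x\<bar> \<le> w x"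
  shows "(\<lambda>n. nm (\<lambda>x. \<phi> x - s n x)) \<longlonglongrightarrow> 0"
proof -
  have "(\<lambda>n. \<integral>x. (\<phi> x - s n x)\<^sup>2 \<partial>mu) \<longlonglongrightarrow> (\<integral>x. 0 \<partial>mu)"
  proof (rule integral_dominated_convergence)
    show "integrable mu (\<lambda>x. (w x)\<^sup>2)" using dom(1) by (simp add: sq_int_def)
    show "AE x in mu. (\<lambda>n. (\<phi> x - s n x)\<^sup>2) \<longlonglongrightarrow> 0"
      using lim
    proof eventually_elim
      case (elim x)
      have "(\<lambda>n. (\<phi> x - s n x)\<^sup>2) \<longlonglongrightarrow> (\<phi> x - \<phi> x)\<^sup>2"
        by (intro tendsto_intros elim)
      then show ?case by simp
    qed
    show "AE x in mu. norm ((\<phi> x - s n x)\<^sup>2) \<le> (w x)\<^sup>2" for n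
      using dom(2)[of n]
      by eventually_elim (simp add: abs_le_square_iff[symmetric])
  qed (use \<phi> s in measurable)
  then have "(\<lambda>n. sqrt ((nm (\<lambda>x. \<phi> x - s n x))\<^sup>2)) \<longlonglongrightarrow> sqrt 0"
    by (intro tendsto_real_sqrt) (simp add: nm_sq_integral)
  then show ?thesis by simp
qed

text \<open>On the unit circle a real linear functional is a combination of cosine and sine, so
  polynomials of two real variables pull back to trigonometric polynomials. This is the bridge to
  Stone-Weierstrass.\<close>

lemma TP_of_polynomial:
  assumes "real_polynomial_function p"
  shows "(\<lambda>x. p (cis (om * x))) \<in> TP"
  using assms
proof induction
  case (linear f)
  have "f (cis (om * x)) = f 1 * cos (of_int 1 * om * x) + f \<i> * sin (of_int 1 * om * x)" for x
  proof -
    have "cis (om * x) = cos (om * x) *\<^sub>R 1 + sin (om * x) *\<^sub>R \<i>"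
      by (simp add: complex_eq_iff)
    then show ?thesis
      using linear by (simp add: bounded_linear.linear linear_add linear_scale mult.commute)
  qed
  then show ?case
    by (simp only:) (intro TP_add TP_cmult TP_cos TP_sin)
next
  case (const c)
  show ?case by (rule TP_const)
next
  case (add f g)
  then show ?case by (intro TP_add)
next
  case (mult f g)
  then show ?case by (intro TP_mult)
qed

text \<open>The period is wrapped around the unit circle, where equal end values make the
  transported function continuous and polynomial approximation applies.\<close>

lemma TP_uniform_approx:
  fixes q :: "real \<Rightarrow> real"
  assumes q: "continuous_on {- L / 2..L / 2} q" "q (- L / 2) = q (L / 2)" and d: "0 < d"
  obtains h where "h \<in> TP" "\<And>x. x \<in> {- L / 2..L / 2} \<Longrightarrow> \<bar>q x - h x\<bar> < d"
proof -
  define F where "F z = q (Arg z / om)" for z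
  let ?c = "\<lambda>x. cis (om * x)" and ?I = "{- L / 2..L / 2}"
  have om2: "om * (L / 2) = pi" using om_L by simp
  have F: "F (?c x) = q x" if "x \<in> ?I" for x
  proof (cases "x = - L / 2")
    case True
    have "om * x = - pi" using True om2 by simp
    then have "?c x = cis pi" by (simp only:) (simp add: complex_eq_iff)
    then have "F (?c x) = F (cis pi)" by simp
    also have "\<dots> = q (L / 2)"
    proof -
      have "pi / om = L / 2" using om2 om_pos by (simp add: field_simps)
      moreover have "Arg (cis pi) = pi" by (rule Arg_cis) simp
      ultimately show ?thesis by (simp only: F_def)
    qed
    finally show ?thesis using q(2) True by simp
  next
    case False
    with that have "- (L / 2) < x" "x \<le> L / 2" by auto
    then have "om * - (L / 2) < om * x" "om * x \<le> om * (L / 2)"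
      using om_pos by (intro mult_strict_left_mono mult_left_mono; simp)+
    then have "om * x \<in> {- pi<..pi}"
      using om2 by simp
    then show ?thesis
      using om_pos by (simp add: F_def Arg_cis)
  qed
  have img: "?c ` ?I = sphere 0 1"
  proof
    show "sphere 0 1 \<subseteq> ?c ` ?I"
    proof
      fix z :: complex assume z: "z \<in> sphere 0 1"
      then have "cis (Arg z) = z"
        using cis_Arg[of z] by (cases "z = 0") (auto simp: sgn_div_norm)
      moreover have "Arg z / om \<in> ?I"
        using Arg_bounded[of z] om_pos om2 by (auto simp: field_simps)
      ultimately show "z \<in> ?c ` ?I"
        using om_pos by (intro image_eqI[of _ _ "Arg z / om"]) auto
    qed
  qed auto
  \<comment> \<open>\<open>Arg\<close> jumps at -1, so continuity is not inherited from it. Instead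
    the wrapping map is a quotient map: the preimage of a closed set under \<open>F\<close> is the
    image of a compact set.\<close>
  have "continuous_on (sphere 0 1) F"
  proof (subst continuous_on_closed_vimage)
    show "\<forall>B. closed B \<longrightarrow> closed (F -` B \<inter> sphere 0 1)"
    proof (intro allI impI)
      fix B :: "real set" assume B: "closed B"
      have "F -` B \<inter> c ` S = c ` (q -` B \<inter> S)" if "\<And>x. x \<in> S \<Longrightarrow> F (c x) = q x" for S c
        using that by force
      from this[of ?I ?c] have "F -` B \<inter> sphere 0 1 = ?c ` (q -` B \<inter> ?I)"
        using F by (simp only: img)
      moreover have "closed (q -` B \<inter> ?I)"
        using q(1) B continuous_on_closed_vimage[of ?I q] by simp
      then have "compact (q -` B \<inter> ?I)"
        by (metis compact_Icc compact_Int_closed inf.commute inf.left_idem)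
      then have "compact (?c ` (q -` B \<inter> ?I))"
        by (intro compact_continuous_image continuous_intros)
      ultimately show "closed (F -` B \<inter> sphere 0 1)"
        by (simp add: compact_imp_closed)
    qed
  qed auto
  then obtain p where p: "real_polynomial_function p" "\<And>z. z \<in> sphere 0 1 \<Longrightarrow> \<bar>F z - p z\<bar> < d"
    using Stone_Weierstrass_real_polynomial_function[of "sphere 0 1" F d] d by auto
  show ?thesis
  proof (rule that)
    show "(\<lambda>x. p (?c x)) \<in> TP"
      by (rule TP_of_polynomial[OF p(1)])
    show "\<bar>q x - p (?c x)\<bar> < d" if "x \<in> ?I" for x
      using p(2)[of "?c x"] F[OF that] by simp
  qed
qed

lemma TP_sq_int:
  assumes "f \<in> TP" shows "f \<in> sq_int"
proof -
  obtain N0 c a where "\<And>N. N0 \<le> N \<Longrightarrow> f = (\<lambda>x. c + ts N a x)"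
    using TP_rep[OF assms] by blast
  from this[OF order_refl] show ?thesis
    using sq_int_add[OF sq_int_const ts_sq_int] by simp
qed

lemma TP_approx_continuous:
  fixes q :: "real \<Rightarrow> real"
  assumes q: "continuous_on UNIV q" "q (- L / 2) = q (L / 2)" and "0 < d"
  obtains h where "h \<in> TP" "nm (\<lambda>x. q x - h x) < d"
proof -
  define d' where "d' = d / (2 * sqrt L)"
  have d': "0 < d'" using \<open>0 < d\<close> L_pos by (simp add: d'_def)
  obtain h where h: "h \<in> TP" "\<And>x. x \<in> {- L / 2..L / 2} \<Longrightarrow> \<bar>q x - h x\<bar> < d'"
    using TP_uniform_approx[OF continuous_on_subset[OF q(1)] q(2) d'] by auto
  have "nm (\<lambda>x. q x - h x) \<le> d' * sqrt L"
  proof (rule nm_bounded)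
    show "(\<lambda>x. q x - h x) \<in> borel_measurable mu"
      using sq_int_diff[OF continuous_sq_int[OF q(1)] TP_sq_int[OF h(1)]] by (simp add: sq_int_def)
    show "AE x in mu. \<bar>q x - h x\<bar> \<le> d'"
      using h(2) by (intro AE_mu_I) (simp add: less_imp_le)
  qed (use d' in simp)
  also have "\<dots> < d"
    using \<open>0 < d\<close> L_pos by (simp add: d'_def)
  finally show ?thesis using that h(1) by blast
qed

text \<open>A measurable function is an almost everywhere limit of continuous ones; these are
  modified so that dominated convergence applies and the end values agree.\<close>

lemma continuous_approx_bounded:
  assumes \<phi>: "\<phi> \<in> borel_measurable mu" and bound: "\<And>x. \<bar>\<phi> x\<bar> \<le> B" and "0 < d"
  obtains q where "continuous_on UNIV q" "q (- L / 2) = q (L / 2)" "nm (\<lambda>x. \<phi> x - q x) < d"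
proof -
  have "\<phi> measurable_on {- L / 2..L / 2}"
    using \<phi> by (simp add: measurable_on_iff_borel_measurable mu_def)
  then obtain N g where N: "negligible N" and g: "\<And>n. continuous_on UNIV (g n)"
    and lim: "\<And>x. x \<notin> N \<Longrightarrow> (\<lambda>n. g n x) \<longlonglongrightarrow> (if x \<in> {- L / 2..L / 2} then \<phi> x else 0)"
    unfolding measurable_on_def by blast
  \<comment> \<open>The cutoff vanishes at both end points and is eventually 1 at each interior
    point; clamping to \<open>[-B, B]\<close> below supplies the dominating constant.\<close>
  define cut where "cut n x = max 0 (min 1 (real n * (L / 2 - \<bar>x\<bar>)))" for n x
  define q where "q n x = cut n x * max (- B) (min B (g n x))" for n x
  have B: "0 \<le> B" using bound[of 0] by linarith
  have cut01: "0 \<le> cut n x" "cut n x \<le> 1" for n x by (auto simp: cut_def)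
  have cont: "continuous_on UNIV (q n)" for n
    unfolding q_def[abs_def] cut_def by (intro continuous_intros g)
  have "(\<lambda>n. nm (\<lambda>x. \<phi> x - q n x)) \<longlonglongrightarrow> 0"
  proof (rule nm_tendsto_0[where w = "\<lambda>x. 2 * B"])
    show "AE x in mu. (\<lambda>n. q n x) \<longlonglongrightarrow> \<phi> x"
    proof (rule AE_mu_negligible)
      show "negligible (N \<union> {- L / 2, L / 2})"
        using N by (auto simp: negligible_Un)
      fix x assume x: "x \<in> {- L / 2..L / 2}" "x \<notin> N \<union> {- L / 2, L / 2}"
      then have pos: "0 < L / 2 - \<bar>x\<bar>" by auto
      obtain n0 :: nat where n0: "1 < real n0 * (L / 2 - \<bar>x\<bar>)"
        using reals_Archimedean3[OF pos] by blast
      have "cut n x = 1" if "n0 \<le> n" for n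
      proof -
        have "real n0 * (L / 2 - \<bar>x\<bar>) \<le> real n * (L / 2 - \<bar>x\<bar>)"
          using that pos by (intro mult_right_mono) auto
        then show ?thesis using n0 by (simp add: cut_def)
      qed
      then have "(\<lambda>n. cut n x) \<longlonglongrightarrow> 1"
        by (intro tendsto_eventually) (auto simp: eventually_sequentially)
      moreover have "(\<lambda>n. max (- B) (min B (g n x))) \<longlonglongrightarrow> max (- B) (min B (\<phi> x))"
        using lim[of x] x by (intro tendsto_intros) auto
      ultimately have "(\<lambda>n. q n x) \<longlonglongrightarrow> 1 * max (- B) (min B (\<phi> x))"
        unfolding q_def by (rule tendsto_mult)
      then show "(\<lambda>n. q n x) \<longlonglongrightarrow> \<phi> x"
        using bound[of x] by (simp add: min_def max_def abs_le_iff split: if_splits)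
    qed
    show "AE x in mu. \<bar>\<phi> x - q n x\<bar> \<le> 2 * B" for n
    proof (rule AE_I2)
      fix x
      have "\<bar>q n x\<bar> \<le> 1 * B"
        unfolding q_def abs_mult using cut01[of n x] B by (intro mult_mono) auto
      then show "\<bar>\<phi> x - q n x\<bar> \<le> 2 * B"
        using bound[of x] by linarith
    qed
  qed (use \<phi> cont in \<open>auto intro: continuous_measurable_mu\<close>)
  then obtain n where "nm (\<lambda>x. \<phi> x - q n x) < d"
    using \<open>0 < d\<close> by (force dest: order_tendstoD(2) simp: eventually_sequentially)
  moreover have "q n (- L / 2) = q n (L / 2)"
    using L_pos by (simp add: q_def cut_def)
  ultimately show ?thesis
    using that cont by blast
qed

lemma bounded_approx:
  assumes \<phi>: "\<phi> \<in> sq_int" and "0 < d"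
  obtains \<psi> B where "\<psi> \<in> borel_measurable mu" "\<forall>x. \<bar>\<psi> x\<bar> \<le> B" "nm (\<lambda>x. \<phi> x - \<psi> x) < d"
proof -
  define s where "s n x = max (- real n) (min (real n) (\<phi> x))" for n x
  have meas: "s n \<in> borel_measurable mu" for n
    using \<phi> by (auto simp: s_def[abs_def] sq_int_def)
  have "(\<lambda>n. nm (\<lambda>x. \<phi> x - s n x)) \<longlonglongrightarrow> 0"
  proof (rule nm_tendsto_0[where w = "\<lambda>x. \<bar>\<phi> x\<bar>"])
    show "(\<lambda>x. \<bar>\<phi> x\<bar>) \<in> sq_int" using \<phi> by (auto simp: sq_int_def)
    show "AE x in mu. (\<lambda>n. s n x) \<longlonglongrightarrow> \<phi> x"
    proof (rule AE_I2)
      fix x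
      obtain n0 :: nat where "\<bar>\<phi> x\<bar> \<le> real n0" using real_arch_simple by blast
      then have "s n x = \<phi> x" if "n0 \<le> n" for n
        using that by (auto simp: s_def)
      then show "(\<lambda>n. s n x) \<longlonglongrightarrow> \<phi> x"
        by (intro tendsto_eventually) (auto simp: eventually_sequentially)
    qed
    show "AE x in mu. \<bar>\<phi> x - s n x\<bar> \<le> \<bar>\<phi> x\<bar>" for n
      by (rule AE_I2) (auto simp: s_def)
  qed (use \<phi> meas in \<open>auto simp: sq_int_def\<close>)
  then obtain n where "nm (\<lambda>x. \<phi> x - s n x) < d"
    using \<open>0 < d\<close> by (force dest: order_tendstoD(2) simp: eventually_sequentially)
  moreover have "\<bar>s n x\<bar> \<le> real n" for x by (auto simp: s_def)
  ultimately show ?thesis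
    using that meas by blast
qed

lemma TP_dense:
  assumes \<phi>: "\<phi> \<in> sq_int" and "0 < d"
  obtains h where "h \<in> TP" "nm (\<lambda>x. \<phi> x - h x) < d"
proof -
  have d3: "0 < d / 3" using \<open>0 < d\<close> by simp
  obtain \<psi> B where \<psi>: "\<psi> \<in> borel_measurable mu" "\<forall>x. \<bar>\<psi> x\<bar> \<le> B" "nm (\<lambda>x. \<phi> x - \<psi> x) < d / 3"
    by (rule bounded_approx[OF \<phi> d3])
  obtain q where q: "continuous_on UNIV q" "q (- L / 2) = q (L / 2)" "nm (\<lambda>x. \<psi> x - q x) < d / 3"
    by (rule continuous_approx_bounded[OF \<psi>(1) \<psi>(2)[rule_format] d3])
  obtain h where h: "h \<in> TP" "nm (\<lambda>x. q x - h x) < d / 3"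
    by (rule TP_approx_continuous[OF q(1,2) d3])
  have sq: "\<psi> \<in> sq_int" "q \<in> sq_int" "h \<in> sq_int"
    using sq_int_bounded[OF \<psi>(1)] \<psi>(2) q(1) h(1) by (auto intro: continuous_sq_int TP_sq_int)
  have "nm (\<lambda>x. \<phi> x - h x) < d"
    using nm_triangle_diff[OF \<phi> sq(1,3)] nm_triangle_diff[OF sq] \<psi>(3) q(3) h(2) by linarith
  with h(1) that show ?thesis by blast
qed

lemma P_tendsto:
  assumes \<phi>: "\<phi> \<in> sq_int" "ip \<phi> (\<lambda>x. 1) = 0"
  shows "(\<lambda>N. nm (\<lambda>x. \<phi> x - P N \<phi> x)) \<longlonglongrightarrow> 0"
proof (rule LIMSEQ_I)
  fix d :: real assume "0 < d"
  obtain h where h: "h \<in> TP" "nm (\<lambda>x. \<phi> x - h x) < d"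
    by (rule TP_dense[OF \<phi>(1) \<open>0 < d\<close>])
  obtain N0 c a where rep: "\<And>N. N0 \<le> N \<Longrightarrow> h = (\<lambda>x. c + ts N a x)"
    using TP_rep[OF h(1)] by blast
  have "norm (nm (\<lambda>x. \<phi> x - P N \<phi> x) - 0) < d" if "N0 \<le> N" for N
    using best_approx[OF \<phi>, of N c a] rep[OF that] h(2) by simp
  then show "\<exists>N0. \<forall>N\<ge>N0. norm (nm (\<lambda>x. \<phi> x - P N \<phi> x) - 0) < d"
    by blast
qed

text \<open>The filter is left free because the lemma serves both \<open>N\<close> tending to
  infinity and continuity in time.\<close>

lemma ip_tendsto:
  assumes "\<And>n. u n \<in> sq_int" "\<phi> \<in> sq_int" "((\<lambda>n. nm (\<lambda>x. \<phi> x - u n x)) \<longlongrightarrow> 0) F"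
    and "\<And>n. v n \<in> sq_int" "\<psi> \<in> sq_int" "((\<lambda>n. nm (\<lambda>x. \<psi> x - v n x)) \<longlongrightarrow> 0) F"
  shows "((\<lambda>n. ip (u n) (v n)) \<longlongrightarrow> ip \<phi> \<psi>) F"
proof -
  let ?a = "\<lambda>n. nm (\<lambda>x. \<phi> x - u n x)" and ?b = "\<lambda>n. nm (\<lambda>x. \<psi> x - v n x)"
  have "((\<lambda>n. ip (u n) (v n) - ip \<phi> \<psi>) \<longlongrightarrow> 0) F"
  proof (rule Lim_null_comparison)
    have bd: "\<bar>ip (u n) (v n) - ip \<phi> \<psi>\<bar> \<le> ?a n * nm \<psi> + nm \<phi> * ?b n + ?a n * ?b n" for n
    proof -
      have sq: "(\<lambda>x. \<phi> x - u n x) \<in> sq_int" "(\<lambda>x. \<psi> x - v n x) \<in> sq_int"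
        using assms by auto
      have "ip (u n) (v n) - ip \<phi> \<psi> = - ip (\<lambda>x. \<phi> x - u n x) \<psi> - ip \<phi> (\<lambda>x. \<psi> x - v n x)
          + ip (\<lambda>x. \<phi> x - u n x) (\<lambda>x. \<psi> x - v n x)"
        using assms sq by (simp add: ip_diff_left ip_diff_right)
      then show ?thesis
        using cauchy_schwarz[OF sq(1) assms(5)] cauchy_schwarz[OF assms(2) sq(2)] cauchy_schwarz[OF sq]
        by linarith
    qed
    show "\<forall>\<^sub>F n in F. norm (ip (u n) (v n) - ip \<phi> \<psi>) \<le> ?a n * nm \<psi> + nm \<phi> * ?b n + ?a n * ?b n"
      using bd by simp
    have "((\<lambda>n. ?a n * nm \<psi> + nm \<phi> * ?b n + ?a n * ?b n) \<longlongrightarrow> 0 * nm \<psi> + nm \<phi> * 0 + 0 * 0) F"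
      by (intro tendsto_intros assms)
    then show "((\<lambda>n. ?a n * nm \<psi> + nm \<phi> * ?b n + ?a n * ?b n) \<longlongrightarrow> 0) F"
      by simp
  qed
  then show ?thesis
    by (simp add: LIM_zero_iff)
qed

lemma nm_tendsto:
  assumes "\<And>n. u n \<in> sq_int" "\<phi> \<in> sq_int" "((\<lambda>n. nm (\<lambda>x. \<phi> x - u n x)) \<longlongrightarrow> 0) F"
  shows "((\<lambda>n. nm (u n)) \<longlongrightarrow> nm \<phi>) F"
  unfolding L2_norm_def by (intro tendsto_real_sqrt ip_tendsto assms)

lemma nm_mult_tendsto:
  assumes u: "\<And>n. u n \<in> sq_int" "\<phi> \<in> sq_int" "((\<lambda>n. nm (\<lambda>x. \<phi> x - u n x)) \<longlongrightarrow> 0) F"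
    and \<psi>: "\<psi> \<in> borel_measurable mu" "AE x in mu. \<bar>\<psi> x\<bar> \<le> B"
  shows "((\<lambda>n. nm (\<lambda>x. \<phi> x * \<psi> x - u n x * \<psi> x)) \<longlongrightarrow> 0) F"
proof (rule Lim_null_comparison)
  have "AE x in mu. \<bar>\<psi> x\<bar> \<le> \<bar>B\<bar>" using \<psi>(2) by eventually_elim linarith
  then have "nm (\<lambda>x. (\<phi> x - u n x) * \<psi> x) \<le> \<bar>B\<bar> * nm (\<lambda>x. \<phi> x - u n x)" for n
    using u \<psi>(1) by (intro nm_bounded_mult) auto
  then show "\<forall>\<^sub>F n in F. norm (nm (\<lambda>x. \<phi> x * \<psi> x - u n x * \<psi> x)) \<le> \<bar>B\<bar> * nm (\<lambda>x. \<phi> x - u n x)"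
    by (simp add: left_diff_distrib)
  show "((\<lambda>n. \<bar>B\<bar> * nm (\<lambda>x. \<phi> x - u n x)) \<longlongrightarrow> 0) F"
    using tendsto_mult[OF tendsto_const u(3), of "\<bar>B\<bar>"] by simp
qed

end

section \<open>Functions with a weak derivative\<close>

context torus
begin

lemma ts_bounded: "\<exists>B. \<forall>x. \<bar>ts N a x\<bar> \<le> B"
proof -
  have "\<bar>e k x\<bar> \<le> sqrt (2 / L)" for k x
  proof -
    have "\<bar>e k x\<bar> \<le> sqrt (2 / L) * 1"
      unfolding e_def abs_mult using L_pos by (intro mult_mono) auto
    then show ?thesis by simp
  qed
  then have "\<bar>a k * e k x\<bar> \<le> \<bar>a k\<bar> * sqrt (2 / L)" for k x
    unfolding abs_mult by (intro mult_left_mono) auto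
  then have "\<bar>ts N a x\<bar> \<le> (\<Sum>k\<in>K N. \<bar>a k\<bar> * sqrt (2 / L))" for x
    unfolding ts_def by (intro order_trans[OF sum_abs] sum_mono)
  then show ?thesis by blast
qed

lemma TP_bounded:
  assumes "f \<in> TP" shows "\<exists>B. \<forall>x. \<bar>f x\<bar> \<le> B"
proof -
  obtain N0 c a where "\<And>N. N0 \<le> N \<Longrightarrow> f = (\<lambda>x. c + ts N a x)"
    using TP_rep[OF assms] by blast
  then have f: "f = (\<lambda>x. c + ts N0 a x)" by blast
  obtain B where "\<forall>x. \<bar>ts N0 a x\<bar> \<le> B" using ts_bounded by blast
  then have "\<bar>f x\<bar> \<le> \<bar>c\<bar> + B" for x
    unfolding f by (meson abs_triangle_ineq add_left_mono order_trans)
  then show ?thesis by blast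
qed

lemma TP_has_deriv:
  assumes "f \<in> TP"
  shows "deriv f \<in> TP" "(f has_real_derivative deriv f x) (at x)"
proof -
  obtain N0 c a where "\<And>N. N0 \<le> N \<Longrightarrow> f = (\<lambda>x. c + ts N a x)"
    using TP_rep[OF assms] by blast
  then have f: "f = (\<lambda>x. c + ts N0 a x)" by blast
  have d: "(f has_real_derivative ts N0 (dcoef a) x) (at x)" for x
    unfolding f using DERIV_add[OF DERIV_const ts_deriv] by simp
  then have "deriv f = ts N0 (dcoef a)"
    by (intro ext DERIV_imp_deriv)
  with d show "deriv f \<in> TP" "(f has_real_derivative deriv f x) (at x)"
    by (simp_all add: ts_TP)
qed

lemma TP_per: "f \<in> TP \<Longrightarrow> f (x + L) = f x"
  by (induction rule: TP.induct) (simp_all add: cos_per sin_per)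

lemma TP_smooth:
  assumes "f \<in> TP" shows "f \<in> smooth_per L"
proof -
  have "(deriv ^^ j) f \<in> TP" for j
    by (induction j) (simp_all add: assms TP_has_deriv)
  then show ?thesis
    using TP_has_deriv(2) TP_per[OF assms]
    unfolding smooth_per_def real_differentiable_def by blast
qed

lemma TP_cont: "f \<in> TP \<Longrightarrow> continuous_on S f"
  by (rule DERIV_continuous_on, rule has_field_derivative_at_within, rule TP_has_deriv)

lemma TP_meas: "f \<in> TP \<Longrightarrow> f \<in> borel_measurable mu"
  using TP_sq_int by (simp add: sq_int_def)

lemma e_TP: "e k \<in> TP"
  unfolding e_def[abs_def] by (cases "0 < k") (auto intro: TP_cmult TP_cos TP_sin)

lemma mult_TP_sq_int [simp]: 
  assumes "\<phi> \<in> sq_int" "f \<in> TP" shows "(\<lambda>x. \<phi> x * f x) \<in> sq_int"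
proof -
  obtain B where "\<forall>x. \<bar>f x\<bar> \<le> B" using TP_bounded[OF assms(2)] by blast
  then show ?thesis
    by (intro sq_int_bounded_mult[OF assms(1) TP_meas[OF assms(2)], of B]) auto
qed

text \<open>Division by the frequency is possible because the mode 0 is excluded; the background
  profile is obtained from its derivative in this way.\<close>

lemma ts_primitive: "\<exists>b. ts N (dcoef b) = ts N a"
proof (intro exI ext)
  fix x
  show "ts N (dcoef (\<lambda>k. a (- k) / (of_int k * om))) x = ts N a x"
    unfolding ts_def
  proof (rule sum.cong)
    fix k assume "k \<in> K N"
    then have "k \<noteq> 0" by (metis zero_notin_K)
    then show "dcoef (\<lambda>k. a (- k) / (of_int k * om)) k * e k x = a k * e k x"
      using om_pos by (simp add: dcoef_def)
  qed simp
qed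

text \<open>A primitive is a linear function plus a periodic sum, and the latter cancels over any
  window of length \<open>L\<close>. Hence neither the window nor the translation matters.\<close>

lemma TP_integral_shift:
  assumes "f \<in> TP"
  shows "((\<lambda>x. f (x + s)) has_integral (\<integral>x. f x \<partial>mu)) {y..y + L}"
proof -
  obtain N0 c a where "\<And>N. N0 \<le> N \<Longrightarrow> f = (\<lambda>x. c + ts N a x)"
    using TP_rep[OF assms] by blast
  then have f: "f = (\<lambda>x. c + ts N0 a x)" by blast
  obtain b where "ts N0 (dcoef b) = ts N0 a"
    using ts_primitive by blast
  then have "((\<lambda>x. c * x + ts N0 b (x + s)) has_real_derivative f (x + s)) (at x)" for x
    unfolding f using DERIV_shift[of "ts N0 b" "ts N0 a (x + s)" x s] ts_deriv[of N0 b "x + s"]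
    by (auto intro!: derivative_eq_intros)
  then have gen: "((\<lambda>x. f (x + s)) has_integral
      (c * (y + L) + ts N0 b (y + L + s)) - (c * y + ts N0 b (y + s))) {y..y + L}" for y
    using L_pos by (intro fundamental_theorem_of_calculus)
      (auto simp: has_real_derivative_iff_has_vector_derivative[symmetric] intro: has_field_derivative_at_within)
  have "ts N0 b (y + L + s) = ts N0 b (y + s)"
    using ts_per[of N0 b "y + s"] by (simp add: add.commute add.left_commute)
  then have *: "((\<lambda>x. f (x + s)) has_integral (c * L)) {y..y + L}"
    using gen[of y] by (simp add: algebra_simps)
  have "(\<integral>x. f x \<partial>mu) = c * L"
    using ip_one_ts[of N0 a] measure_mu
    by (simp add: f ip_eq mu.integrable_const sq_int_mult_integrable[OF sq_int_const[of 1] ts_sq_int, simplified])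
  with * show ?thesis by simp
qed

lemma TP_integral_mu_shift:
  assumes "f \<in> TP"
  shows "(\<integral>x. f (x + s) \<partial>mu) = (\<integral>x. f x \<partial>mu)"
proof -
  have "((\<lambda>x. f (x + s)) has_integral (\<integral>x. f x \<partial>mu)) {- L / 2..- L / 2 + L}"
    by (rule TP_integral_shift[OF assms])
  moreover have "((\<lambda>x. f (x + s)) has_integral (\<integral>x. f (x + s) \<partial>mu)) {- L / 2..- L / 2 + L}"
    using TP_integral_shift[OF TP_shift[OF assms, of s], of 0 "- L / 2"] by (simp only: add_0_right)
  ultimately show ?thesis
    by (rule has_integral_unique[symmetric])
qed

text \<open>Cauchy-Schwarz for the integral of the derivative between the two points, which lie
  within one period; by periodicity that period need not be the fundamental one.\<close>

lemma ts_holder: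
  assumes "\<bar>x - y\<bar> \<le> L"
  shows "(ts N a x - ts N a y)\<^sup>2 \<le> \<bar>x - y\<bar> * (nm (ts N (dcoef a)))\<^sup>2"
proof -
  let ?h = "ts N a" and ?h' = "ts N (dcoef a)"
  have main: "(?h x - ?h y)\<^sup>2 \<le> (x - y) * (nm ?h')\<^sup>2" if yx: "y < x" "x - y \<le> L" for x y
  proof -
    \<comment> \<open>The mean of \<open>?h'\<close> over the interval; nonnegativity of the
      integral of \<open>(?h' - m)^2\<close> is the Cauchy-Schwarz inequality wanted.\<close>
    define m where "m = (?h x - ?h y) / (x - y)"
    have sqTP: "(\<lambda>z. (?h' z)\<^sup>2) \<in> TP" by (intro TP_power ts_TP)
    have int: "(?h' has_integral (?h x - ?h y)) {y..x}"
      using yx ts_deriv by (intro fundamental_theorem_of_calculus)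
        (auto simp: has_real_derivative_iff_has_vector_derivative[symmetric] intro: has_field_derivative_at_within)
    have sqint: "(\<lambda>z. (?h' z)\<^sup>2) integrable_on {y..x}" for x y
      by (intro integrable_continuous_real TP_cont sqTP)
    have "((\<lambda>z. (?h' z)\<^sup>2 - 2 * m * ?h' z + m\<^sup>2) has_integral
        (integral {y..x} (\<lambda>z. (?h' z)\<^sup>2) - 2 * m * (?h x - ?h y) + m\<^sup>2 * (x - y))) {y..x}"
      using has_integral_const_real[of "m\<^sup>2" y x] yx
      by (intro has_integral_add has_integral_diff has_integral_mult_right int integrable_integral sqint)
        (auto simp: mult.commute)
    then have "0 \<le> integral {y..x} (\<lambda>z. (?h' z)\<^sup>2) - 2 * m * (?h x - ?h y) + m\<^sup>2 * (x - y)"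
    proof (rule has_integral_nonneg)
      fix z
      have "(?h' z)\<^sup>2 - 2 * m * ?h' z + m\<^sup>2 = (?h' z - m)\<^sup>2" by (simp add: power2_diff)
      then show "0 \<le> (?h' z)\<^sup>2 - 2 * m * ?h' z + m\<^sup>2" by simp
    qed
    moreover have "m\<^sup>2 * (x - y) = m * (?h x - ?h y)" "m * (?h x - ?h y) = (?h x - ?h y)\<^sup>2 / (x - y)"
      using yx by (simp_all add: m_def power2_eq_square)
    ultimately have "(?h x - ?h y)\<^sup>2 / (x - y) \<le> integral {y..x} (\<lambda>z. (?h' z)\<^sup>2)"
      by linarith
    also have "\<dots> \<le> integral {y..y + L} (\<lambda>z. (?h' z)\<^sup>2)"
      using yx by (intro integral_subset_le sqint) auto
    also have "\<dots> = (nm ?h')\<^sup>2"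
      using TP_integral_shift[OF sqTP, of 0 y] by (simp add: nm_sq_integral integral_unique)
    finally show ?thesis
      using yx by (simp add: pos_divide_le_eq mult.commute)
  qed
  show ?thesis
  proof (cases x y rule: linorder_cases)
    case less
    then show ?thesis using main[of x y] assms by (simp add: power2_commute)
  next
    case greater
    then show ?thesis using main[of y x] assms by simp
  qed simp
qed

text \<open>The oscillation bound is averaged over the second point, where the mean of the sum
  vanishes.\<close>

lemma ts_sup:
  assumes "x \<in> {- L / 2..L / 2}"
  shows "\<bar>ts N a x\<bar> \<le> sqrt L * nm (ts N (dcoef a))"
proof -
  let ?B = "sqrt L * nm (ts N (dcoef a))"
  have "\<bar>ts N a x - ts N a y\<bar> \<le> ?B" if "y \<in> {- L / 2..L / 2}" for y
  proof (rule power2_le_imp_le)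
    have d: "\<bar>x - y\<bar> \<le> L" using assms that by auto
    have "(ts N a x - ts N a y)\<^sup>2 \<le> \<bar>x - y\<bar> * (nm (ts N (dcoef a)))\<^sup>2"
      by (rule ts_holder[OF d])
    also have "\<dots> \<le> L * (nm (ts N (dcoef a)))\<^sup>2"
      using d by (intro mult_right_mono) auto
    finally show "\<bar>ts N a x - ts N a y\<bar>\<^sup>2 \<le> ?B\<^sup>2"
      using L_pos by (simp add: power_mult_distrib)
  qed (use L_pos in simp)
  then have bd: "AE y in mu. \<bar>ts N a x - ts N a y\<bar> \<le> ?B"
    by (rule AE_mu_I)
  have int: "integrable mu (ts N a)"
    using sq_int_mult_integrable[OF sq_int_const[of 1] ts_sq_int] by simp
  have "(\<integral>y. ts N a x - ts N a y \<partial>mu) = L * ts N a x"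
    using ip_one_ts[of N a] int measure_mu by (simp add: ip_eq)
  moreover have "\<bar>\<integral>y. ts N a x - ts N a y \<partial>mu\<bar> \<le> (\<integral>y. ?B \<partial>mu)"
    using int bd by (intro order_trans[OF integral_abs_bound] integral_mono_AE) auto
  ultimately have "\<bar>L * ts N a x\<bar> \<le> L * ?B"
    using measure_mu by simp
  then show ?thesis
    using L_pos by (simp add: abs_mult)
qed

text \<open>Poincare's inequality with a crude constant. Iterated, it bounds every norm of a
  background profile by that of its third derivative.\<close>

lemma nm_ts_le: "nm (ts N a) \<le> L * nm (ts N (dcoef a))"
proof -
  have "nm (ts N a) \<le> (sqrt L * nm (ts N (dcoef a))) * sqrt L"
    by (rule nm_bounded) (use L_pos in \<open>auto intro!: AE_mu_I ts_sup simp: TP_meas ts_TP\<close>)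
  also have "\<dots> = (sqrt L * sqrt L) * nm (ts N (dcoef a))"
    by (simp only: mult_ac)
  finally show ?thesis
    using L_pos by simp
qed

lemma weak_deriv_ts: "weak_deriv_per L (ts N a) (ts N (dcoef a))"
  unfolding weak_deriv_per_def
proof (intro conjI ballI)
  have "ts N (dcoef a) \<in> borel_measurable lebesgue"
    by (intro measurable_completion) (simp add: borel_measurable_continuous_onI ts_cont)
  then show "ts N (dcoef a) \<in> L2_per L"
    using ts_sq_int[of N "dcoef a"] unfolding L2_per_def set_integrable_eq
    by (auto simp: ts_per sq_int_def)
  fix \<psi> assume "\<psi> \<in> smooth_per L"
  then have \<psi>: "\<And>x. \<psi> (x + L) = \<psi> x" "\<And>k x. ((deriv ^^ k) \<psi>) differentiable (at x)"
    by (auto simp: smooth_per_def)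
  have d: "(\<psi> has_real_derivative deriv \<psi> x) (at x)" "(deriv \<psi> has_real_derivative deriv (deriv \<psi>) x) (at x)" for x
    using \<psi>(2)[of 0 x] \<psi>(2)[of 1 x] by (auto simp: DERIV_deriv_iff_real_differentiable)
  have "continuous_on UNIV (deriv \<psi>)"
    by (rule DERIV_continuous_on, rule has_field_derivative_at_within, rule d)
  with d(1) \<psi>(1) show "ip (ts N a) (deriv \<psi>) = - ip (ts N (dcoef a)) \<psi>"
    by (intro ip_by_parts) (auto intro: ts_deriv ts_cont simp: ts_per)
qed

lemma ts_space_V: "ts N a \<in> space_V L"
proof -
  have "ts N a \<in> borel_measurable lebesgue"
    by (intro measurable_completion) (simp add: borel_measurable_continuous_onI ts_cont)
  then have "ts N a \<in> L2_per L"
    using ts_sq_int[of N a] unfolding L2_per_def set_integrable_eq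
    by (auto simp: ts_per sq_int_def)
  moreover have "torus_integral L (ts N a) = 0"
    by (subst torus_integral_eq_ip_one, subst ip_sym) (rule ip_one_ts)
  ultimately show ?thesis
    using weak_deriv_ts by (auto simp: space_V_def space_H_def)
qed

lemma weak_deriv_facts:
  assumes "weak_deriv_per L \<phi> g"
  shows "g \<in> sq_int" "ip g (\<lambda>x. 1) = 0" "cf g = dcoef (cf \<phi>)"
    and "\<psi> \<in> TP \<Longrightarrow> ip \<phi> (deriv \<psi>) = - ip g \<psi>"
proof -
  show g: "g \<in> sq_int"
    using assms by (simp add: weak_deriv_per_def L2_per_sq_int)
  show test: "ip \<phi> (deriv \<psi>) = - ip g \<psi>" if "\<psi> \<in> TP" for \<psi>
    using assms TP_smooth[OF that] by (simp add: weak_deriv_per_def)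
  show "ip g (\<lambda>x. 1) = 0"
    using test[OF TP_const[of 1]] by (simp add: ip_eq)
  show "cf g = dcoef (cf \<phi>)"
  proof
    fix k
    have "deriv (e k) = (\<lambda>x. (of_int k * om) * e (- k) x)"
      by (intro ext DERIV_imp_deriv e_deriv)
    then show "cf g k = dcoef (cf \<phi>) k"
      using test[OF e_TP[of k]] by (simp add: cf_def dcoef_def)
  qed
qed

lemma weak_deriv_dx: "\<phi> \<in> space_V L \<Longrightarrow> weak_deriv_per L \<phi> (dx L \<phi>)"
  unfolding space_V_def dx_def using someI_ex[of "weak_deriv_per L \<phi>"] by blast

lemma space_V_mean: "\<phi> \<in> space_V L \<Longrightarrow> ip \<phi> (\<lambda>x. 1) = 0"
  by (simp add: space_V_def space_H_def torus_integral_eq_ip_one)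

text \<open>\<open>dx\<close> returns an unspecified representative, even for a trigonometric
  polynomial. It has the same Fourier coefficients as the classical derivative, and convergence of
  the projections makes the norms equal.\<close>

lemma V_norm_ts: "V_norm L (ts N a) = sqrt ((nm (ts N a))\<^sup>2 + (nm (ts N (dcoef a)))\<^sup>2)"
proof -
  note wd = weak_deriv_facts[OF weak_deriv_dx[OF ts_space_V[of N a]]]
  note wd' = weak_deriv_facts[OF weak_deriv_ts[of N a]]
  have eq: "cf (dx L (ts N a)) = cf (ts N (dcoef a))"
    by (simp only: wd(3) wd'(3))
  have "(\<lambda>M. nm (P M (dx L (ts N a)))) \<longlonglongrightarrow> nm (dx L (ts N a))"
    using wd by (intro nm_tendsto P_tendsto) auto
  moreover have "(\<lambda>M. nm (P M (ts N (dcoef a)))) \<longlonglongrightarrow> nm (ts N (dcoef a))"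
    using wd' by (intro nm_tendsto P_tendsto) auto
  ultimately have "nm (dx L (ts N a)) = nm (ts N (dcoef a))"
    unfolding eq by (rule LIMSEQ_unique)
  then show ?thesis by (simp add: V_norm_def)
qed

section \<open>From trigonometric polynomials to functions with a weak derivative\<close>

context
  fixes \<phi> g :: "real \<Rightarrow> real"
  assumes \<phi>V: "\<phi> \<in> space_V L" and g: "weak_deriv_per L \<phi> g"
begin

lemma P_deriv: "ts N (dcoef (cf \<phi>)) = P N g"
  by (simp add: weak_deriv_facts(3)[OF g])

lemma P_tendsto_V: "(\<lambda>N. nm (\<lambda>x. \<phi> x - P N \<phi> x)) \<longlonglongrightarrow> 0"
  using \<phi>V by (intro P_tendsto space_V_sq_int space_V_mean)

lemma P_deriv_tendsto_V: "(\<lambda>N. nm (\<lambda>x. g x - P N g x)) \<longlonglongrightarrow> 0"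
  by (intro P_tendsto weak_deriv_facts[OF g])

lemma P_sup: "AE x in mu. \<bar>P N \<phi> x\<bar> \<le> sqrt L * nm g"
proof (rule AE_mu_I)
  fix x assume "x \<in> {- L / 2..L / 2}"
  then have "\<bar>P N \<phi> x\<bar> \<le> sqrt L * nm (P N g)"
    unfolding P_deriv[symmetric] by (rule ts_sup)
  also have "\<dots> \<le> sqrt L * nm g"
    using L_pos by (intro mult_left_mono nm_P_le weak_deriv_facts[OF g]) auto
  finally show "\<bar>P N \<phi> x\<bar> \<le> sqrt L * nm g" .
qed

text \<open>The bound holds for every \<open>P N \<phi>\<close>, but these converge only in mean
  square. So the excess over the bound is compared with \<open>\<phi> - P N \<phi>\<close>, which
  forces its integral to be zero.\<close>

lemma V_sup: "AE x in mu. \<bar>\<phi> x\<bar> \<le> sqrt L * nm g"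
proof -
  let ?B = "sqrt L * nm g"
  let ?d = "\<lambda>x. max 0 (\<bar>\<phi> x\<bar> - ?B)"
  note \<phi> = space_V_sq_int[OF \<phi>V]
  have meas: "\<phi> \<in> borel_measurable mu" using \<phi> by (simp add: sq_int_def)
  have le: "AE x in mu. (?d x)\<^sup>2 \<le> (\<phi> x - P N \<phi> x)\<^sup>2" for N
    using P_sup[of N]
  proof eventually_elim
    case (elim x)
    then have "\<bar>?d x\<bar> \<le> \<bar>\<phi> x - P N \<phi> x\<bar>" by linarith
    then show ?case by (simp only: abs_le_square_iff)
  qed
  have int: "integrable mu (\<lambda>x. (?d x)\<^sup>2)"
  proof (rule Bochner_Integration.integrable_bound)
    show "integrable mu (\<lambda>x. (\<phi> x - P 0 \<phi> x)\<^sup>2)"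
      using sq_int_diff[OF \<phi> ts_sq_int] by (simp add: sq_int_def)
    show "(\<lambda>x. (?d x)\<^sup>2) \<in> borel_measurable mu" using meas by measurable
    show "AE x in mu. norm ((?d x)\<^sup>2) \<le> norm ((\<phi> x - P 0 \<phi> x)\<^sup>2)"
      using le[of 0] by eventually_elim simp
  qed
  have "(\<integral>x. (?d x)\<^sup>2 \<partial>mu) \<le> (nm (\<lambda>x. \<phi> x - P N \<phi> x))\<^sup>2" for N
    unfolding nm_sq_integral using sq_int_diff[OF \<phi> ts_sq_int]
    by (intro integral_mono_AE int le) (simp add: sq_int_def)
  moreover have "(\<lambda>N. (nm (\<lambda>x. \<phi> x - P N \<phi> x))\<^sup>2) \<longlonglongrightarrow> 0\<^sup>2"
    by (intro tendsto_power P_tendsto_V)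
  ultimately have "(\<integral>x. (?d x)\<^sup>2 \<partial>mu) \<le> 0\<^sup>2"
    using LIMSEQ_le_const by blast
  then have "(\<integral>x. (?d x)\<^sup>2 \<partial>mu) \<le> 0"
    by simp
  then have "(\<integral>x. (?d x)\<^sup>2 \<partial>mu) = 0"
    by (intro antisym Bochner_Integration.integral_nonneg) auto
  then have "AE x in mu. (?d x)\<^sup>2 = 0"
    using integral_nonneg_eq_0_iff_AE[OF int] by simp
  then show ?thesis
    by eventually_elim (simp add: max_def split: if_splits)
qed

lemma V_sq_sq_int: "(\<lambda>x. (\<phi> x)\<^sup>2) \<in> sq_int"
proof -
  have "\<phi> \<in> borel_measurable mu"
    using space_V_sq_int[OF \<phi>V] by (simp add: sq_int_def)
  then have "(\<lambda>x. \<phi> x * \<phi> x) \<in> sq_int"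
    by (rule sq_int_bounded_mult[OF space_V_sq_int[OF \<phi>V] _ V_sup])
  then show ?thesis by (simp add: power2_eq_square)
qed

lemma V_nm_sq_le: "nm (\<lambda>x. (\<phi> x)\<^sup>2) \<le> sqrt L * nm g * nm \<phi>"
proof -
  have "nm (\<lambda>x. \<phi> x * \<phi> x) \<le> (sqrt L * nm g) * nm \<phi>"
    using space_V_sq_int[OF \<phi>V] L_pos by (intro nm_bounded_mult V_sup) (auto simp: sq_int_def)
  then show ?thesis by (simp add: power2_eq_square)
qed

text \<open>The bound is uniform in \<open>N\<close> and, along a solution, integrable in time: it
  provides the dominating function in the energy inequality.\<close>

lemma cubic_P_bound: "\<bar>ip (\<lambda>x. (\<phi> x)\<^sup>2) (P N g)\<bar> \<le> sqrt L * nm \<phi> * (nm g)\<^sup>2"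
proof -
  have "\<bar>ip (\<lambda>x. (\<phi> x)\<^sup>2) (P N g)\<bar> \<le> nm (\<lambda>x. (\<phi> x)\<^sup>2) * nm (P N g)"
    by (intro cauchy_schwarz V_sq_sq_int) simp
  also have "\<dots> \<le> (sqrt L * nm g * nm \<phi>) * nm g"
    using L_pos by (intro mult_mono V_nm_sq_le nm_P_le weak_deriv_facts[OF g]) auto
  finally show ?thesis by (simp add: power2_eq_square mult_ac)
qed

text \<open>The nonlinearity does no work. For \<open>p = P N \<phi>\<close> the integral of
  \<open>p^2 p'\<close> vanishes exactly, and \<open>\<phi>^2 - p^2\<close> factors into a
  mean-square small and a bounded function.\<close>

lemma cubic_P_tendsto: "(\<lambda>N. ip (\<lambda>x. (\<phi> x)\<^sup>2) (P N g)) \<longlonglongrightarrow> 0"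
proof (rule Lim_null_comparison)
  let ?B = "sqrt L * nm g"
  note \<phi> = space_V_sq_int[OF \<phi>V]
  have B: "0 \<le> ?B" using L_pos by simp
  have le: "\<bar>ip (\<lambda>x. (\<phi> x)\<^sup>2) (P N g)\<bar> \<le> nm (\<lambda>x. \<phi> x - P N \<phi> x) * (2 * ?B * nm g)" for N
  proof -
    let ?p = "P N \<phi>" and ?q = "P N g"
    have "(\<integral>x. (?p x)\<^sup>2 * ?q x \<partial>mu) = 0"
    proof (rule integral_deriv_periodic)
      show "((\<lambda>x. (?p x) ^ 3 / 3) has_real_derivative (?p x)\<^sup>2 * ?q x) (at x)" for x
        using ts_deriv[of N "cf \<phi>" x] unfolding P_deriv
        by (auto intro!: derivative_eq_intros simp: power2_eq_square)
    qed (auto intro!: continuous_intros simp: ts_per)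
    then have 0: "ip (\<lambda>x. (?p x)\<^sup>2) ?q = 0" by (simp add: ip_eq)
    have sum_meas: "(\<lambda>x. \<phi> x + ?p x) \<in> borel_measurable mu"
      using sq_int_add[OF \<phi> ts_sq_int] by (simp add: sq_int_def)
    have sum_bd: "AE x in mu. \<bar>\<phi> x + ?p x\<bar> \<le> 2 * ?B"
      using V_sup P_sup[of N] by eventually_elim linarith
    have "ip (\<lambda>x. (\<phi> x)\<^sup>2) ?q = ip (\<lambda>x. (\<phi> x)\<^sup>2 - (?p x)\<^sup>2) ?q"
      using 0 V_sq_sq_int TP_sq_int[OF TP_power[OF ts_TP]] by (subst ip_diff_left) auto
    also have "\<dots> = ip (\<lambda>x. \<phi> x - ?p x) (\<lambda>x. ?q x * (\<phi> x + ?p x))"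
      by (simp add: ip_eq power2_eq_square algebra_simps)
    finally have "\<bar>ip (\<lambda>x. (\<phi> x)\<^sup>2) ?q\<bar> \<le> nm (\<lambda>x. \<phi> x - ?p x) * nm (\<lambda>x. ?q x * (\<phi> x + ?p x))"
      using cauchy_schwarz[OF sq_int_diff[OF \<phi> ts_sq_int] sq_int_bounded_mult[OF ts_sq_int sum_meas sum_bd]]
      by simp
    also have "nm (\<lambda>x. ?q x * (\<phi> x + ?p x)) \<le> 2 * ?B * nm ?q"
      using B by (intro nm_bounded_mult sum_meas sum_bd) auto
    also have "2 * ?B * nm ?q \<le> 2 * ?B * nm g"
      using B by (intro mult_left_mono nm_P_le weak_deriv_facts[OF g]) auto
    finally show ?thesis by (simp add: mult_left_mono)
  qed
  show "\<forall>\<^sub>F N in sequentially. norm (ip (\<lambda>x. (\<phi> x)\<^sup>2) (P N g)) \<le> nm (\<lambda>x. \<phi> x - P N \<phi> x) * (2 * ?B * nm g)"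
    using le by simp
  show "(\<lambda>N. nm (\<lambda>x. \<phi> x - P N \<phi> x) * (2 * ?B * nm g)) \<longlonglongrightarrow> 0"
    using tendsto_mult_right[OF P_tendsto_V] by simp
qed

lemma sq_mult_tendsto:
  assumes \<psi>: "\<psi> \<in> TP"
  shows "(\<lambda>N. ip (\<lambda>x. (P N \<phi> x)\<^sup>2) \<psi>) \<longlonglongrightarrow> ip (\<lambda>x. (\<phi> x)\<^sup>2) \<psi>"
proof -
  note \<phi> = space_V_sq_int[OF \<phi>V]
  obtain B where B: "\<forall>x. \<bar>\<psi> x\<bar> \<le> B" using TP_bounded[OF \<psi>] by blast
  have "(\<lambda>N. ip (P N \<phi>) (\<lambda>x. P N \<phi> x * \<psi> x)) \<longlonglongrightarrow> ip \<phi> (\<lambda>x. \<phi> x * \<psi> x)"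
    using B \<psi> by (intro ip_tendsto nm_mult_tendsto[where B = B] P_tendsto_V \<phi>) (auto simp: \<phi> TP_meas)
  then show ?thesis
    by (simp add: ip_eq power2_eq_square mult.assoc)
qed

text \<open>Writing \<open>u u_x\<close> as half the derivative of \<open>u^2\<close> frees the weak
  form of \<open>u_x\<close>, which is available at almost every time only.\<close>

lemma product_rule:
  assumes \<psi>: "\<psi> \<in> TP"
  shows "ip (\<lambda>x. \<phi> x * g x) \<psi> = - (1/2) * ip (\<lambda>x. (\<phi> x)\<^sup>2) (deriv \<psi>)"
proof -
  note \<phi> = space_V_sq_int[OF \<phi>V] and g' = weak_deriv_facts(1)[OF g]
  obtain B where B: "\<forall>x. \<bar>\<psi> x\<bar> \<le> B" using TP_bounded[OF \<psi>] by blast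
  have "(\<lambda>N. ip (P N \<phi>) (\<lambda>x. P N g x * \<psi> x)) \<longlonglongrightarrow> ip \<phi> (\<lambda>x. g x * \<psi> x)"
    using B \<psi> by (intro ip_tendsto nm_mult_tendsto[where B = B] P_tendsto_V P_deriv_tendsto_V \<phi> g')
      (auto simp: g' TP_meas)
  moreover have "ip (P N \<phi>) (\<lambda>x. P N g x * \<psi> x) = - (1/2) * ip (\<lambda>x. (P N \<phi> x)\<^sup>2) (deriv \<psi>)" for N
  proof -
    have "ip (\<lambda>x. (P N \<phi> x)\<^sup>2) (deriv \<psi>) = - ip (\<lambda>x. 2 * (P N \<phi> x * P N g x)) \<psi>"
    proof (rule ip_by_parts)
      show "((\<lambda>x. (P N \<phi> x)\<^sup>2) has_real_derivative 2 * (P N \<phi> x * P N g x)) (at x)" for x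
        using ts_deriv[of N "cf \<phi>" x] unfolding P_deriv
        by (auto intro!: derivative_eq_intros)
      show "continuous_on UNIV (\<lambda>x. 2 * (P N \<phi> x * P N g x))"
        by (intro continuous_intros)
    qed (auto intro: TP_has_deriv TP_cont \<psi> simp: ts_per TP_per[OF \<psi>])
    then show ?thesis
      by (simp only: ip_cmult_left) (simp add: ip_eq mult.assoc)
  qed
  ultimately have "(\<lambda>N. - (1/2) * ip (\<lambda>x. (P N \<phi> x)\<^sup>2) (deriv \<psi>)) \<longlonglongrightarrow> ip \<phi> (\<lambda>x. g x * \<psi> x)"
    by simp
  moreover have "(\<lambda>N. - (1/2) * ip (\<lambda>x. (P N \<phi> x)\<^sup>2) (deriv \<psi>)) \<longlonglongrightarrow> - (1/2) * ip (\<lambda>x. (\<phi> x)\<^sup>2) (deriv \<psi>)"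
    by (intro tendsto_mult_left sq_mult_tendsto TP_has_deriv \<psi>)
  ultimately have "ip \<phi> (\<lambda>x. g x * \<psi> x) = - (1/2) * ip (\<lambda>x. (\<phi> x)\<^sup>2) (deriv \<psi>)"
    by (rule LIMSEQ_unique)
  then show ?thesis
    by (simp add: ip_eq mult.assoc)
qed

text \<open>The translate of \<open>b\<close> is a probability density, and the variance under it is
  at most the mean square deviation from the value at the centre \<open>s\<close>. That deviation is
  bounded by distance times squared derivative norm, so the first moment of \<open>b\<close>
  appears.\<close>

lemma variance_bound:
  assumes b: "b \<in> TP" "\<And>x. 0 \<le> b x" "(\<integral>x. b x \<partial>mu) = 1"
    and m: "(\<integral>x. \<bar>x\<bar> * b x \<partial>mu) \<le> m"
  shows "ip (\<lambda>x. (\<phi> x)\<^sup>2) (\<lambda>x. b (x - s)) \<le> (ip \<phi> (\<lambda>x. b (x - s)))\<^sup>2 + m * (nm g)\<^sup>2"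
proof -
  note \<phi> = space_V_sq_int[OF \<phi>V]
  have bs: "(\<lambda>x. b (x - s)) \<in> TP"
    using TP_shift[OF b(1), of "- s"] by simp
  have fin: "ip (\<lambda>x. (P N \<phi> x)\<^sup>2) (\<lambda>x. b (x - s)) \<le> (ip (P N \<phi>) (\<lambda>x. b (x - s)))\<^sup>2 + m * (nm g)\<^sup>2" for N
  proof -
    let ?p = "P N \<phi>"
    \<comment> \<open>Deviations are measured from the value at the centre rather than from the
      mean; the difference is a square with the favourable sign.\<close>
    define c where "c = ?p s"
    define F where "F = (\<lambda>x. (?p x - c)\<^sup>2 * b (x - s))"
    have F: "F \<in> TP"
      unfolding F_def by (intro TP_mult TP_power TP_diff ts_TP TP_const bs)
    have int: "integrable mu f" if "f \<in> TP" for f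
      using sq_int_mult_integrable[OF sq_int_const[of 1] TP_sq_int[OF that]] by simp
    have ints: "integrable mu (\<lambda>x. (?p x)\<^sup>2 * b (x - s))" "integrable mu (\<lambda>x. ?p x * b (x - s))"
      "integrable mu (\<lambda>x. b (x - s))"
      by (intro int TP_mult TP_power ts_TP bs)+
    have one: "(\<integral>x. b (x - s) \<partial>mu) = 1"
      using TP_integral_mu_shift[OF b(1), of "- s"] b(3) by simp
    have "(\<integral>x. F x \<partial>mu) = (\<integral>x. (?p x)\<^sup>2 * b (x - s) - 2 * c * (?p x * b (x - s)) + c\<^sup>2 * b (x - s) \<partial>mu)"
      unfolding F_def by (intro Bochner_Integration.integral_cong) (auto simp: power2_eq_square algebra_simps)
    also have "\<dots> = ip (\<lambda>x. (?p x)\<^sup>2) (\<lambda>x. b (x - s)) - 2 * c * ip ?p (\<lambda>x. b (x - s)) + c\<^sup>2"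
      using ints one by (simp add: ip_eq)
    finally have "ip (\<lambda>x. (?p x)\<^sup>2) (\<lambda>x. b (x - s))
        = (\<integral>x. F x \<partial>mu) + (ip ?p (\<lambda>x. b (x - s)))\<^sup>2 - (ip ?p (\<lambda>x. b (x - s)) - c)\<^sup>2"
      by (simp add: power2_eq_square algebra_simps)
    then have 1: "ip (\<lambda>x. (?p x)\<^sup>2) (\<lambda>x. b (x - s)) \<le> (\<integral>x. F x \<partial>mu) + (ip ?p (\<lambda>x. b (x - s)))\<^sup>2"
      by simp
    have bint: "integrable mu (\<lambda>x. \<bar>x\<bar> * b x)"
      by (rule sq_int_mult_integrable[OF continuous_sq_int TP_sq_int[OF b(1)]]) (intro continuous_intros)
    have "(\<integral>x. F x \<partial>mu) = (\<integral>x. F (x + s) \<partial>mu)"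
      by (rule TP_integral_mu_shift[OF F, symmetric])
    also have "\<dots> \<le> (\<integral>x. (nm (P N g))\<^sup>2 * (\<bar>x\<bar> * b x) \<partial>mu)"
    proof (rule integral_mono_AE)
      show "integrable mu (\<lambda>x. F (x + s))" by (intro int TP_shift F)
      show "integrable mu (\<lambda>x. (nm (P N g))\<^sup>2 * (\<bar>x\<bar> * b x))" using bint by simp
      show "AE x in mu. F (x + s) \<le> (nm (P N g))\<^sup>2 * (\<bar>x\<bar> * b x)"
      proof (rule AE_mu_I)
        fix x assume "x \<in> {- L / 2..L / 2}"
        then have "(?p (x + s) - ?p s)\<^sup>2 \<le> \<bar>x + s - s\<bar> * (nm (P N g))\<^sup>2"
          unfolding P_deriv[symmetric] using L_pos by (intro ts_holder) auto
        then have "(?p (x + s) - c)\<^sup>2 * b x \<le> (\<bar>x\<bar> * (nm (P N g))\<^sup>2) * b x"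
          unfolding c_def using b(2) by (intro mult_right_mono) auto
        then show "F (x + s) \<le> (nm (P N g))\<^sup>2 * (\<bar>x\<bar> * b x)"
          by (simp add: F_def mult_ac)
      qed
    qed
    also have "\<dots> = (nm (P N g))\<^sup>2 * (\<integral>x. \<bar>x\<bar> * b x \<partial>mu)" by simp
    also have "\<dots> \<le> (nm g)\<^sup>2 * m"
      using m b(2) by (intro mult_mono power_mono nm_P_le weak_deriv_facts[OF g] Bochner_Integration.integral_nonneg) auto
    finally show ?thesis using 1 by (simp add: mult.commute)
  qed
  have "(\<lambda>N. ip (\<lambda>x. (P N \<phi> x)\<^sup>2) (\<lambda>x. b (x - s))) \<longlonglongrightarrow> ip (\<lambda>x. (\<phi> x)\<^sup>2) (\<lambda>x. b (x - s))"
    by (rule sq_mult_tendsto[OF bs])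
  moreover have "(\<lambda>N. (ip (P N \<phi>) (\<lambda>x. b (x - s)))\<^sup>2 + m * (nm g)\<^sup>2) \<longlonglongrightarrow> (ip \<phi> (\<lambda>x. b (x - s)))\<^sup>2 + m * (nm g)\<^sup>2"
    using TP_sq_int[OF bs]
    by (intro tendsto_intros ip_tendsto P_tendsto_V \<phi>)
      (auto simp: L2_norm_def ip_eq)
  ultimately show ?thesis
    using fin by (intro LIMSEQ_le) auto
qed

end

end

section \<open>Weak solutions and the energy inequality\<close>

lemma integral_mono_except_negligible:
  fixes f g :: "real \<Rightarrow> real"
  assumes "negligible Z" "f integrable_on S" "g integrable_on S" "\<And>x. x \<in> S - Z \<Longrightarrow> f x \<le> g x"
  shows "integral S f \<le> integral S g"
proof -
  let ?g = "\<lambda>x. if x \<in> Z then f x else g x"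
  have "(?g has_integral integral S g) S"
    by (rule has_integral_spike[OF assms(1) _ integrable_integral[OF assms(3)]]) simp
  then show ?thesis
    using assms(4) by (intro has_integral_le[OF integrable_integral[OF assms(2)]]) auto
qed

context torus
begin

lemma sum_dcoef: "(\<Sum>k\<in>K N. dcoef a k * b k) = - (\<Sum>k\<in>K N. a k * dcoef b k)"
proof -
  have "(\<Sum>k\<in>K N. dcoef a k * b k) = (\<Sum>k\<in>K N. dcoef a (- k) * b (- k))"
    by (rule sum_K_neg[of "\<lambda>k. dcoef a k * b k" N, symmetric])
  also have "\<dots> = - (\<Sum>k\<in>K N. a k * dcoef b k)"
    unfolding sum_negf[symmetric] by (intro sum.cong refl) (simp add: dcoef_def)
  finally show ?thesis .
qed

lemma ip_ts_of_integrable: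
  assumes "\<And>k. integrable mu (\<lambda>x. \<phi> x * e k x)"
  shows "ip \<phi> (ts N a) = (\<Sum>k\<in>K N. a k * cf \<phi> k)"
proof -
  have "ip \<phi> (ts N a) = (\<integral>x. (\<Sum>k\<in>K N. a k * (\<phi> x * e k x)) \<partial>mu)"
    unfolding ip_eq ts_def by (intro Bochner_Integration.integral_cong) (auto simp: sum_distrib_left mult_ac)
  also have "\<dots> = (\<Sum>k\<in>K N. a k * cf \<phi> k)"
    using assms by (simp add: cf_def ip_eq)
  finally show ?thesis .
qed

lemma ip_sq_TP: "ip (\<lambda>x. (\<phi> x)\<^sup>2) \<psi> = ip \<phi> (\<lambda>x. \<phi> x * \<psi> x)"
  by (simp add: ip_eq power2_eq_square mult.assoc)

lemma sq_TP_integrable: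
  assumes "\<phi> \<in> sq_int" "\<psi> \<in> TP"
  shows "integrable mu (\<lambda>x. (\<phi> x)\<^sup>2 * \<psi> x)"
  using sq_int_mult_integrable[OF assms(1) mult_TP_sq_int[OF assms]]
  by (simp add: power2_eq_square mult.assoc)

lemma ts_delta:
  assumes "k \<in> K N"
  shows "ts N (\<lambda>l. if l = k then 1 else 0) = e k"
proof
  fix x
  have "ts N (\<lambda>l. if l = k then 1 else 0) x = (\<Sum>l\<in>K N. if l = k then e l x else 0)"
    unfolding ts_def by (intro sum.cong) auto
  then show "ts N (\<lambda>l. if l = k then 1 else 0) x = e k x" using assms by simp
qed

section \<open>Translates of finite Fourier sums and the best translate\<close>

definition sh :: "real \<Rightarrow> (int \<Rightarrow> real) \<Rightarrow> int \<Rightarrow> real" where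
  "sh s a k = cos (of_int k * om * s) * a k + sin (of_int k * om * s) * a (- k)"

text \<open>Translation rotates each pair of modes \<open>k\<close>, \<open>-k\<close> by the angle
  \<open>k om s\<close>. Translates of a profile thus keep the cutoff \<open>N\<close>, and pairings
  with them are smooth periodic functions of \<open>s\<close>.\<close>

lemma e_shift: "e k (x - s) = cos (of_int k * om * s) * e k x - sin (of_int k * om * s) * e (- k) x"
  using sin_zero[where 'a = real]
  by (cases k "0 :: int" rule: linorder_cases)
    (simp_all add: e_def right_diff_distrib cos_diff sin_diff algebra_simps)

lemma ts_sh: "ts N (sh s a) x = ts N a (x - s)"
proof -
  have "ts N a (x - s) = (\<Sum>k\<in>K N. cos (of_int k * om * s) * a k * e k x)
      + (\<Sum>k\<in>K N. - sin (of_int k * om * s) * a k * e (- k) x)"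
    unfolding ts_def e_shift sum.distrib[symmetric] by (intro sum.cong) (auto simp: algebra_simps)
  also have "(\<Sum>k\<in>K N. - sin (of_int k * om * s) * a k * e (- k) x)
      = (\<Sum>k\<in>K N. sin (of_int k * om * s) * a (- k) * e k x)"
    using sum_K_neg[of "\<lambda>k. - sin (of_int k * om * s) * a k * e (- k) x" N] by simp
  finally show ?thesis
    by (simp add: ts_def sh_def distrib_right sum.distrib)
qed

lemma dcoef_sh: "dcoef (sh s a) = sh s (dcoef a)"
  by (auto simp: dcoef_def sh_def algebra_simps)

lemma nm_sh: "nm (ts N (sh s a)) = nm (ts N a)"
proof -
  have "(\<integral>x. (ts N a (x + - s))\<^sup>2 \<partial>mu) = (\<integral>x. (ts N a x)\<^sup>2 \<partial>mu)"
    by (rule TP_integral_mu_shift) (intro TP_power ts_TP)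
  then have "(nm (ts N (sh s a)))\<^sup>2 = (nm (ts N a))\<^sup>2"
    by (simp add: nm_sq_integral ts_sh)
  then show ?thesis by simp
qed

lemma ip_sh_deriv:
  assumes "\<phi> \<in> sq_int"
  shows "((\<lambda>s. ip \<phi> (ts N (sh s a))) has_real_derivative - ip \<phi> (ts N (dcoef (sh s a)))) (at s)"
proof -
  have "((\<lambda>s. \<Sum>k\<in>K N. sh s a k * cf \<phi> k) has_real_derivative (\<Sum>k\<in>K N. - dcoef (sh s a) k * cf \<phi> k)) (at s)"
    unfolding sh_def by (intro DERIV_sum) (auto intro!: derivative_eq_intros simp: dcoef_def algebra_simps)
  then show ?thesis
    using assms by (simp add: ip_ts sum_negf)
qed

lemma sh_periodic: "sh (s + of_int n * L) a = sh s a"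
proof
  fix k
  have *: "of_int k * om * (s + of_int n * L) = of_int k * om * s + (2 * pi) * of_int (k * n)"
    using om_L by (simp add: algebra_simps)
  show "sh (s + of_int n * L) a k = sh s a k"
    unfolding sh_def * cos_add sin_add cos_int_2pin sin_int_2pin by simp
qed

lemma ip_sh_max:
  assumes "\<phi> \<in> sq_int"
  obtains s where "\<And>s'. ip \<phi> (ts N (sh s' a)) \<le> ip \<phi> (ts N (sh s a))"
proof -
  let ?F = "\<lambda>s. ip \<phi> (ts N (sh s a))"
  have "continuous_on {0..L} ?F"
    by (rule DERIV_continuous_on, rule has_field_derivative_at_within, rule ip_sh_deriv[OF assms])
  then obtain s where s: "\<And>s'. s' \<in> {0..L} \<Longrightarrow> ?F s' \<le> ?F s"
    using continuous_attains_sup[of "{0..L}" ?F] L_pos by force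
  have "?F s' \<le> ?F s" for s'
  proof -
    \<comment> \<open>The representative of \<open>s'\<close> modulo \<open>L\<close> in the compact
      interval on which the maximum was taken.\<close>
    define r where "r = s' + of_int (- \<lfloor>s' / L\<rfloor>) * L"
    have "of_int \<lfloor>s' / L\<rfloor> * L \<le> s'" "s' \<le> (of_int \<lfloor>s' / L\<rfloor> + 1) * L"
      using iffD1[OF pos_le_divide_eq[OF L_pos] of_int_floor_le]
        iffD1[OF pos_divide_le_eq[OF L_pos] real_of_int_floor_add_one_ge] by blast+
    then have "r \<in> {0..L}" by (simp add: r_def algebra_simps)
    moreover have "?F r = ?F s'" unfolding r_def sh_periodic ..
    ultimately show ?thesis using s by metis
  qed
  then show ?thesis using that by blast
qed

end

text \<open>\<open>C\<close> is a parameter rather than a witness extracted from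
  \<open>f_dual\<close>, so that all thresholds depend on the data only and are shared by every
  solution.\<close>

locale weak_sol = torus +
  fixes \<nu> \<beta> \<gamma> :: real and f :: "(real \<Rightarrow> real) \<Rightarrow> real" and C :: real and u :: "real \<Rightarrow> real \<Rightarrow> real"
  assumes nu_pos: "0 < \<nu>"
    and f_dual: "f \<in> dual_V L"
    and C_nonneg: "0 \<le> C" and f_bound: "\<And>\<phi>. \<phi> \<in> space_V L \<Longrightarrow> \<bar>f \<phi>\<bar> \<le> C * V_norm L \<phi>"
    and sol: "weak_solution L \<nu> \<beta> \<gamma> f u"
begin

lemma u_H: "0 \<le> t \<Longrightarrow> u t \<in> space_H L"
  using sol by (simp add: weak_solution_def continuous_into_H_def)

lemma u_sq_int: "0 \<le> t \<Longrightarrow> u t \<in> sq_int"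
  by (simp add: u_H space_H_sq_int)

lemma u_mean: "0 \<le> t \<Longrightarrow> ip (u t) (\<lambda>x. 1) = 0"
  using u_H by (simp add: space_H_def torus_integral_eq_ip_one)

lemma u_cont:
  assumes "0 \<le> t"
  shows "((\<lambda>s. nm (\<lambda>x. u t x - u s x)) \<longlongrightarrow> 0) (at t within {0..})"
  using sol assms unfolding weak_solution_def continuous_into_H_def
  by (subst nm_minus_commute) auto

lemma ip_u_cont':
  assumes "0 \<le> t" and "\<And>s. 0 \<le> s \<Longrightarrow> v s \<in> sq_int"
    and "((\<lambda>s. nm (\<lambda>x. v t x - v s x)) \<longlongrightarrow> 0) (at t within {0..})"
  shows "((\<lambda>s. ip (u s) (v s)) \<longlongrightarrow> ip (u t) (v t)) (at t within {0..})"
proof -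
  \<comment> \<open>Nothing is known of \<open>u\<close> at negative times, whereas
    \<open>ip_tendsto\<close> wants square integrability at every index; composing with
    \<open>max 0\<close> bridges the gap.\<close>
  have ev: "\<forall>\<^sub>F s in at t within {0..}. max 0 s = s"
    by (auto simp: eventually_at_filter)
  have "((\<lambda>s. nm (\<lambda>x. u t x - u (max 0 s) x)) \<longlongrightarrow> 0) (at t within {0..})"
    by (rule Lim_transform_eventually[OF u_cont[OF assms(1)]]) (use ev in \<open>eventually_elim, simp\<close>)
  moreover have "((\<lambda>s. nm (\<lambda>x. v t x - v (max 0 s) x)) \<longlongrightarrow> 0) (at t within {0..})"
    by (rule Lim_transform_eventually[OF assms(3)]) (use ev in \<open>eventually_elim, simp\<close>)
  ultimately have "((\<lambda>s. ip (u (max 0 s)) (v (max 0 s))) \<longlongrightarrow> ip (u t) (v t)) (at t within {0..})"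
    using assms by (intro ip_tendsto) (auto simp: u_sq_int)
  then show ?thesis
    by (rule Lim_transform_eventually) (use ev in \<open>eventually_elim, simp\<close>)
qed

lemma ip_u_cont: 
  assumes "\<psi> \<in> sq_int"
  shows "continuous_on {0..} (\<lambda>t. ip (u t) \<psi>)"
proof -
  have 0: "nm (\<lambda>x. \<psi> x - \<psi> x) = 0" by (simp add: L2_norm_def ip_eq)
  show ?thesis
    unfolding continuous_on_def
  proof
    fix t :: real assume "t \<in> {0..}"
    then show "((\<lambda>t. ip (u t) \<psi>) \<longlongrightarrow> ip (u t) \<psi>) (at t within {0..})"
      using assms 0 by (intro ip_u_cont'[where v = "\<lambda>_. \<psi>"]) auto
  qed
qed

lemma ip_u_sq_cont:
  assumes "\<psi> \<in> TP"
  shows "continuous_on {0..} (\<lambda>t. ip (\<lambda>x. (u t x)\<^sup>2) \<psi>)"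
  unfolding continuous_on_def
proof
  fix t :: real assume t: "t \<in> {0..}"
  obtain B where B: "\<forall>x. \<bar>\<psi> x\<bar> \<le> B" using TP_bounded[OF assms] by blast
  have ev: "\<forall>\<^sub>F s in at t within {0..}. max 0 s = s"
    by (auto simp: eventually_at_filter)
  have "((\<lambda>s. nm (\<lambda>x. u t x - u (max 0 s) x)) \<longlongrightarrow> 0) (at t within {0..})"
    by (rule Lim_transform_eventually[OF u_cont]) (use t ev in \<open>auto elim: eventually_mono\<close>)
  then have "((\<lambda>s. nm (\<lambda>x. u t x * \<psi> x - u (max 0 s) x * \<psi> x)) \<longlongrightarrow> 0) (at t within {0..})"
    using t B assms by (intro nm_mult_tendsto[where B = B]) (auto simp: u_sq_int TP_meas)
  then have "((\<lambda>s. nm (\<lambda>x. u t x * \<psi> x - u s x * \<psi> x)) \<longlongrightarrow> 0) (at t within {0..})"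
    by (rule Lim_transform_eventually) (use ev in \<open>auto elim: eventually_mono\<close>)
  then show "((\<lambda>t. ip (\<lambda>x. (u t x)\<^sup>2) \<psi>) \<longlongrightarrow> ip (\<lambda>x. (u t x)\<^sup>2) \<psi>) (at t within {0..})"
    unfolding ip_sq_TP using t assms by (intro ip_u_cont') (auto simp: u_sq_int)
qed

lemma nm_u_cont: "continuous_on {0..} (\<lambda>t. nm (u t))"
  unfolding continuous_on_def L2_norm_def
  by (intro ballI tendsto_real_sqrt ip_u_cont' u_cont) (auto simp: u_sq_int)

text \<open>The time derivative of \<open>(u t, ts N a)\<close>, with every space derivative moved
  onto the test function. It contains \<open>u\<close> but not \<open>u_x\<close>, and is therefore
  continuous in time.\<close>

definition G :: "nat \<Rightarrow> (int \<Rightarrow> real) \<Rightarrow> real \<Rightarrow> real" where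
  "G N a t = \<nu> * ip (u t) (ts N (dcoef (dcoef a))) + 1/2 * ip (\<lambda>x. (u t x)\<^sup>2) (ts N (dcoef a))
    + \<beta> * ip (u t) (ts N a) + \<gamma> * ip (u t) (ts N (dcoef (dcoef (dcoef a)))) + f (ts N a)"

lemma G_cont: "continuous_on {0..} (G N a)"
  unfolding G_def[abs_def] by (intro continuous_intros ip_u_cont ip_u_sq_cont ts_TP ts_sq_int)

lemma G_cont_Icc: "0 \<le> t1 \<Longrightarrow> continuous_on {t1..t2} (G N a)"
  by (rule continuous_on_subset[OF G_cont]) auto

text \<open>The null set of times at which \<open>dx L (u t)\<close> carries no information.\<close>

definition Z :: "real set" where "Z = {t. 0 \<le> t \<and> u t \<notin> space_V L}"

lemma negligible_Z: "negligible Z"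
proof -
  have "AE t in lebesgue. t \<notin> Z"
    using sol by (simp add: weak_solution_def L2_loc_V_def Z_def)
  then obtain N where "negligible N" "{t. \<not> t \<notin> Z} \<subseteq> N"
    unfolding eventually_ae_filter_negligible by blast
  then show ?thesis
    by (auto intro: negligible_subset)
qed

lemma u_V: "0 \<le> t \<Longrightarrow> t \<notin> Z \<Longrightarrow> u t \<in> space_V L"
  by (simp add: Z_def)

text \<open>Outside \<open>Z\<close> the integrand of the weak formulation equals the continuous
  function \<open>f (ts N a) - G N a\<close>, so the Lebesgue integral becomes a gauge integral of a
  continuous function.\<close>

lemma weak_form_0:
  assumes "0 \<le> t"
  shows "integral {0..t} (G N a) = ip (u t) (ts N a) - ip (u 0) (ts N a)"
proof -
  let ?\<psi> = "ts N a"
  let ?I = "\<lambda>s. \<nu> * ip (dx L (u s)) (deriv ?\<psi>) + ip (\<lambda>x. u s x * dx L (u s) x) ?\<psi>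
          - \<beta> * ip (u s) ?\<psi> + \<gamma> * ip (dx L (u s)) (deriv (deriv ?\<psi>))"
  let ?H = "\<lambda>s. f ?\<psi> - G N a s"
  have Hc: "continuous_on {0..t} ?H"
    by (intro continuous_intros G_cont_Icc) simp
  have eq: "?I s = ?H s" if "s \<in> {0..t} - Z" for s
  proof -
    have V: "u s \<in> space_V L" using that by (auto simp: Z_def)
    note g = weak_deriv_dx[OF V]
    have "ip (dx L (u s)) (ts N b) = - ip (u s) (ts N (dcoef b))" for b
      using weak_deriv_facts(4)[OF g ts_TP[of N b]] by (simp add: deriv_ts)
    then show ?thesis
      using product_rule[OF V g ts_TP[of N a]] by (simp add: deriv_ts G_def)
  qed
  have "?I absolutely_integrable_on {0..t}"
    by (rule absolutely_integrable_spike[OF absolutely_integrable_continuous_real[OF Hc] negligible_Z eq])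
  then have "(LINT s:{0..t}|lebesgue. ?I s) = integral {0..t} ?I"
    by (rule set_lebesgue_integral_eq_integral(2))
  also have "\<dots> = integral {0..t} ?H"
    by (rule integral_spike[OF negligible_Z]) (use eq in auto)
  also have "\<dots> = t * f ?\<psi> - integral {0..t} (G N a)"
    using assms by (subst integral_diff) (auto intro: integrable_continuous_real G_cont_Icc)
  finally have "(LINT s:{0..t}|lebesgue. ?I s) = t * f ?\<psi> - integral {0..t} (G N a)" .
  moreover have "torus_integral L ?\<psi> = 0"
    using ts_space_V[of N a] by (simp add: space_V_def space_H_def)
  then have "ip (u t) ?\<psi> - ip (u 0) ?\<psi> + (LINT s:{0..t}|lebesgue. ?I s) = t * f ?\<psi>"
    using sol assms ts_smooth[of N a] unfolding weak_solution_def by blast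
  ultimately show ?thesis by linarith
qed

lemma weak_form:
  assumes "0 \<le> t1" "t1 \<le> t2"
  shows "integral {t1..t2} (G N a) = ip (u t2) (ts N a) - ip (u t1) (ts N a)"
  using weak_form_0[of t1 N a] weak_form_0[of t2 N a] assms
    Henstock_Kurzweil_Integration.integral_combine[of 0 t1 t2 "G N a"] integrable_continuous_real[OF G_cont_Icc[of 0 t2]]
  by simp

text \<open>The Fourier coefficient at \<open>k\<close> of the right-hand side of the equation. The
  derivatives now act on \<open>u\<close>, which reverses the signs of the odd ones compared with
  \<open>G\<close>.\<close>

definition w :: "int \<Rightarrow> real \<Rightarrow> real" where
  "w k t = \<nu> * dcoef (dcoef (cf (u t))) k - 1/2 * dcoef (cf (\<lambda>x. (u t x)\<^sup>2)) k
    + \<beta> * cf (u t) k - \<gamma> * dcoef (dcoef (dcoef (cf (u t)))) k + f (e k)"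

text \<open>Linearity of \<open>f\<close> is known on \<open>V\<close> only, so the induction runs
  over subsets of the modes, each partial sum being a \<open>ts\<close> with restricted coefficients
  and hence in \<open>V\<close>.\<close>

lemma f_ts: "f (ts N a) = (\<Sum>k\<in>K N. a k * f (e k))"
proof -
  have eV: "e k \<in> space_V L" if "k \<in> K N" for k
    using ts_space_V ts_delta[OF that] by metis
  have add: "f (\<lambda>x. \<phi> x + \<psi> x) = f \<phi> + f \<psi>" if "\<phi> \<in> space_V L" "\<psi> \<in> space_V L" for \<phi> \<psi>
    using f_dual that by (simp add: dual_V_def)
  have scale: "f (\<lambda>x. c * \<phi> x) = c * f \<phi>" if "\<phi> \<in> space_V L" for \<phi> c
    using f_dual that by (simp add: dual_V_def)
  define b where "b A k = (if k \<in> A then a k else 0)" for A k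
  have restr: "ts N (b A) = (\<lambda>x. \<Sum>k\<in>A. a k * e k x)" if "A \<subseteq> K N" for A
    unfolding ts_def[abs_def] b_def using that by (intro ext sum.mono_neutral_cong_right) auto
  have "A \<subseteq> K N \<Longrightarrow> f (\<lambda>x. \<Sum>k\<in>A. a k * e k x) = (\<Sum>k\<in>A. a k * f (e k))" if "finite A" for A
    using that
  proof (induction A rule: finite_induct)
    case empty
    show ?case using scale[OF ts_space_V[of 0 "\<lambda>_. 0"], of 0] by simp
  next
    case (insert k A)
    then have k: "k \<in> K N" by simp
    have "(\<lambda>x. \<Sum>l\<in>A. a l * e l x) \<in> space_V L"
      using restr[of A] ts_space_V[of N "b A"] insert by simp
    moreover have "(\<lambda>x. a k * e k x) \<in> space_V L"
      using restr[of "{k}"] ts_space_V[of N "b {k}"] insert by simp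
    ultimately show ?case
      using insert add scale[OF eV[OF k]] by simp
  qed
  then show ?thesis unfolding ts_def[abs_def] by simp
qed

lemma G_eq_sum:
  assumes "0 \<le> t"
  shows "G N a t = (\<Sum>k\<in>K N. a k * w k t)"
proof -
  have sq: "ip (\<lambda>x. (u t x)\<^sup>2) (ts N b) = (\<Sum>k\<in>K N. b k * cf (\<lambda>x. (u t x)\<^sup>2) k)" for b
    by (rule ip_ts_of_integrable) (intro sq_TP_integrable u_sq_int assms e_TP)
  show ?thesis
    unfolding G_def sq ip_ts[OF u_sq_int[OF assms]] f_ts sum_dcoef w_def
    by (simp add: algebra_simps sum.distrib sum_subtractf sum_negf sum_distrib_left)
qed

lemma w_eq_G:
  assumes "k \<in> K N" "0 \<le> t"
  shows "w k t = G N (\<lambda>l. if l = k then 1 else 0) t"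
proof -
  have "G N (\<lambda>l. if l = k then 1 else 0) t = (\<Sum>l\<in>K N. if l = k then w l t else 0)"
    unfolding G_eq_sum[OF assms(2)] by (intro sum.cong) auto
  then show ?thesis using assms(1) by simp
qed

text \<open>Testing with a single mode gives an ordinary differential equation. Each coefficient is
  differentiable in time, which legitimises the time-dependent test function
  \<open>P N (u t)\<close>.\<close>

lemma cf_u_deriv:
  assumes "k \<in> K N" "0 \<le> t1" "t \<in> {t1..t2}"
  shows "((\<lambda>t. cf (u t) k) has_real_derivative w k t) (at t within {t1..t2})"
proof -
  let ?d = "\<lambda>l. if l = k then 1 else 0 :: real"
  have "((\<lambda>t. integral {t1..t} (G N ?d)) has_real_derivative G N ?d t) (at t within {t1..t2})"
    using assms by (intro integral_has_real_derivative G_cont_Icc)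
  then have "((\<lambda>t. cf (u t1) k + integral {t1..t} (G N ?d)) has_real_derivative w k t) (at t within {t1..t2})"
    using assms w_eq_G[OF assms(1), of t] by (auto intro!: derivative_eq_intros)
  then show ?thesis
  proof (rule has_field_derivative_transform_within[where d = 1])
    fix s assume "s \<in> {t1..t2}"
    then show "cf (u t1) k + integral {t1..s} (G N ?d) = cf (u s) k"
      using weak_form[of t1 s N ?d] assms by (simp add: cf_def ts_delta[OF assms(1)])
  qed (use assms in auto)
qed

section \<open>The energy inequality, by projection and passage to the limit\<close>

definition \<kappa> :: real where "\<kappa> = 2 * \<bar>\<beta>\<bar> + \<nu>"

lemma energy_N:
  assumes "0 \<le> t1" "t1 \<le> t2"
  shows "integral {t1..t2} (\<lambda>t. 2 * G N (cf (u t)) t) = (nm (P N (u t2)))\<^sup>2 - (nm (P N (u t1)))\<^sup>2"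
    and "(\<lambda>t. 2 * G N (cf (u t)) t) integrable_on {t1..t2}"
proof -
  have "((\<lambda>t. \<Sum>k\<in>K N. cf (u t) k * cf (u t) k) has_real_derivative 2 * G N (cf (u t)) t) (at t within {t1..t2})"
    if "t \<in> {t1..t2}" for t
  proof -
    have "((\<lambda>t. \<Sum>k\<in>K N. cf (u t) k * cf (u t) k) has_real_derivative (\<Sum>k\<in>K N. w k t * cf (u t) k + w k t * cf (u t) k)) (at t within {t1..t2})"
      using assms that by (intro DERIV_sum DERIV_mult cf_u_deriv) auto
    also have "(\<Sum>k\<in>K N. w k t * cf (u t) k + w k t * cf (u t) k) = 2 * G N (cf (u t)) t"
      using assms that G_eq_sum[of t N "cf (u t)"] by (simp add: sum_distrib_left mult.commute)
    finally show ?thesis .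
  qed
  then have "((\<lambda>t. 2 * G N (cf (u t)) t) has_integral
     ((\<Sum>k\<in>K N. cf (u t2) k * cf (u t2) k) - (\<Sum>k\<in>K N. cf (u t1) k * cf (u t1) k))) {t1..t2}"
    using assms by (intro fundamental_theorem_of_calculus) (auto simp: has_real_derivative_iff_has_vector_derivative)
  then have "((\<lambda>t. 2 * G N (cf (u t)) t) has_integral
     ((nm (P N (u t2)))\<^sup>2 - (nm (P N (u t1)))\<^sup>2)) {t1..t2}"
    by (simp add: nm_sq ip_ts_ts)
  then show "integral {t1..t2} (\<lambda>t. 2 * G N (cf (u t)) t) = (nm (P N (u t2)))\<^sup>2 - (nm (P N (u t1)))\<^sup>2"
    "(\<lambda>t. 2 * G N (cf (u t)) t) integrable_on {t1..t2}"
    by (rule integral_unique, rule has_integral_integrable)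
qed

text \<open>An upper bound for twice the power. The forcing is removed by Young's inequality, which
  takes one of the two units of dissipation and adds \<nu> to \<kappa>; the cubic term stays, since
  it vanishes only in the limit.\<close>

definition R :: "nat \<Rightarrow> real \<Rightarrow> real" where
  "R N t = - \<nu> * (nm (ts N (dcoef (cf (u t)))))\<^sup>2 + ip (\<lambda>x. (u t x)\<^sup>2) (ts N (dcoef (cf (u t))))
    + \<kappa> * (nm (P N (u t)))\<^sup>2 + C\<^sup>2 / \<nu>"

text \<open>On coefficients d/dx is antisymmetric, so the third derivative pairs to zero with the
  projection itself and dispersion drops out before any limit is taken.\<close>

lemma G_le_R:
  assumes "0 \<le> t"
  shows "2 * G N (cf (u t)) t \<le> R N t"
proof -
  let ?c = "cf (u t)" and ?D = "nm (ts N (dcoef (cf (u t))))" and ?E = "nm (P N (u t))"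
  have red: "ip (u t) (ts N b) = ip (P N (u t)) (ts N b)" for b
    by (simp add: ip_ts[OF u_sq_int[OF assms]] ip_ts_ts mult.commute)
  have diss: "ip (u t) (ts N (dcoef (dcoef ?c))) = - ?D\<^sup>2"
    unfolding red ip_ts_by_parts nm_sq ..
  have "ip (ts N (dcoef ?c)) (ts N (dcoef (dcoef ?c))) = - ip (ts N (dcoef (dcoef ?c))) (ts N (dcoef ?c))"
    by (rule ip_ts_by_parts)
  then have "ip (ts N (dcoef ?c)) (ts N (dcoef (dcoef ?c))) = 0"
    using ip_sym[of "ts N (dcoef (dcoef ?c))" "ts N (dcoef ?c)"] by simp
  then have disp: "ip (u t) (ts N (dcoef (dcoef (dcoef ?c)))) = 0"
    unfolding red ip_ts_by_parts by simp
  have self: "ip (u t) (P N (u t)) = ?E\<^sup>2"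
    by (rule ip_P_eq[OF u_sq_int[OF assms]])
  have "2 * f (P N (u t)) \<le> 2 * (C * sqrt (?E\<^sup>2 + ?D\<^sup>2))"
    using f_bound[OF ts_space_V[of N ?c]] by (simp add: V_norm_ts)
  also have "\<dots> \<le> C\<^sup>2 / \<nu> + \<nu> * (?E\<^sup>2 + ?D\<^sup>2)"
  proof -
    define q where "q = sqrt (?E\<^sup>2 + ?D\<^sup>2)"
    have q2: "q\<^sup>2 = ?E\<^sup>2 + ?D\<^sup>2" by (simp add: q_def)
    have "0 \<le> (C - \<nu> * q)\<^sup>2 / \<nu>" using nu_pos by simp
    also have "\<dots> = C\<^sup>2 / \<nu> - 2 * (C * q) + \<nu> * q\<^sup>2"
      using nu_pos by (simp add: power2_diff power_mult_distrib diff_divide_distrib add_divide_distrib)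
        (simp add: power2_eq_square)
    finally have "2 * (C * q) \<le> C\<^sup>2 / \<nu> + \<nu> * q\<^sup>2" by simp
    then show ?thesis unfolding q2 by (simp only: q_def)
  qed
  finally have "2 * f (P N (u t)) \<le> C\<^sup>2 / \<nu> + \<nu> * (?E\<^sup>2 + ?D\<^sup>2)" .
  moreover have "\<beta> * ?E\<^sup>2 \<le> \<bar>\<beta>\<bar> * ?E\<^sup>2"
    by (intro mult_right_mono) auto
  ultimately show ?thesis
    unfolding G_def diss disp self R_def \<kappa>_def by (simp add: algebra_simps)
qed

lemma R_cont:
  assumes "0 \<le> t1"
  shows "continuous_on {t1..t2} (R N)"
proof -
  have c: "continuous_on {t1..t2} (\<lambda>t. cf (u t) k)" for k
    unfolding cf_def by (rule continuous_on_subset[OF ip_u_cont]) (use assms in auto)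
  have q: "continuous_on {t1..t2} (\<lambda>t. cf (\<lambda>x. (u t x)\<^sup>2) k)" for k
    unfolding cf_def by (rule continuous_on_subset[OF ip_u_sq_cont[OF e_TP]]) (use assms in auto)
  have d: "continuous_on {t1..t2} (\<lambda>t. dcoef (cf (u t)) k)" for k
    unfolding dcoef_def by (intro continuous_intros c)
  have "continuous_on {t1..t2} (\<lambda>t. - \<nu> * (\<Sum>k\<in>K N. dcoef (cf (u t)) k * dcoef (cf (u t)) k)
      + (\<Sum>k\<in>K N. dcoef (cf (u t)) k * cf (\<lambda>x. (u t x)\<^sup>2) k) + \<kappa> * (\<Sum>k\<in>K N. cf (u t) k * cf (u t) k) + C\<^sup>2 / \<nu>)"
    by (intro continuous_intros c q d)
  then show ?thesis
  proof (rule continuous_on_eq)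
    fix t assume "t \<in> {t1..t2}"
    then have t: "0 \<le> t" using assms by auto
    have "ip (\<lambda>x. (u t x)\<^sup>2) (ts N b) = (\<Sum>k\<in>K N. b k * cf (\<lambda>x. (u t x)\<^sup>2) k)" for b
      by (rule ip_ts_of_integrable) (intro sq_TP_integrable u_sq_int t e_TP)
    then show "- \<nu> * (\<Sum>k\<in>K N. dcoef (cf (u t)) k * dcoef (cf (u t)) k)
      + (\<Sum>k\<in>K N. dcoef (cf (u t)) k * cf (\<lambda>x. (u t x)\<^sup>2) k) + \<kappa> * (\<Sum>k\<in>K N. cf (u t) k * cf (u t) k) + C\<^sup>2 / \<nu> = R N t"
      by (simp add: R_def nm_sq ip_ts_ts)
  qed
qed

abbreviation D :: "real \<Rightarrow> real" where "D t \<equiv> (nm (dx L (u t)))\<^sup>2"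

lemma nm_u_sq_integrable:
  assumes "0 \<le> t1"
  shows "(\<lambda>t. (nm (u t))\<^sup>2) integrable_on {t1..t2}" "(\<lambda>t. nm (u t)) integrable_on {t1..t2}"
proof -
  have "continuous_on {t1..t2} (\<lambda>t. nm (u t))"
    by (rule continuous_on_subset[OF nm_u_cont]) (use assms in auto)
  then show "(\<lambda>t. (nm (u t))\<^sup>2) integrable_on {t1..t2}" "(\<lambda>t. nm (u t)) integrable_on {t1..t2}"
    by (auto intro!: integrable_continuous_real continuous_intros)
qed

lemma D_integrable:
  assumes "0 \<le> t1"
  shows "D integrable_on {t1..t2}"
proof -
  have "set_integrable lebesgue {0..max t2 0 + 1} (\<lambda>t. (V_norm L (u t))\<^sup>2)"
    using sol by (auto simp: weak_solution_def L2_loc_V_def)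
  then have "(\<lambda>t. (V_norm L (u t))\<^sup>2) integrable_on {0..max t2 0 + 1}"
    by (rule set_lebesgue_integral_eq_integral)
  then have "(\<lambda>t. (V_norm L (u t))\<^sup>2) integrable_on {t1..t2}"
    by (rule integrable_subinterval_real) (use assms in auto)
  then have "(\<lambda>t. (V_norm L (u t))\<^sup>2 - (nm (u t))\<^sup>2) integrable_on {t1..t2}"
    using assms by (intro integrable_diff nm_u_sq_integrable)
  then show ?thesis by (simp add: V_norm_def)
qed

text \<open>The projected inequality is integrated in time and \<open>N\<close> tends to infinity by
  dominated convergence: the cubic term disappears, while dissipation and energy converge.\<close>

lemma energy:
  assumes "0 \<le> t1" "t1 \<le> t2"
  shows "(nm (u t2))\<^sup>2 + \<nu> * integral {t1..t2} D
    \<le> (nm (u t1))\<^sup>2 + integral {t1..t2} (\<lambda>t. \<kappa> * (nm (u t))\<^sup>2 + C\<^sup>2 / \<nu>)"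
proof -
  define Rl where "Rl t = - \<nu> * D t + \<kappa> * (nm (u t))\<^sup>2 + C\<^sup>2 / \<nu>" for t
  \<comment> \<open>Dominated convergence is used in its everywhere form, so on \<open>Z\<close> the
    sequence is replaced by its limit; integrals do not notice.\<close>
  define F where "F N t = (if t \<in> Z then Rl t else R N t)" for N t
  have "compact ((\<lambda>t. nm (u t)) ` {t1..t2})"
    by (intro compact_continuous_image continuous_on_subset[OF nm_u_cont]) (use assms in auto)
  then have "bdd_above ((\<lambda>t. nm (u t)) ` {t1..t2})"
    by (intro bounded_imp_bdd_above compact_imp_bounded)
  then obtain U where "\<forall>t\<in>{t1..t2}. nm (u t) \<le> U"
    by (auto simp: bdd_above_def)
  then have U: "\<And>t. t \<in> {t1..t2} \<Longrightarrow> nm (u t) \<le> U"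
    by blast
  \<comment> \<open>The cubic term is dominated because \<open>nm (u t)\<close> is bounded by
    \<open>U\<close> on the interval and \<open>D\<close> is integrable.\<close>
  define h where "h t = (\<nu> + sqrt L * U) * D t + (\<kappa> * (nm (u t))\<^sup>2 + C\<^sup>2 / \<nu>)" for t
  have \<kappa>: "0 \<le> \<kappa>" using nu_pos by (simp add: \<kappa>_def)
  have Cn: "0 \<le> C\<^sup>2 / \<nu>" using nu_pos by simp
  have hint: "h integrable_on {t1..t2}"
    unfolding h_def using assms
    by (intro integrable_add integrable_on_mult_right D_integrable nm_u_sq_integrable) auto
  have Fint: "F N integrable_on {t1..t2}" for N
    by (rule integrable_spike[OF integrable_continuous_real[OF R_cont[OF assms(1)]] negligible_Z])
      (auto simp: F_def)
  have U0: "0 \<le> U" using order_trans[OF nm_nonneg U[of t1]] assms by simp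
  have bd: "norm (F N t) \<le> h t" if t: "t \<in> {t1..t2}" for N t
  proof (cases "t \<in> Z")
    case True
    have "norm (Rl t) \<le> \<nu> * D t + \<kappa> * (nm (u t))\<^sup>2 + C\<^sup>2 / \<nu>"
      using nu_pos \<kappa> Cn unfolding Rl_def real_norm_def by (intro abs_leI) auto
    also have "\<dots> \<le> h t"
      unfolding h_def using L_pos U0 by (simp add: distrib_right)
    finally show ?thesis using True by (simp add: F_def)
  next
    case False
    then have V: "u t \<in> space_V L" using t assms by (auto simp: Z_def)
    note g = weak_deriv_dx[OF V]
    have "nm (P N (dx L (u t))) \<le> nm (dx L (u t))"
      by (intro nm_P_le weak_deriv_facts(1)[OF g])
    then have 1: "(nm (P N (dx L (u t))))\<^sup>2 \<le> D t" by (simp add: power_mono)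
    have "nm (P N (u t)) \<le> nm (u t)"
      by (intro nm_P_le space_V_sq_int V)
    then have 2: "(nm (P N (u t)))\<^sup>2 \<le> (nm (u t))\<^sup>2" by (simp add: power_mono)
    have "\<bar>ip (\<lambda>x. (u t x)\<^sup>2) (P N (dx L (u t)))\<bar> \<le> sqrt L * nm (u t) * D t"
      by (rule cubic_P_bound[OF V g])
    also have "\<dots> \<le> sqrt L * U * D t"
      using U[OF t] L_pos by (intro mult_right_mono mult_left_mono) auto
    finally have 3: "\<bar>ip (\<lambda>x. (u t x)\<^sup>2) (P N (dx L (u t)))\<bar> \<le> sqrt L * U * D t" .
    have 4: "\<nu> * (nm (P N (dx L (u t))))\<^sup>2 \<le> \<nu> * D t" "\<kappa> * (nm (P N (u t)))\<^sup>2 \<le> \<kappa> * (nm (u t))\<^sup>2"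
      using 1 2 nu_pos \<kappa> by (auto intro: mult_left_mono)
    have 5: "0 \<le> \<nu> * (nm (P N (dx L (u t))))\<^sup>2" "0 \<le> \<kappa> * (nm (P N (u t)))\<^sup>2"
      using nu_pos \<kappa> by auto
    have "\<bar>R N t\<bar> \<le> h t"
      unfolding R_def h_def P_deriv[OF V g] distrib_right mult_minus_left
      using 3 4 5 Cn by (intro abs_leI) linarith+
    then show ?thesis using False by (simp add: F_def)
  qed
  have lim: "(\<lambda>N. F N t) \<longlonglongrightarrow> Rl t" if t: "t \<in> {t1..t2}" for t
  proof (cases "t \<in> Z")
    case False
    then have V: "u t \<in> space_V L" using t assms by (auto simp: Z_def)
    note g = weak_deriv_dx[OF V]
    have "(\<lambda>N. - \<nu> * (nm (P N (dx L (u t))))\<^sup>2 + ip (\<lambda>x. (u t x)\<^sup>2) (P N (dx L (u t)))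
        + \<kappa> * (nm (P N (u t)))\<^sup>2 + C\<^sup>2 / \<nu>) \<longlonglongrightarrow> - \<nu> * D t + 0 + \<kappa> * (nm (u t))\<^sup>2 + C\<^sup>2 / \<nu>"
      by (intro tendsto_intros cubic_P_tendsto[OF V g] nm_tendsto P_deriv_tendsto_V[OF V g]
          P_tendsto_V[OF V g] ts_sq_int space_V_sq_int[OF V] weak_deriv_facts(1)[OF g])
    then show ?thesis
      using False by (simp add: F_def R_def Rl_def P_deriv[OF V g])
  qed (simp add: F_def)
  have "(\<lambda>N. integral {t1..t2} (F N)) \<longlonglongrightarrow> integral {t1..t2} Rl" and Rlint: "Rl integrable_on {t1..t2}"
    using dominated_convergence[OF Fint hint bd lim] by auto
  moreover have "integral {t1..t2} (F N) = integral {t1..t2} (R N)" for N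
    by (rule integral_spike[OF negligible_Z]) (auto simp: F_def)
  ultimately have "(\<lambda>N. integral {t1..t2} (R N)) \<longlonglongrightarrow> integral {t1..t2} Rl" by simp
  moreover have "(\<lambda>N. (nm (P N (u t2)))\<^sup>2 - (nm (P N (u t1)))\<^sup>2) \<longlonglongrightarrow> (nm (u t2))\<^sup>2 - (nm (u t1))\<^sup>2"
    using assms by (intro tendsto_intros nm_tendsto P_tendsto u_mean u_sq_int ts_sq_int) auto
  moreover have "(nm (P N (u t2)))\<^sup>2 - (nm (P N (u t1)))\<^sup>2 \<le> integral {t1..t2} (R N)" for N
    unfolding energy_N(1)[OF assms, symmetric]
    using assms by (intro integral_le energy_N(2) integrable_continuous_real R_cont G_le_R) auto
  ultimately have "(nm (u t2))\<^sup>2 - (nm (u t1))\<^sup>2 \<le> integral {t1..t2} Rl"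
    by (intro LIMSEQ_le) auto
  also have "integral {t1..t2} Rl = integral {t1..t2} (\<lambda>t. (\<kappa> * (nm (u t))\<^sup>2 + C\<^sup>2 / \<nu>) - \<nu> * D t)"
    by (intro arg_cong[where f = "integral {t1..t2}"] ext) (simp add: Rl_def)
  also have "\<dots> = integral {t1..t2} (\<lambda>t. \<kappa> * (nm (u t))\<^sup>2 + C\<^sup>2 / \<nu>) - \<nu> * integral {t1..t2} D"
    using assms by (subst integral_diff)
      (auto intro!: integrable_add integrable_on_mult_right D_integrable nm_u_sq_integrable)
  finally show ?thesis by simp
qed

end

section \<open>Background profiles\<close>

text \<open>With \<open>y\<close> a quarter of the absolute angle,
  \<open>1 - cos \<theta> = 2 (sin (2 y))^2\<close>, and \<open>sin (2 y) >= y\<close> because both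
  the cosine on \<open>[0, pi/4]\<close> and the slope of the sine there are at least
  \<open>1 / sqrt 2\<close>.\<close>

lemma square_le_one_minus_cos:
  fixes \<theta> :: real
  assumes "\<bar>\<theta>\<bar> \<le> pi"
  shows "\<theta>\<^sup>2 \<le> 8 * (1 - cos \<theta>)"
proof -
  define y where "y = \<bar>\<theta>\<bar> / 4"
  define c where "c = sqrt 2 / 2"
  have y: "0 \<le> y" "y \<le> pi / 4" using assms by (auto simp: y_def)
  have cos_ge: "c \<le> cos z" if "0 \<le> z" "z \<le> pi / 4" for z
    using cos_monotone_0_pi_le[of z "pi / 4"] that by (simp add: c_def cos_45)
  have "sin 0 - c * 0 \<le> sin y - c * y"
  proof (rule DERIV_nonneg_imp_nondecreasing[OF y(1)])
    fix z assume "0 \<le> z" "z \<le> y"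
    then show "\<exists>d. ((\<lambda>z. sin z - c * z) has_real_derivative d) (at z) \<and> 0 \<le> d"
      using y cos_ge[of z] by (intro exI[of _ "cos z - c"]) (auto intro!: derivative_eq_intros)
  qed
  then have sin: "c * y \<le> sin y" by simp
  have c2: "c\<^sup>2 = 1/2" and c0: "0 \<le> c" by (auto simp: c_def power_divide)
  have "0 \<le> c * y" using y c0 by simp
  then have "0 \<le> sin y" using sin by linarith
  then have "(c * y) * c \<le> sin y * cos y"
    using sin cos_ge[OF y] c0 by (intro mult_mono) auto
  then have "c\<^sup>2 * y \<le> sin y * cos y" by (simp add: power2_eq_square mult_ac)
  then have "y \<le> sin (2 * y)" using c2 by (simp add: sin_double)
  then have "y\<^sup>2 \<le> (sin (2 * y))\<^sup>2" using y by (intro power_mono) auto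
  moreover have "cos \<theta> = cos (2 * (2 * y))" by (simp add: y_def)
  then have "cos \<theta> = 1 - 2 * (sin (2 * y))\<^sup>2" by (simp only: cos_double_sin)
  ultimately have "2 * y\<^sup>2 \<le> 1 - cos \<theta>" by linarith
  moreover have "y\<^sup>2 = \<theta>\<^sup>2 / 16" by (simp add: y_def power_divide)
  ultimately show ?thesis by simp
qed

context torus
begin

lemma TP_integrable: "f \<in> TP \<Longrightarrow> integrable mu f"
  using sq_int_mult_integrable[OF sq_int_const[of 1] TP_sq_int] by simp

section \<open>Powers of the raised cosine as concentrating bumps\<close>

definition raised_cos :: "real \<Rightarrow> real" where "raised_cos x = 1 + cos (om * x)"

definition rc_mass :: "nat \<Rightarrow> real" where "rc_mass n = (\<integral>x. raised_cos x ^ n \<partial>mu)"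

lemma raised_cos_TP: "raised_cos \<in> TP"
  using TP_add[OF TP_const[of 1] TP_cos[of 1]] by (simp add: raised_cos_def[abs_def])

lemma raised_cos_bounds: "0 \<le> raised_cos x" "raised_cos x \<le> 2"
  using cos_ge_minus_one[of "om * x"] cos_le_one[of "om * x"] unfolding raised_cos_def by linarith+

lemma raised_cos_deriv: "(raised_cos has_real_derivative - om * sin (om * x)) (at x)"
  unfolding raised_cos_def[abs_def] by (auto intro!: derivative_eq_intros)

lemma rc_pow_TP: "(\<lambda>x. raised_cos x ^ n) \<in> TP"
  by (intro TP_power raised_cos_TP)

lemma rc_pow_int: "integrable mu (\<lambda>x. raised_cos x ^ n)"
  by (intro TP_integrable rc_pow_TP)

text \<open>The integrand is the derivative of \<open>sin (om x) (1 + cos (om x))^n\<close>,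
  simplified with \<open>sin^2 = r (2 - r)\<close> for \<open>r = 1 + cos\<close>.\<close>

lemma rc_mass_Suc: "real (n + 1) * rc_mass (Suc n) = real (2 * n + 1) * rc_mass n"
proof -
  have "(\<integral>x. om * (real (n + 1) * raised_cos x ^ Suc n - real (2 * n + 1) * raised_cos x ^ n) \<partial>mu) = 0"
  proof (rule integral_deriv_periodic)
    fix x
    show "((\<lambda>x. sin (om * x) * raised_cos x ^ n) has_real_derivative
        om * (real (n + 1) * raised_cos x ^ Suc n - real (2 * n + 1) * raised_cos x ^ n)) (at x)"
    proof -
      have "((\<lambda>x. sin (om * x) * raised_cos x ^ n) has_real_derivative
         (cos (om * x) * om) * raised_cos x ^ n + (real n * raised_cos x ^ (n - 1) * (- om * sin (om * x))) * sin (om * x)) (at x)"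
        by (auto intro!: derivative_eq_intros raised_cos_deriv)
      moreover have "(cos (om * x) * om) * raised_cos x ^ n + (real n * raised_cos x ^ (n - 1) * (- om * sin (om * x))) * sin (om * x)
          = om * (real (n + 1) * raised_cos x ^ Suc n - real (2 * n + 1) * raised_cos x ^ n)"
      proof -
        have "sin (om * x) * sin (om * x) = raised_cos x * (2 - raised_cos x)"
          using sin_cos_squared_add[of "om * x"] by (simp add: raised_cos_def power2_eq_square algebra_simps)
        then have *: "(real n * raised_cos x ^ (n - 1) * (- om * sin (om * x))) * sin (om * x)
            = - om * real n * (raised_cos x ^ (n - 1) * raised_cos x) * (2 - raised_cos x)"
          by (simp add: mult.assoc)
        have "real n * (raised_cos x ^ (n - 1) * raised_cos x) = real n * raised_cos x ^ n"
          by (cases n) auto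
        then have **: "- om * real n * (raised_cos x ^ (n - 1) * raised_cos x) * (2 - raised_cos x)
            = - om * real n * raised_cos x ^ n * (2 - raised_cos x)"
          by (simp only: mult.assoc[of "- om" "real n"])
        have cos: "cos (om * x) = raised_cos x - 1" by (simp add: raised_cos_def)
        show ?thesis unfolding * ** cos by (simp add: algebra_simps)
      qed
      ultimately show ?thesis by simp
    qed
    show "sin (om * (x + L)) * raised_cos (x + L) ^ n = sin (om * x) * raised_cos x ^ n"
      using sin_per[of 1 x] TP_per[OF raised_cos_TP, of x] by simp
  next
    show "continuous_on UNIV (\<lambda>x. om * (real (n + 1) * raised_cos x ^ Suc n - real (2 * n + 1) * raised_cos x ^ n))"
      by (intro continuous_intros TP_cont raised_cos_TP)
  qed
  then have "om * (real (n + 1) * rc_mass (Suc n) - real (2 * n + 1) * rc_mass n) = 0"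
    unfolding rc_mass_def using rc_pow_int[of n] rc_pow_int[of "Suc n"] by simp
  then show ?thesis using om_pos by simp
qed

text \<open>The true order is \<open>2^n L / sqrt n\<close>. The weaker bound follows from the
  recursion by an elementary inequality and costs a factor \<open>sqrt n\<close> in the height of
  the bump.\<close>

lemma rc_mass_lower: "2 ^ n * L / real (n + 1) \<le> rc_mass n"
proof (induction n)
  case 0
  then show ?case using measure_mu by (simp add: rc_mass_def)
next
  case (Suc n)
  have "2 ^ Suc n * L / real (Suc n + 1) \<le> real (2 * n + 1) / real (n + 1) * (2 ^ n * L / real (n + 1))"
  proof -
    have "2 * (real n + 1)\<^sup>2 \<le> (2 * real n + 1) * (real n + 2)"
      by (simp add: power2_eq_square algebra_simps)
    then have "2 / (real n + 2) \<le> (2 * real n + 1) / (real n + 1)\<^sup>2"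
      by (subst pos_divide_le_eq, simp, subst times_divide_eq_left, subst pos_le_divide_eq) simp_all
    then have "2 / (real n + 2) * (2 ^ n * L) \<le> (2 * real n + 1) / (real n + 1)\<^sup>2 * (2 ^ n * L)"
      using L_pos by (intro mult_right_mono) auto
    then show ?thesis by (simp add: power2_eq_square add_ac mult_ac)
  qed
  also have "\<dots> \<le> real (2 * n + 1) / real (n + 1) * rc_mass n"
    using Suc by (intro mult_left_mono) auto
  also have "\<dots> = rc_mass (Suc n)"
    using rc_mass_Suc[of n] by (simp add: field_simps)
  finally show ?case .
qed

lemma rc_mass_pos: "0 < rc_mass n"
  using rc_mass_lower[of n] L_pos by (meson divide_pos_pos less_le_trans mult_pos_pos of_nat_0_less_iff
      zero_less_numeral zero_less_power add_gr_0 zero_less_one)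

text \<open>A kernel of de la Vallee-Poussin type: it concentrates at 0 but has finitely many modes,
  so the profile built from it is an admissible test function.\<close>

definition bump :: "nat \<Rightarrow> real \<Rightarrow> real" where "bump n x = raised_cos x ^ n / rc_mass n"

lemma bump_TP: "bump n \<in> TP"
  using TP_cmult[OF rc_pow_TP, of "1 / rc_mass n"] by (simp add: bump_def[abs_def])

lemma bump_nonneg: "0 \<le> bump n x"
  using raised_cos_bounds rc_mass_pos[of n] by (simp add: bump_def)

lemma bump_mass: "(\<integral>x. bump n x \<partial>mu) = 1"
  using rc_mass_pos[of n] by (simp add: bump_def rc_mass_def[symmetric])

lemma two_pow_div_rc_mass: "2 ^ n / rc_mass n \<le> real (n + 1) / L"
  using rc_mass_lower[of n] rc_mass_pos[of n] L_pos by (simp add: field_simps)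

text \<open>\<open>|x|\<close> is split as \<open>\<delta>/2 + x^2/(2 \<delta>)\<close>, and
  \<open>x^2\<close> is bounded by a multiple of \<open>2 - raised_cos x\<close>, whose mean under
  the bump is exactly \<open>1/(n+1)\<close> by the mass recursion. The best \<delta> is of order
  \<open>1 / sqrt n\<close>.\<close>

lemma bump_moment:
  assumes "0 < \<delta>"
  shows "(\<integral>x. \<bar>x\<bar> * bump n x \<partial>mu) \<le> \<delta> / 2 + 4 / (om\<^sup>2 * \<delta> * real (n + 1))"
proof -
  have ptw: "\<bar>x\<bar> \<le> \<delta> / 2 + 4 / (om\<^sup>2 * \<delta>) * (2 - raised_cos x)" if "x \<in> {- L / 2..L / 2}" for x
  proof -
    have "\<bar>om * x\<bar> \<le> om * (L / 2)"
      using that om_pos by (auto simp: abs_mult intro!: mult_left_mono)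
    then have "(om * x)\<^sup>2 \<le> 8 * (1 - cos (om * x))"
      using om_L by (intro square_le_one_minus_cos) simp
    then have "x\<^sup>2 \<le> 8 / om\<^sup>2 * (2 - raised_cos x)"
      using om_pos by (simp add: raised_cos_def field_simps power_mult_distrib)
    then have "x\<^sup>2 / (2 * \<delta>) \<le> 8 / om\<^sup>2 * (2 - raised_cos x) / (2 * \<delta>)"
      using assms by (intro divide_right_mono) auto
    moreover have "\<bar>x\<bar> \<le> \<delta> / 2 + x\<^sup>2 / (2 * \<delta>)"
    proof -
      have "0 \<le> (\<bar>x\<bar> - \<delta>)\<^sup>2 / (2 * \<delta>)" using assms by simp
      also have "\<dots> = x\<^sup>2 / (2 * \<delta>) - \<bar>x\<bar> + \<delta> / 2"
        using assms by (simp add: power2_diff field_simps) (simp add: power2_eq_square)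
      finally show ?thesis by simp
    qed
    moreover have "8 / om\<^sup>2 * (2 - raised_cos x) / (2 * \<delta>) = 4 / (om\<^sup>2 * \<delta>) * (2 - raised_cos x)"
      using assms om_pos by (simp add: field_simps)
    ultimately show ?thesis by linarith
  qed
  have bint: "integrable mu (\<lambda>x. \<bar>x\<bar> * bump n x)"
    by (rule sq_int_mult_integrable[OF continuous_sq_int TP_sq_int[OF bump_TP]]) (intro continuous_intros)
  have m2: "(\<integral>x. raised_cos x * bump n x \<partial>mu) = 2 - 1 / real (n + 1)"
  proof -
    have "(\<integral>x. raised_cos x * bump n x \<partial>mu) = rc_mass (Suc n) / rc_mass n"
      by (simp add: bump_def rc_mass_def)
    also have "\<dots> = real (2 * n + 1) / real (n + 1)"
      using rc_mass_Suc[of n] rc_mass_pos[of n] by (simp add: field_simps)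
    finally show ?thesis by (simp add: field_simps)
  qed
  have ints: "integrable mu (bump n)" "integrable mu (\<lambda>x. raised_cos x * bump n x)"
    by (intro TP_integrable TP_mult bump_TP raised_cos_TP)+
  let ?c = "4 / (om\<^sup>2 * \<delta>)"
  have "(\<integral>x. \<bar>x\<bar> * bump n x \<partial>mu) \<le> (\<integral>x. (\<delta> / 2 + 2 * ?c) * bump n x - ?c * (raised_cos x * bump n x) \<partial>mu)"
  proof (rule integral_mono_AE[OF bint])
    show "integrable mu (\<lambda>x. (\<delta> / 2 + 2 * ?c) * bump n x - ?c * (raised_cos x * bump n x))"
      by (intro Bochner_Integration.integrable_diff integrable_mult_right ints)
    show "AE x in mu. \<bar>x\<bar> * bump n x \<le> (\<delta> / 2 + 2 * ?c) * bump n x - ?c * (raised_cos x * bump n x)"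
    proof (rule AE_mu_I)
      fix x assume "x \<in> {- L / 2..L / 2}"
      then have "\<bar>x\<bar> * bump n x \<le> (\<delta> / 2 + ?c * (2 - raised_cos x)) * bump n x"
        by (intro mult_right_mono ptw bump_nonneg)
      also have "\<dots> = (\<delta> / 2 + 2 * ?c) * bump n x - ?c * (raised_cos x * bump n x)"
        by (simp only: algebra_simps)
      finally show "\<bar>x\<bar> * bump n x \<le> (\<delta> / 2 + 2 * ?c) * bump n x - ?c * (raised_cos x * bump n x)" .
    qed
  qed
  also have "\<dots> = (\<delta> / 2 + 2 * ?c) - ?c * (2 - 1 / real (n + 1))"
    using ints by (subst Bochner_Integration.integral_diff) (simp_all add: bump_mass m2)
  also have "\<dots> = \<delta> / 2 + ?c * (1 / real (n + 1))"
    by (simp only: algebra_simps)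
  also have "?c * (1 / real (n + 1)) = 4 / (om\<^sup>2 * \<delta> * real (n + 1))"
    by simp
  finally show ?thesis .
qed

text \<open>\<open>1 - L b\<close> has mean zero, hence a periodic primitive. Of the three powers of
  \<open>n\<close>, two come from differentiating the \<open>n\<close>-th power twice and one from
  the height \<open>2^n / rc_mass n\<close>.\<close>

lemma background_exists:
  assumes "1 \<le> n"
  obtains N a where "ts N (dcoef a) = (\<lambda>x. 1 - L * bump n x)"
    "nm (ts N (dcoef (dcoef (dcoef a)))) \<le> 4 * om\<^sup>2 * sqrt L * real n ^ 3"
proof -
  have "(\<lambda>x. 1 - L * bump n x) \<in> TP"
    by (intro TP_diff TP_const TP_cmult bump_TP)
  then obtain N0 c a0 where "\<And>N. N0 \<le> N \<Longrightarrow> (\<lambda>x. 1 - L * bump n x) = (\<lambda>x. c + ts N a0 x)"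
    using TP_rep by blast
  then have rep: "(\<lambda>x. 1 - L * bump n x) = (\<lambda>x. c + ts N0 a0 x)" by blast
  have "(\<integral>x. 1 - L * bump n x \<partial>mu) = 0"
    using TP_integrable[OF bump_TP[of n]] measure_mu by (simp add: bump_mass)
  moreover have "(\<integral>x. c + ts N0 a0 x \<partial>mu) = c * L"
    using TP_integrable[OF ts_TP[of N0 a0]] measure_mu ip_one_ts[of N0 a0] by (simp add: ip_eq)
  ultimately have "c = 0" using rep L_pos by simp
  then have rep0: "(\<lambda>x. 1 - L * bump n x) = ts N0 a0" using rep by simp
  obtain a where a: "ts N0 (dcoef a) = ts N0 a0" using ts_primitive by blast
  define r where "r = L / rc_mass n"
  have r: "0 < r" using L_pos rc_mass_pos[of n] by (simp add: r_def)
  have d1: "ts N0 (dcoef a) x = 1 - r * raised_cos x ^ n" for x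
    using a rep0 by (simp add: fun_eq_iff bump_def r_def)
  have d2: "ts N0 (dcoef (dcoef a)) x = r * om * (real n * raised_cos x ^ (n - 1) * sin (om * x))" for x
  proof (rule DERIV_unique[OF ts_deriv])
    show "(ts N0 (dcoef a) has_real_derivative r * om * (real n * raised_cos x ^ (n - 1) * sin (om * x))) (at x)"
      unfolding d1[abs_def] by (auto intro!: derivative_eq_intros raised_cos_deriv)
  qed
  let ?d3 = "\<lambda>x. r * om * (real n * (real (n - 1) * raised_cos x ^ (n - 1 - 1) * (- om * sin (om * x)) * sin (om * x)
      + raised_cos x ^ (n - 1) * (om * cos (om * x))))"
  have d3: "ts N0 (dcoef (dcoef (dcoef a))) x = ?d3 x" for x
  proof (rule DERIV_unique[OF ts_deriv])
    show "(ts N0 (dcoef (dcoef a)) has_real_derivative ?d3 x) (at x)"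
      unfolding d2[abs_def] by (auto intro!: derivative_eq_intros raised_cos_deriv simp: algebra_simps)
  qed
  have pow: "raised_cos x ^ k \<le> 2 ^ n" if "k \<le> n" for k x
    using power_mono[OF raised_cos_bounds(2,1), of x k] power_increasing[OF that, of "2::real"] by linarith
  have bd: "\<bar>ts N0 (dcoef (dcoef (dcoef a))) x\<bar> \<le> 4 * om\<^sup>2 * real n ^ 3" for x
  proof -
    \<comment> \<open>The truncated exponent at \<open>n = 1\<close> is harmless, since the factor
      \<open>real (n - 1)\<close> is then 0.\<close>
    let ?A = "real (n - 1) * raised_cos x ^ (n - 1 - 1) * (- om * sin (om * x)) * sin (om * x)"
    let ?B = "raised_cos x ^ (n - 1) * (om * cos (om * x))"
    have "\<bar>?A\<bar> \<le> real n * 2 ^ n * (om * 1) * 1"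
      unfolding abs_mult using om_pos raised_cos_bounds(1)[of x] pow[of "n - 1 - 1" x]
      by (intro mult_mono) auto
    moreover have "\<bar>?B\<bar> \<le> 2 ^ n * (om * 1)"
      unfolding abs_mult using om_pos raised_cos_bounds(1)[of x] pow[of "n - 1" x]
      by (intro mult_mono) auto
    moreover have "2 ^ n * (om * 1) \<le> real n * 2 ^ n * (om * 1) * 1"
      using assms om_pos mult_right_mono[of 1 "real n" "2 ^ n * om"] by simp
    ultimately have "\<bar>?A + ?B\<bar> \<le> 2 * (real n * 2 ^ n * (om * 1) * 1)"
      using abs_triangle_ineq[of ?A ?B] by linarith
    then have "\<bar>?A + ?B\<bar> \<le> 2 * (real n * 2 ^ n * om)" by simp
    then have "\<bar>r * om * (real n * (?A + ?B))\<bar> \<le> r * om * (real n * (2 * (real n * 2 ^ n * om)))"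
      using r om_pos by (simp add: abs_mult mult_left_mono)
    also have "\<dots> = 2 * om\<^sup>2 * (real n)\<^sup>2 * (L * (2 ^ n / rc_mass n))"
      by (simp add: r_def power2_eq_square)
    also have "\<dots> \<le> 2 * om\<^sup>2 * (real n)\<^sup>2 * (L * (real (n + 1) / L))"
      using L_pos by (intro mult_left_mono two_pow_div_rc_mass) auto
    also have "\<dots> \<le> 2 * om\<^sup>2 * (real n)\<^sup>2 * (2 * real n)"
      using assms L_pos by (intro mult_left_mono) auto
    finally show ?thesis unfolding d3 by (simp add: power2_eq_square power3_eq_cube)
  qed
  have "nm (ts N0 (dcoef (dcoef (dcoef a)))) \<le> (4 * om\<^sup>2 * real n ^ 3) * sqrt L"
    using bd by (intro nm_bounded) (auto simp: TP_meas ts_TP)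
  then show ?thesis
    using that[of N0 a] a rep0 by (simp add: mult_ac)
qed

end

section \<open>Growth of the maximal pairing with a translated profile\<close>

context weak_sol
begin

context
  fixes N :: nat and a :: "int \<Rightarrow> real" and b :: "real \<Rightarrow> real" and m :: real
  assumes b: "b \<in> TP" "\<And>x. 0 \<le> b x" "(\<integral>x. b x \<partial>mu) = 1" "(\<integral>x. \<bar>x\<bar> * b x \<partial>mu) \<le> m"
    and ab: "ts N (dcoef a) = (\<lambda>x. 1 - L * b x)"
begin

text \<open>The cost of all terms that are at most linear in \<open>u\<close>, invariant under
  translation of the profile.\<close>

definition Wc :: real where
  "Wc = \<nu> * nm (ts N (dcoef (dcoef a))) + \<bar>\<beta>\<bar> * nm (ts N a)
    + \<bar>\<gamma>\<bar> * nm (ts N (dcoef (dcoef (dcoef a)))) + C * V_norm L (ts N a)"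

text \<open>A maximiser chosen separately at each time; it may jump, so the growth of
  \<open>Mx\<close> is expressed by increments rather than by a derivative.\<close>

definition opt :: "real \<Rightarrow> real" where
  "opt t = (SOME s. \<forall>s'. ip (u t) (ts N (sh s' a)) \<le> ip (u t) (ts N (sh s a)))"

definition Mx :: "real \<Rightarrow> real" where "Mx t = ip (u t) (ts N (sh (opt t) a))"

text \<open>The growth rate guaranteed for \<open>Mx\<close> at a critical translate.\<close>

definition low :: "real \<Rightarrow> real" where
  "low t = 1/2 * (nm (u t))\<^sup>2 - 1/2 * L * m * D t - Wc * (1 + nm (u t))"

lemma Wc_nonneg: "0 \<le> Wc"
  using nu_pos C_nonneg by (simp add: Wc_def V_norm_def)

lemma bs_TP: "(\<lambda>x. b (x - s)) \<in> TP"
  using TP_shift[OF b(1), of "- s"] by simp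

lemma dcoef_sh_eq: "ts N (dcoef (sh s a)) = (\<lambda>x. 1 - L * b (x - s))"
  by (rule ext) (simp add: dcoef_sh ts_sh ab)

lemma opt_max: "0 \<le> t \<Longrightarrow> ip (u t) (ts N (sh s a)) \<le> Mx t"
proof -
  assume "0 \<le> t"
  then obtain s0 where "\<And>s'. ip (u t) (ts N (sh s' a)) \<le> ip (u t) (ts N (sh s0 a))"
    using ip_sh_max[OF u_sq_int] by blast
  then have "\<exists>s. \<forall>s'. ip (u t) (ts N (sh s' a)) \<le> ip (u t) (ts N (sh s a))" by blast
  from someI_ex[OF this] show ?thesis
    by (simp add: Mx_def opt_def)
qed

text \<open>The derivative in \<open>s\<close> vanishes at a maximum. It is the pairing of
  \<open>u\<close> with \<open>1 - L b\<close>, up to sign and translation, and \<open>u\<close> has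
  mean zero.\<close>

lemma opt_critical:
  assumes "0 \<le> t"
  shows "ip (u t) (\<lambda>x. b (x - opt t)) = 0"
proof -
  have "- ip (u t) (ts N (dcoef (sh (opt t) a))) = 0"
  proof (rule DERIV_local_max[where d = 1])
    show "((\<lambda>s. ip (u t) (ts N (sh s a))) has_real_derivative - ip (u t) (ts N (dcoef (sh (opt t) a)))) (at (opt t))"
      by (rule ip_sh_deriv[OF u_sq_int[OF assms]])
  qed (use opt_max[OF assms] in \<open>auto simp: Mx_def\<close>)
  then have "ip (u t) (\<lambda>x. 1 - L * b (x - opt t)) = 0"
    by (simp add: dcoef_sh_eq)
  then show ?thesis
    using L_pos u_mean[OF assms] TP_sq_int[OF bs_TP] u_sq_int[OF assms]
    by (simp add: ip_diff_right)
qed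

text \<open>The test function has derivative \<open>1 - L b\<close>, so the nonlinear term is half
  of \<open>|u|^2 - L (u^2, b)\<close>. The translate is not assumed critical at time
  \<open>t\<close>: the hypothesis \<open>small\<close> bounds the remaining mean under
  \<open>b\<close>, and the 1 in the conclusion pays for it.\<close>

lemma G_lower:
  assumes t: "0 \<le> t" "t \<notin> Z"
    and small: "L / 2 * (ip (u t) (\<lambda>x. b (x - s)))\<^sup>2 \<le> 1"
  shows "low t - 1 \<le> G N (sh s a) t"
proof -
  have V: "u t \<in> space_V L" by (rule u_V[OF t])
  note sq = u_sq_int[OF t(1)]
  let ?n = "nm (u t)" and ?bs = "\<lambda>x. b (x - s)"
  have "ip (\<lambda>x. (u t x)\<^sup>2) (ts N (dcoef (sh s a))) = ?n\<^sup>2 - L * ip (\<lambda>x. (u t x)\<^sup>2) ?bs"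
  proof -
    have "ip (\<lambda>x. (u t x)\<^sup>2) (\<lambda>x. 1 - L * b (x - s)) = (\<integral>x. (u t x)\<^sup>2 - L * ((u t x)\<^sup>2 * b (x - s)) \<partial>mu)"
      unfolding ip_eq by (intro Bochner_Integration.integral_cong) (auto simp: algebra_simps)
    also have "\<dots> = ?n\<^sup>2 - L * ip (\<lambda>x. (u t x)\<^sup>2) ?bs"
      using sq sq_TP_integrable[OF sq bs_TP[of s]] by (simp add: nm_sq_integral ip_eq sq_int_def)
    finally show ?thesis by (simp add: dcoef_sh_eq)
  qed
  moreover have "ip (\<lambda>x. (u t x)\<^sup>2) ?bs \<le> (ip (u t) ?bs)\<^sup>2 + m * D t"
    by (rule variance_bound[OF V weak_deriv_dx[OF V] b])
  then have "L / 2 * ip (\<lambda>x. (u t x)\<^sup>2) ?bs \<le> L / 2 * (ip (u t) ?bs)\<^sup>2 + L / 2 * (m * D t)"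
    using L_pos by (simp flip: distrib_left)
  ultimately have quad: "1/2 * ?n\<^sup>2 - 1/2 * L * m * D t - 1 \<le> 1/2 * ip (\<lambda>x. (u t x)\<^sup>2) (ts N (dcoef (sh s a)))"
    using small by (simp add: algebra_simps)
  have ipb: "\<bar>ip (u t) (ts N (sh s c))\<bar> \<le> ?n * nm (ts N c)" for c
    using cauchy_schwarz[OF sq ts_sq_int[of N "sh s c"]] by (simp add: nm_sh)
  have "\<bar>\<nu> * ip (u t) (ts N (sh s (dcoef (dcoef a))))\<bar> \<le> \<nu> * (?n * nm (ts N (dcoef (dcoef a))))"
    unfolding abs_mult using nu_pos by (simp add: ipb)
  moreover have "\<bar>\<beta> * ip (u t) (ts N (sh s a))\<bar> \<le> \<bar>\<beta>\<bar> * (?n * nm (ts N a))"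
    unfolding abs_mult by (intro mult_left_mono ipb) simp
  moreover have "\<bar>\<gamma> * ip (u t) (ts N (sh s (dcoef (dcoef (dcoef a)))))\<bar> \<le> \<bar>\<gamma>\<bar> * (?n * nm (ts N (dcoef (dcoef (dcoef a)))))"
    unfolding abs_mult by (intro mult_left_mono ipb) simp
  moreover have "\<bar>f (ts N (sh s a))\<bar> \<le> C * V_norm L (ts N a)"
    using f_bound[OF ts_space_V[of N "sh s a"]] by (simp add: V_norm_ts dcoef_sh nm_sh)
  ultimately have "- (\<nu> * (?n * nm (ts N (dcoef (dcoef a)))) + \<bar>\<beta>\<bar> * (?n * nm (ts N a))
      + \<bar>\<gamma>\<bar> * (?n * nm (ts N (dcoef (dcoef (dcoef a))))) + C * V_norm L (ts N a))
      \<le> G N (sh s a) t - 1/2 * ip (\<lambda>x. (u t x)\<^sup>2) (ts N (dcoef (sh s a)))"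
    unfolding G_def dcoef_sh by linarith
  moreover have "\<nu> * (?n * nm (ts N (dcoef (dcoef a)))) + \<bar>\<beta>\<bar> * (?n * nm (ts N a))
      + \<bar>\<gamma>\<bar> * (?n * nm (ts N (dcoef (dcoef (dcoef a))))) + C * V_norm L (ts N a) \<le> Wc * (1 + ?n)"
  proof -
    have "0 \<le> \<nu> * nm (ts N (dcoef (dcoef a))) + \<bar>\<beta>\<bar> * nm (ts N a)
        + \<bar>\<gamma>\<bar> * nm (ts N (dcoef (dcoef (dcoef a))))" "0 \<le> C * V_norm L (ts N a) * ?n"
      using nu_pos C_nonneg by (auto simp: V_norm_def)
    then show ?thesis by (simp add: Wc_def algebra_simps)
  qed
  ultimately show ?thesis using quad unfolding low_def by linarith
qed

lemma low_integrable:
  assumes "0 \<le> t1"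
  shows "low integrable_on {t1..t2}"
  unfolding low_def[abs_def]
  using assms by (intro integrable_diff integrable_on_mult_right integrable_add D_integrable nm_u_sq_integrable) auto

text \<open>The translate is frozen at the maximiser of \<open>t1\<close>. Its pairing equals
  \<open>Mx\<close> at \<open>t1\<close> and is at most \<open>Mx\<close> at \<open>t2\<close>; in
  between, the mean under \<open>b\<close> is small because \<open>u\<close> has moved
  little.\<close>

lemma Mx_step:
  assumes t: "0 \<le> t1" "t1 \<le> t2"
    and small: "\<And>t. t \<in> {t1..t2} \<Longrightarrow> L / 2 * (nm (\<lambda>x. u t x - u t1 x) * nm b)\<^sup>2 \<le> 1"
  shows "integral {t1..t2} (\<lambda>t. low t - 1) \<le> Mx t2 - Mx t1"
proof -
  let ?s = "opt t1"
  have nmb: "nm (\<lambda>x. b (x - ?s)) = nm b"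
  proof -
    have "(\<integral>x. (b (x + - ?s))\<^sup>2 \<partial>mu) = (\<integral>x. (b x)\<^sup>2 \<partial>mu)"
      by (rule TP_integral_mu_shift) (intro TP_power b)
    then have "(nm (\<lambda>x. b (x - ?s)))\<^sup>2 = (nm b)\<^sup>2" by (simp add: nm_sq_integral)
    then show ?thesis by simp
  qed
  have "integral {t1..t2} (\<lambda>t. low t - 1) \<le> integral {t1..t2} (G N (sh ?s a))"
  proof (rule integral_mono_except_negligible[OF negligible_Z])
    show "(\<lambda>t. low t - 1) integrable_on {t1..t2}"
      using t by (intro integrable_diff low_integrable) auto
    show "G N (sh ?s a) integrable_on {t1..t2}"
      using t by (intro integrable_continuous_real G_cont_Icc)
    fix \<tau> assume \<tau>: "\<tau> \<in> {t1..t2} - Z"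
    then have \<tau>0: "0 \<le> \<tau>" using t by auto
    have "ip (u \<tau>) (\<lambda>x. b (x - ?s)) = ip (\<lambda>x. u \<tau> x - u t1 x) (\<lambda>x. b (x - ?s))"
      using t \<tau>0 opt_critical[OF t(1)] by (simp add: ip_diff_left u_sq_int TP_sq_int[OF bs_TP])
    then have "\<bar>ip (u \<tau>) (\<lambda>x. b (x - ?s))\<bar> \<le> nm (\<lambda>x. u \<tau> x - u t1 x) * nm b"
      using cauchy_schwarz[of "\<lambda>x. u \<tau> x - u t1 x" "\<lambda>x. b (x - ?s)"] t \<tau>0 nmb
      by (simp add: u_sq_int TP_sq_int[OF bs_TP])
    then have "\<bar>ip (u \<tau>) (\<lambda>x. b (x - ?s))\<bar>\<^sup>2 \<le> (nm (\<lambda>x. u \<tau> x - u t1 x) * nm b)\<^sup>2"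
      by (intro power_mono) auto
    then have "L / 2 * (ip (u \<tau>) (\<lambda>x. b (x - ?s)))\<^sup>2 \<le> L / 2 * (nm (\<lambda>x. u \<tau> x - u t1 x) * nm b)\<^sup>2"
      using L_pos by (intro mult_left_mono) auto
    also have "\<dots> \<le> 1" using small[of \<tau>] \<tau> by simp
    finally have "L / 2 * (ip (u \<tau>) (\<lambda>x. b (x - ?s)))\<^sup>2 \<le> 1" .
    then show "low \<tau> - 1 \<le> G N (sh ?s a) \<tau>"
      using \<tau> \<tau>0 by (intro G_lower) auto
  qed
  also have "\<dots> = ip (u t2) (ts N (sh ?s a)) - Mx t1"
    using weak_form[OF t] by (simp add: Mx_def)
  also have "\<dots> \<le> Mx t2 - Mx t1"
    using opt_max[of t2 ?s] t by simp
  finally show ?thesis .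
qed

text \<open>Continuity of \<open>u\<close> in \<open>H\<close> makes the step valid on short
  intervals, and the inequality adds up over adjacent ones, so bisection extends it. The slack 1 is
  a rate and does not accumulate with the number of pieces.\<close>

lemma Mx_growth:
  assumes t: "0 \<le> t1" "t1 \<le> t2"
  shows "integral {t1..t2} (\<lambda>t. low t - 1) \<le> Mx t2 - Mx t1"
proof -
  have int: "(\<lambda>t. low t - 1) integrable_on {x..y}" if "0 \<le> x" for x y
    using that by (intro integrable_diff low_integrable) auto
  have "t1 \<le> t1 \<and> t2 \<le> t2 \<longrightarrow> integral {t1..t2} (\<lambda>t. low t - 1) \<le> Mx t2 - Mx t1"
    using t(2)
  proof (induction rule: Bolzano[where P = "\<lambda>p q. t1 \<le> p \<and> q \<le> t2 \<longrightarrow> integral {p..q} (\<lambda>t. low t - 1) \<le> Mx q - Mx p"])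
    case (trans p q r)
    show ?case
    proof
      assume "t1 \<le> p \<and> r \<le> t2"
      then show "integral {p..r} (\<lambda>t. low t - 1) \<le> Mx r - Mx p"
        using trans Henstock_Kurzweil_Integration.integral_combine[of p q r "\<lambda>t. low t - 1"] int[of p r] t by auto
    qed
  next
    case (local x)
    \<comment> \<open>Chosen so that \<open>L/2 (\<delta> (nm b + 1))^2 = L / (2 (L+1)^2)\<close>,
      which is below 1; adding 1 to \<open>nm b\<close> keeps the denominator positive.\<close>
    define \<delta> where "\<delta> = 1 / ((nm b + 1) * (L + 1))"
    have \<delta>: "0 < \<delta>" using L_pos nm_nonneg[of b] by (simp add: \<delta>_def add_nonneg_pos)
    have x0: "0 \<le> x" using local t by simp
    have "\<forall>\<^sub>F s in at x within {0..}. nm (\<lambda>y. u x y - u s y) < \<delta> / 2"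
      by (rule order_tendstoD(2)[OF u_cont[OF x0]]) (use \<delta> in simp)
    then obtain d where d: "0 < d" "\<And>s. s \<in> {0..} \<Longrightarrow> s \<noteq> x \<Longrightarrow> dist s x < d \<Longrightarrow> nm (\<lambda>y. u x y - u s y) < \<delta> / 2"
      unfolding eventually_at by blast
    have near: "nm (\<lambda>y. u x y - u s y) < \<delta> / 2" if "0 \<le> s" "\<bar>s - x\<bar> < d" for s
    proof (cases "s = x")
      case True
      then show ?thesis using \<delta> by (simp add: L2_norm_def ip_eq)
    qed (use d(2)[of s] that in \<open>simp add: dist_real_def\<close>)
    have "integral {p..q} (\<lambda>t. low t - 1) \<le> Mx q - Mx p"
      if pq: "p \<le> x" "x \<le> q" "q - p < d" "t1 \<le> p" "q \<le> t2" for p q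
    proof (rule Mx_step)
      show "0 \<le> p" "p \<le> q" using pq t by auto
      fix \<tau> assume \<tau>: "\<tau> \<in> {p..q}"
      then have \<tau>0: "0 \<le> \<tau>" "0 \<le> p" using pq t by auto
      have "nm (\<lambda>y. u \<tau> y - u p y) \<le> nm (\<lambda>y. u \<tau> y - u x y) + nm (\<lambda>y. u x y - u p y)"
        using \<tau>0 x0 by (intro nm_triangle_diff u_sq_int)
      also have "\<dots> \<le> \<delta>"
      proof -
        have "\<bar>\<tau> - x\<bar> < d" "\<bar>p - x\<bar> < d" using \<tau> pq by auto
        then show ?thesis
          using near[of \<tau>] near[of p] \<tau>0 nm_minus_commute[of "u \<tau>" "u x"] by linarith
      qed
      finally have "nm (\<lambda>y. u \<tau> y - u p y) * nm b \<le> \<delta> * (nm b + 1)"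
        by (intro mult_mono) (use \<delta> in auto)
      also have "\<dots> = 1 / (L + 1)"
      proof -
        have "0 < nm b + 1" using nm_nonneg[of b] by linarith
        then show ?thesis by (simp add: \<delta>_def)
      qed
      finally have "(nm (\<lambda>y. u \<tau> y - u p y) * nm b)\<^sup>2 \<le> (1 / (L + 1))\<^sup>2"
        by (intro power_mono) auto
      then have "L / 2 * (nm (\<lambda>y. u \<tau> y - u p y) * nm b)\<^sup>2 \<le> L / 2 * (1 / (L + 1))\<^sup>2"
        using L_pos by (intro mult_left_mono) auto
      also have "\<dots> \<le> 1"
      proof -
        have "L \<le> 2 * (L + 1)\<^sup>2" using L_pos by (simp add: power2_eq_square algebra_simps)
        then show ?thesis using L_pos by (simp add: power_divide)
      qed
      finally show "L / 2 * (nm (\<lambda>y. u \<tau> y - u p y) * nm b)\<^sup>2 \<le> 1" .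
    qed
    then show ?case using d(1) by blast
  qed
  then show ?thesis by simp
qed

lemma Mx_bound: "0 \<le> t \<Longrightarrow> \<bar>Mx t\<bar> \<le> nm (u t) * nm (ts N a)"
  unfolding Mx_def using cauchy_schwarz[OF u_sq_int ts_sq_int[of N "sh (opt t) a"]] by (simp add: nm_sh)

end

end

section \<open>Coming down from infinity\<close>

context torus
begin

text \<open>
  The numerical constants are those needed to close the contradiction in \<open>decay\<close> below, with
  \<open>\<tau> = c / 2\<^sup>j\<close>; the scale \<open>128\<^sup>j\<close> absorbs \<open>|\<phi>\<^sub>x\<^sub>x\<^sub>x| = O(64\<^sup>j)\<close> together with \<open>1 / \<tau>\<close>.
\<close>

definition adapted_profiles :: "real \<Rightarrow> real \<Rightarrow> real \<Rightarrow> real \<Rightarrow> real \<Rightarrow> real \<Rightarrow> bool" where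
  "adapted_profiles \<nu> \<beta> \<gamma> C c \<rho> \<longleftrightarrow> (\<forall>j::nat. \<exists>N a b m.
     b \<in> TP \<and> (\<forall>x. 0 \<le> b x) \<and> (\<integral>x. b x \<partial>mu) = 1 \<and> (\<integral>x. \<bar>x\<bar> * b x \<partial>mu) \<le> m \<and>
     ts N (dcoef a) = (\<lambda>x. 1 - L * b x) \<and> 20000 * L * m / \<nu> \<le> c / 2 ^ j / 8 \<and>
     (\<forall>A\<ge>\<rho> * 128 ^ j. 400 * nm (ts N a) \<le> c / 2 ^ j * A / 8 \<and>
        201 * (\<nu> * nm (ts N (dcoef (dcoef a))) + \<bar>\<beta>\<bar> * nm (ts N a)
          + \<bar>\<gamma>\<bar> * nm (ts N (dcoef (dcoef (dcoef a)))) + C * V_norm L (ts N a)) + 1 \<le> A / 8))"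

lemma adapted_profiles_exist:
  assumes "0 < \<nu>" "0 \<le> C"
  obtains c \<rho> where "0 < c" "0 < \<rho>" "adapted_profiles \<nu> \<beta> \<gamma> C c \<rho>"
proof -
  \<comment> \<open>\<open>m0 / 2^j\<close> will be the moment bound, and \<open>c\<close> turns the
    moment condition into an equality. \<open>q\<close> comes from the third derivative of the
    profile, and \<open>w0\<close> collects powers of the Poincare constant \<open>L\<close>. The
    two summands of \<rho> serve the two conditions on \<open>A\<close>, with
    \<open>3200 = 8 * 400\<close>.\<close>
  define m0 where "m0 = 1/2 + 4 / om\<^sup>2"
  define c where "c = 160000 * L * m0 / \<nu>"
  define q where "q = 4 * om\<^sup>2 * sqrt L"
  define w0 where "w0 = \<nu> * L + \<bar>\<beta>\<bar> * L ^ 3 + \<bar>\<gamma>\<bar> + C * (L ^ 3 + L\<^sup>2)"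
  define \<rho> where "\<rho> = 3200 * L ^ 3 * q / c + 8 * (201 * w0 * q + 1)"
  have m0: "0 < m0" unfolding m0_def using om_pos by (simp add: add_pos_pos)
  have c: "0 < c" unfolding c_def using m0 L_pos assms by simp
  have q: "0 < q" unfolding q_def using om_pos L_pos by simp
  have w0: "0 \<le> w0" unfolding w0_def using assms L_pos by simp
  have \<rho>: "0 < \<rho>" unfolding \<rho>_def using c q w0 L_pos by (intro add_nonneg_pos) (auto simp: add_nonneg_pos)
  have "adapted_profiles \<nu> \<beta> \<gamma> C c \<rho>"
    unfolding adapted_profiles_def
  proof
    fix j :: nat
    \<comment> \<open>The moment decays like \<open>1 / sqrt n\<close>, so a moment of order
      \<open>2^-j\<close> requires \<open>n = 4^j\<close>.\<close>
    define n :: nat where "n = 4 ^ j"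
    have "1 \<le> n" by (simp add: n_def)
    then obtain N a where a: "ts N (dcoef a) = (\<lambda>x. 1 - L * bump n x)"
      and a3: "nm (ts N (dcoef (dcoef (dcoef a)))) \<le> 4 * om\<^sup>2 * sqrt L * real n ^ 3"
      by (rule background_exists)
    let ?X = "nm (ts N (dcoef (dcoef (dcoef a))))"
    have "real n ^ 3 = 64 ^ j"
      by (simp add: n_def power_mult[symmetric] mult.commute[of j] power_mult)
    then have X: "?X \<le> q * 64 ^ j" using a3 by (simp add: q_def)
    have n2: "nm (ts N (dcoef (dcoef a))) \<le> L * ?X" by (rule nm_ts_le)
    have "nm (ts N (dcoef a)) \<le> L * nm (ts N (dcoef (dcoef a)))" by (rule nm_ts_le)
    also have "\<dots> \<le> L * (L * ?X)" using n2 L_pos by (intro mult_left_mono) auto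
    finally have n1: "nm (ts N (dcoef a)) \<le> L\<^sup>2 * ?X" by (simp add: power2_eq_square)
    have "nm (ts N a) \<le> L * nm (ts N (dcoef a))" by (rule nm_ts_le)
    also have "\<dots> \<le> L * (L\<^sup>2 * ?X)" using n1 L_pos by (intro mult_left_mono) auto
    finally have n0: "nm (ts N a) \<le> L ^ 3 * ?X" by (simp add: power2_eq_square power3_eq_cube)
    have V: "V_norm L (ts N a) \<le> (L ^ 3 + L\<^sup>2) * ?X"
      unfolding V_norm_ts distrib_right
      using n0 n1 by (intro order_trans[OF sqrt_sum_squares_le_sum]) auto
    let ?W = "\<nu> * nm (ts N (dcoef (dcoef a))) + \<bar>\<beta>\<bar> * nm (ts N a) + \<bar>\<gamma>\<bar> * ?X + C * V_norm L (ts N a)"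
    have "?W \<le> \<nu> * (L * ?X) + \<bar>\<beta>\<bar> * (L ^ 3 * ?X) + \<bar>\<gamma>\<bar> * ?X + C * ((L ^ 3 + L\<^sup>2) * ?X)"
      using assms n0 n2 V by (intro add_mono mult_left_mono) auto
    also have "\<dots> = w0 * ?X" by (simp add: w0_def algebra_simps)
    also have "\<dots> \<le> w0 * (q * 64 ^ j)" by (intro mult_left_mono X w0)
    finally have W: "?W \<le> w0 * q * 64 ^ j" by simp
    have moment: "(\<integral>x. \<bar>x\<bar> * bump n x \<partial>mu) \<le> m0 / 2 ^ j"
    proof -
      have "(\<integral>x. \<bar>x\<bar> * bump n x \<partial>mu) \<le> (1 / 2 ^ j) / 2 + 4 / (om\<^sup>2 * (1 / 2 ^ j) * real (n + 1))"
        by (rule bump_moment) simp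
      also have "4 / (om\<^sup>2 * (1 / 2 ^ j) * real (n + 1)) \<le> 4 / (om\<^sup>2 * 2 ^ j)"
      proof (rule divide_left_mono)
        have "om\<^sup>2 * 2 ^ j = om\<^sup>2 * (1 / 2 ^ j) * real n"
        proof -
          have "real n = 2 ^ j * 2 ^ j" by (simp add: n_def power_mult_distrib[symmetric])
          then show ?thesis by simp
        qed
        also have "\<dots> \<le> om\<^sup>2 * (1 / 2 ^ j) * real (n + 1)"
          by (intro mult_left_mono) auto
        finally show "om\<^sup>2 * 2 ^ j \<le> om\<^sup>2 * (1 / 2 ^ j) * real (n + 1)" .
      qed (use om_pos in auto)
      finally show ?thesis by (simp add: m0_def add_divide_distrib)
    qed
    have final: "400 * nm (ts N a) \<le> c / 2 ^ j * A / 8 \<and> 201 * ?W + 1 \<le> A / 8" if A: "\<rho> * 128 ^ j \<le> A" for A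
    proof
      have p128: "(128::real) ^ j = 2 ^ j * 64 ^ j" by (simp add: power_mult_distrib[symmetric])
      have \<rho>1: "3200 * L ^ 3 * q / c \<le> \<rho>" unfolding \<rho>_def using w0 q by simp
      have \<rho>2: "8 * (201 * w0 * q + 1) \<le> \<rho>" unfolding \<rho>_def using c q L_pos by simp
      have "400 * nm (ts N a) \<le> 400 * (L ^ 3 * (q * 64 ^ j))"
        using n0 X L_pos by (meson mult_left_mono order_trans zero_le_numeral zero_le_power less_imp_le)
      also have "\<dots> = c / 2 ^ j * ((3200 * L ^ 3 * q / c) * 128 ^ j) / 8"
        using c by (simp add: p128)
      also have "\<dots> \<le> c / 2 ^ j * (\<rho> * 128 ^ j) / 8"
        using c \<rho>1 by (intro divide_right_mono mult_left_mono mult_right_mono) auto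
      also have "\<dots> \<le> c / 2 ^ j * A / 8"
        using c A by (intro divide_right_mono mult_left_mono) auto
      finally show "400 * nm (ts N a) \<le> c / 2 ^ j * A / 8" .
      have "201 * ?W + 1 \<le> 201 * w0 * q * 64 ^ j + 1" using W by simp
      also have "\<dots> \<le> 201 * w0 * q * 128 ^ j + 128 ^ j"
        using w0 q by (intro add_mono mult_left_mono power_mono) auto
      also have "\<dots> = (8 * (201 * w0 * q + 1)) * 128 ^ j / 8"
        by (simp add: algebra_simps)
      also have "\<dots> \<le> \<rho> * 128 ^ j / 8"
        using \<rho>2 by (intro divide_right_mono mult_right_mono) auto
      also have "\<dots> \<le> A / 8" using A by simp
      finally show "201 * ?W + 1 \<le> A / 8" .
    qed
    have "20000 * L * (m0 / 2 ^ j) / \<nu> \<le> c / 2 ^ j / 8"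
      by (simp add: c_def mult_ac)
    then show "\<exists>N a b m.
     b \<in> TP \<and> (\<forall>x. 0 \<le> b x) \<and> (\<integral>x. b x \<partial>mu) = 1 \<and> (\<integral>x. \<bar>x\<bar> * b x \<partial>mu) \<le> m \<and>
     ts N (dcoef a) = (\<lambda>x. 1 - L * b x) \<and> 20000 * L * m / \<nu> \<le> c / 2 ^ j / 8 \<and>
     (\<forall>A\<ge>\<rho> * 128 ^ j. 400 * nm (ts N a) \<le> c / 2 ^ j * A / 8 \<and>
        201 * (\<nu> * nm (ts N (dcoef (dcoef a))) + \<bar>\<beta>\<bar> * nm (ts N a)
          + \<bar>\<gamma>\<bar> * nm (ts N (dcoef (dcoef (dcoef a)))) + C * V_norm L (ts N a)) + 1 \<le> A / 8)"
      using bump_TP bump_nonneg bump_mass moment a final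
      by (intro exI[of _ N] exI[of _ a] exI[of _ "bump n"] exI[of _ "m0 / 2 ^ j"] conjI allI impI) auto
  qed
  with c \<rho> that show ?thesis by blast
qed

end

section \<open>Descent through the scales in a time independent of the initial size\<close>

context weak_sol
begin

text \<open>Over a time \<open>h\<close> the growth term contributes at most half of the maximal
  energy, as \<open>\<kappa> h = 1/2\<close>; \<open>d0\<close> below is the contribution of the
  forcing.\<close>

definition h :: real where "h = 1 / (2 * \<kappa>)"

definition d0 :: real where "d0 = C\<^sup>2 / \<nu> * h"

lemma kappa_pos: "0 < \<kappa>"
  using nu_pos by (simp add: \<kappa>_def add_nonneg_pos)

lemma h_pos: "0 < h"
  using kappa_pos by (simp add: h_def)

lemma D_integral_nonneg: "0 \<le> t1 \<Longrightarrow> 0 \<le> integral {t1..t2} D"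
  by (intro Henstock_Kurzweil_Integration.integral_nonneg D_integrable) auto

text \<open>In place of Gronwall, the energy inequality is read at the time where
  \<open>|u|^2\<close> is largest on the interval, and half of that maximum is absorbed on the
  left.\<close>

lemma short_time_bounds:
  assumes t: "0 \<le> t1" "t1 \<le> t2" "t2 - t1 \<le> h"
  shows "\<And>t. t \<in> {t1..t2} \<Longrightarrow> (nm (u t))\<^sup>2 \<le> 2 * ((nm (u t1))\<^sup>2 + d0)"
    and "\<nu> * integral {t1..t2} D \<le> 2 * ((nm (u t1))\<^sup>2 + d0)"
proof -
  let ?y = "\<lambda>t. (nm (u t))\<^sup>2"
  have "continuous_on {t1..t2} ?y"
    by (intro continuous_intros continuous_on_subset[OF nm_u_cont]) (use t in auto)
  then obtain s where s: "s \<in> {t1..t2}" "\<forall>t\<in>{t1..t2}. ?y t \<le> ?y s"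
    using continuous_attains_sup[of "{t1..t2}" ?y] t by auto
  have main: "integral {t1..r} (\<lambda>t. \<kappa> * ?y t + C\<^sup>2 / \<nu>) \<le> ?y s / 2 + d0" if r: "r \<in> {t1..t2}" for r
  proof -
    have e: "0 \<le> \<kappa> * ?y s + C\<^sup>2 / \<nu>" using kappa_pos nu_pos by simp
    have "integral {t1..r} (\<lambda>t. \<kappa> * ?y t + C\<^sup>2 / \<nu>) \<le> integral {t1..r} (\<lambda>t. \<kappa> * ?y s + C\<^sup>2 / \<nu>)"
      using s r t kappa_pos
      by (intro integral_le integrable_add integrable_on_mult_right nm_u_sq_integrable) auto
    also have "\<dots> = (r - t1) * (\<kappa> * ?y s + C\<^sup>2 / \<nu>)" using r by simp
    also have "\<dots> \<le> h * (\<kappa> * ?y s + C\<^sup>2 / \<nu>)" using r t e by (intro mult_right_mono) auto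
    also have "\<dots> = ?y s / 2 + d0" using kappa_pos by (simp add: h_def d0_def field_simps)
    finally show ?thesis .
  qed
  have "?y s + \<nu> * integral {t1..s} D \<le> ?y t1 + (?y s / 2 + d0)"
    using energy[of t1 s] main[of s] s t by auto
  moreover have "0 \<le> \<nu> * integral {t1..s} D" using nu_pos t by (simp add: D_integral_nonneg)
  ultimately have S: "?y s \<le> 2 * (?y t1 + d0)" by simp
  show "?y t \<le> 2 * (?y t1 + d0)" if "t \<in> {t1..t2}" for t
    using S bspec[OF s(2) that] by linarith
  have "?y t2 + \<nu> * integral {t1..t2} D \<le> ?y t1 + (?y s / 2 + d0)"
    using energy[of t1 t2] main[of t2] t by auto
  moreover have "0 \<le> ?y t2" by simp
  ultimately show "\<nu> * integral {t1..t2} D \<le> 2 * (?y t1 + d0)"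
    using S unfolding distrib_left by linarith
qed

text \<open>If \<open>|u|\<close> stayed above \<open>A\<close>, then \<open>Mx\<close> would gain
  at least \<open>\<tau> A^2 / 4\<close>, whereas its size, at most \<open>200 A |\<phi>|\<close> at
  both ends, permits a gain of \<open>\<tau> A^2 / 8\<close>.\<close>

lemma decay:
  assumes b: "b \<in> TP" "\<And>x. 0 \<le> b x" "(\<integral>x. b x \<partial>mu) = 1" "(\<integral>x. \<bar>x\<bar> * b x \<partial>mu) \<le> m"
    and ab: "ts N (dcoef a) = (\<lambda>x. 1 - L * b x)"
    and t0: "0 \<le> t0" and \<tau>: "0 < \<tau>" "\<tau> \<le> h"
    and i: "20000 * L * m / \<nu> \<le> \<tau> / 8" and ii: "400 * nm (ts N a) \<le> \<tau> * A / 8"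
    and iii: "201 * Wc N a + 1 \<le> A / 8"
    and A: "1 \<le> A" "d0 \<le> A\<^sup>2" and start: "nm (u t0) \<le> 128 * A"
  shows "\<exists>t\<in>{t0..t0 + \<tau>}. nm (u t) \<le> A"
proof (rule ccontr)
  assume "\<not> (\<exists>t\<in>{t0..t0 + \<tau>}. nm (u t) \<le> A)"
  then have big: "A \<le> nm (u t)" if "t \<in> {t0..t0 + \<tau>}" for t
    using that by force
  let ?I = "{t0..t0 + \<tau>}"
  have tt: "0 \<le> t0" "t0 \<le> t0 + \<tau>" "t0 + \<tau> - t0 \<le> h" using t0 \<tau> by auto
  have "(nm (u t0))\<^sup>2 \<le> (128 * A)\<^sup>2" using start by (intro power_mono) auto
  then have "(nm (u t0))\<^sup>2 \<le> 16384 * A\<^sup>2" by (simp add: power_mult_distrib)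
  \<comment> \<open>\<open>128^2 = 16384\<close> and
    \<open>2 * (16384 + 1) <= 40000 = 200^2\<close>.\<close>
  then have 1: "2 * ((nm (u t0))\<^sup>2 + d0) \<le> 40000 * A\<^sup>2"
    using A(2) zero_le_power2[of A] unfolding distrib_left by linarith
  have up: "nm (u t) \<le> 200 * A" if "t \<in> ?I" for t
  proof (rule power2_le_imp_le)
    show "(nm (u t))\<^sup>2 \<le> (200 * A)\<^sup>2"
      using short_time_bounds(1)[OF tt that] 1 by (simp add: power_mult_distrib)
  qed (use A in simp)
  have diss: "\<nu> * integral ?I D \<le> 40000 * A\<^sup>2"
    using short_time_bounds(2)[OF tt] 1 by simp
  have m: "0 \<le> m"
    using b(2) by (intro order_trans[OF _ b(4)] Bochner_Integration.integral_nonneg) auto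
  have W: "0 \<le> Wc N a" by (rule Wc_nonneg[OF b ab])
  \<comment> \<open>\<open>3/8 = 1/2 - 1/8\<close>: by \<open>iii\<close> and
    \<open>1 + 200 A <= 201 A\<close>, the linear terms and the slack together cost at most
    \<open>A^2 / 8\<close>.\<close>
  have "integral ?I (\<lambda>t. 3/8 * A\<^sup>2 - 1/2 * L * m * D t) \<le> integral ?I (\<lambda>t. low N a m t - 1)"
  proof (rule integral_le)
    show "(\<lambda>t. 3/8 * A\<^sup>2 - 1/2 * L * m * D t) integrable_on ?I"
      using t0 by (intro integrable_diff integrable_on_mult_right D_integrable) auto
    show "(\<lambda>t. low N a m t - 1) integrable_on ?I"
      using t0 by (intro integrable_diff low_integrable[OF b ab]) auto
    fix t assume t: "t \<in> ?I"
    have "A\<^sup>2 \<le> (nm (u t))\<^sup>2" using big[OF t] A by (intro power_mono) auto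
    moreover have "Wc N a * (1 + nm (u t)) + 1 \<le> A\<^sup>2 / 8"
    proof -
      have "Wc N a * (1 + nm (u t)) + 1 \<le> Wc N a * (201 * A) + A"
        using W A up[OF t] by (intro add_mono mult_left_mono) auto
      also have "\<dots> = (201 * Wc N a + 1) * A" by (simp add: algebra_simps)
      also have "\<dots> \<le> A / 8 * A" using iii A by (intro mult_right_mono) auto
      finally show ?thesis by (simp add: power2_eq_square)
    qed
    ultimately show "3/8 * A\<^sup>2 - 1/2 * L * m * D t \<le> low N a m t - 1"
      unfolding low_def[OF b ab] by linarith
  qed
  also have "\<dots> \<le> Mx N a (t0 + \<tau>) - Mx N a t0"
    by (rule Mx_growth[OF b ab tt(1,2)])
  also have "\<dots> \<le> 200 * A * nm (ts N a) + 200 * A * nm (ts N a)"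
  proof -
    have "\<bar>Mx N a t\<bar> \<le> 200 * A * nm (ts N a)" if "t \<in> ?I" for t
    proof -
      have "\<bar>Mx N a t\<bar> \<le> nm (u t) * nm (ts N a)"
        using that t0 by (intro Mx_bound[OF b ab]) auto
      also have "\<dots> \<le> 200 * A * nm (ts N a)"
        using up[OF that] by (intro mult_right_mono) auto
      finally show ?thesis .
    qed
    from this[of t0] this[of "t0 + \<tau>"] show ?thesis using \<tau> by simp
  qed
  also have "\<dots> = A * (400 * nm (ts N a))" by simp
  also have "\<dots> \<le> A * (\<tau> * A / 8)" using ii A by (intro mult_left_mono) auto
  finally have upper: "integral ?I (\<lambda>t. 3/8 * A\<^sup>2 - 1/2 * L * m * D t) \<le> \<tau> * A\<^sup>2 / 8"
    by (simp add: power2_eq_square mult_ac)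
  have "integral ?I (\<lambda>t. 3/8 * A\<^sup>2 - 1/2 * L * m * D t) = \<tau> * (3/8 * A\<^sup>2) - 1/2 * L * m * integral ?I D"
    using \<tau> t0 by (subst integral_diff) (auto intro!: integrable_on_mult_right D_integrable)
  moreover have "1/2 * L * m * integral ?I D \<le> \<tau> / 8 * A\<^sup>2"
  proof -
    have "integral ?I D \<le> 40000 * A\<^sup>2 / \<nu>"
      using diss nu_pos by (simp add: field_simps)
    then have "1/2 * L * m * integral ?I D \<le> 1/2 * L * m * (40000 * A\<^sup>2 / \<nu>)"
      using L_pos m by (intro mult_left_mono) auto
    also have "\<dots> = 20000 * L * m / \<nu> * A\<^sup>2" by simp
    also have "\<dots> \<le> \<tau> / 8 * A\<^sup>2" by (intro mult_right_mono i) auto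
    finally show ?thesis .
  qed
  moreover have "0 < \<tau> * A\<^sup>2" using \<tau> A by simp
  \<comment> \<open>The gain is at least \<open>(3/8 - 1/8) \<tau> A^2\<close>, which exceeds the
    bound \<open>upper\<close>.\<close>
  ultimately show False using upper by linarith
qed

text \<open>One application of \<open>decay\<close> at scale \<open>j\<close> lowers the size by a
  factor 128 in time at most \<open>c / 2^j\<close>. Summed from \<open>J\<close> to
  \<open>J + n - 1\<close>, these times give the stated expression, which stays below
  \<open>2 c / 2^J\<close> for every \<open>n\<close>.\<close>

lemma descent:
  assumes prof: "adapted_profiles \<nu> \<beta> \<gamma> C c \<rho>" and c: "0 < c" and \<rho>: "0 < \<rho>"
    and J: "c / 2 ^ J \<le> h" "1 \<le> \<rho> * 128 ^ J" "d0 \<le> (\<rho> * 128 ^ J)\<^sup>2"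
  shows "0 \<le> t0 \<Longrightarrow> nm (u t0) \<le> \<rho> * 128 ^ (J + n) \<Longrightarrow>
    \<exists>t\<ge>t0. t \<le> t0 + 2 * c * (1 / 2 ^ J - 1 / 2 ^ (J + n)) \<and> nm (u t) \<le> \<rho> * 128 ^ J"
proof (induction n arbitrary: t0)
  case 0
  then show ?case by (intro exI[of _ t0]) simp
next
  case (Suc n)
  let ?j = "J + n" and ?A = "\<rho> * 128 ^ (J + n)"
  obtain N a b m where P: "b \<in> TP" "\<And>x. 0 \<le> b x" "(\<integral>x. b x \<partial>mu) = 1" "(\<integral>x. \<bar>x\<bar> * b x \<partial>mu) \<le> m"
     "ts N (dcoef a) = (\<lambda>x. 1 - L * b x)" "20000 * L * m / \<nu> \<le> c / 2 ^ ?j / 8"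
     "400 * nm (ts N a) \<le> c / 2 ^ ?j * ?A / 8"
     and W: "201 * (\<nu> * nm (ts N (dcoef (dcoef a))) + \<bar>\<beta>\<bar> * nm (ts N a)
          + \<bar>\<gamma>\<bar> * nm (ts N (dcoef (dcoef (dcoef a)))) + C * V_norm L (ts N a)) + 1 \<le> ?A / 8"
    using prof[unfolded adapted_profiles_def, rule_format, of ?j] by blast
  have A_mono: "\<rho> * 128 ^ J \<le> ?A" using \<rho> by (intro mult_left_mono power_increasing) auto
  have "\<exists>t\<in>{t0..t0 + c / 2 ^ ?j}. nm (u t) \<le> ?A"
  proof (rule decay[OF P(1-5) Suc.prems(1) _ _ P(6,7)])
    show "c / 2 ^ ?j \<le> h"
    proof -
      have "c / 2 ^ ?j \<le> c / 2 ^ J"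
        using c by (intro divide_left_mono power_increasing) auto
      then show ?thesis using J(1) by simp
    qed
    show "201 * Wc N a + 1 \<le> ?A / 8" unfolding Wc_def[OF P(1-5)] by (rule W)
    show "1 \<le> ?A" using A_mono J(2) by linarith
    have "(\<rho> * 128 ^ J)\<^sup>2 \<le> ?A\<^sup>2" using A_mono \<rho> by (intro power_mono) auto
    then show "d0 \<le> ?A\<^sup>2" using J(3) by linarith
    show "nm (u t0) \<le> 128 * ?A" using Suc.prems(2) by (simp add: mult_ac)
  qed (use c in auto)
  then obtain t1 where t1: "t0 \<le> t1" "t1 \<le> t0 + c / 2 ^ ?j" "nm (u t1) \<le> ?A" by auto
  with Suc.IH[of t1] Suc.prems(1) obtain t where
    t: "t1 \<le> t" "t \<le> t1 + 2 * c * (1 / 2 ^ J - 1 / 2 ^ ?j)" "nm (u t) \<le> \<rho> * 128 ^ J" by auto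
  have "2 * c * (1 / 2 ^ J - 1 / 2 ^ ?j) + c / 2 ^ ?j = 2 * c * (1 / 2 ^ J - 1 / 2 ^ (J + Suc n))"
    by (simp add: field_simps)
  with t t1 show ?case by (intro exI[of _ t]) auto
qed

text \<open>The descent is started at time \<open>t - \<delta>\<close>, from whatever scale the
  solution has there, and ends before \<open>t\<close>; the remaining time is at most
  \<open>h\<close>, so the energy can no more than double, up to \<open>d0\<close>.\<close>

lemma absorbed:
  assumes prof: "adapted_profiles \<nu> \<beta> \<gamma> C c \<rho>" and c: "0 < c" and \<rho>: "0 < \<rho>"
    and J: "c / 2 ^ J \<le> h" "1 \<le> \<rho> * 128 ^ J" "d0 \<le> (\<rho> * 128 ^ J)\<^sup>2"
    and \<delta>: "2 * c / 2 ^ J \<le> \<delta>" "\<delta> \<le> h" "\<delta> \<le> t"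
  shows "(nm (u t))\<^sup>2 \<le> 2 * ((\<rho> * 128 ^ J)\<^sup>2 + d0)"
proof -
  have t0: "0 \<le> t - \<delta>" using \<delta> by simp
  obtain n where n: "nm (u (t - \<delta>)) / \<rho> < 128 ^ n"
    using real_arch_pow[of 128] by auto
  have "nm (u (t - \<delta>)) < \<rho> * 128 ^ n"
    using n \<rho> by (simp add: pos_divide_less_eq mult.commute)
  also have "\<dots> \<le> \<rho> * 128 ^ (J + n)"
    using \<rho> by (intro mult_left_mono power_increasing) auto
  finally have "nm (u (t - \<delta>)) \<le> \<rho> * 128 ^ (J + n)" by simp
  from descent[OF prof c \<rho> J t0 this] obtain s where
    s: "t - \<delta> \<le> s" "s \<le> t - \<delta> + 2 * c * (1 / 2 ^ J - 1 / 2 ^ (J + n))" "nm (u s) \<le> \<rho> * 128 ^ J"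
    by auto
  have "2 * c * (1 / 2 ^ J - 1 / 2 ^ (J + n)) \<le> 2 * c / 2 ^ J"
    using c by (simp add: right_diff_distrib)
  with s \<delta> have st: "s \<le> t" "0 \<le> s" "t - s \<le> h" using t0 by auto
  have "(nm (u t))\<^sup>2 \<le> 2 * ((nm (u s))\<^sup>2 + d0)"
    by (rule short_time_bounds(1)[OF st(2,1,3)]) (use st in auto)
  also have "\<dots> \<le> 2 * ((\<rho> * 128 ^ J)\<^sup>2 + d0)"
    using s(3) by (intro mult_left_mono add_mono power_mono) auto
  finally show ?thesis .
qed

end

theorem corollary2p7:
  fixes L \<nu> \<beta> \<gamma> :: real
    and f :: "(real \<Rightarrow> real) \<Rightarrow> real"
    and S :: "real \<Rightarrow> (real \<Rightarrow> real) \<Rightarrow> (real \<Rightarrow> real)"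
  assumes "L > 0" and "\<nu> > 0" and "\<gamma> \<noteq> 0"
    and "f \<in> dual_V L"
    and "solution_semigroup L \<nu> \<beta> \<gamma> f S"
  shows "\<forall>t'>0. \<exists>r>0. \<forall>u0\<in>space_H L. \<forall>t\<ge>t'. L2_norm L (S t u0) < r"
proof (intro allI impI)
  fix t' :: real assume t': "0 < t'"
  interpret torus L by unfold_locales (rule assms)
  obtain C0 where C0: "\<forall>\<phi>\<in>space_V L. \<bar>f \<phi>\<bar> \<le> C0 * V_norm L \<phi>"
    using assms(4) by (auto simp: dual_V_def)
  define C where "C = max C0 0"
  have fC: "\<bar>f \<phi>\<bar> \<le> C * V_norm L \<phi>" if "\<phi> \<in> space_V L" for \<phi>
  proof -
    have "C0 * V_norm L \<phi> \<le> C * V_norm L \<phi>"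
      by (intro mult_right_mono) (auto simp: C_def V_norm_def)
    then show ?thesis using C0 that by force
  qed
  have C: "0 \<le> C" by (simp add: C_def)
  obtain c \<rho> where c: "0 < c" and \<rho>: "0 < \<rho>" and prof: "adapted_profiles \<nu> \<beta> \<gamma> C c \<rho>"
    by (rule adapted_profiles_exist[OF assms(2) C])
  \<comment> \<open>\<open>k\<close> and \<open>d\<close> are the values of \<open>h\<close> and
    \<open>d0\<close>, restated because \<open>J\<close> and \<open>r\<close> must be fixed before a
    solution is chosen.\<close>
  define k where "k = 1 / (2 * (2 * \<bar>\<beta>\<bar> + \<nu>))"
  define d where "d = C\<^sup>2 / \<nu> * k"
  have k: "0 < k" using assms(2) by (simp add: k_def add_nonneg_pos)
  \<comment> \<open>\<open>n1\<close> makes the descent shorter than both \<open>t'\<close> and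
    \<open>k\<close>; \<open>n2\<close> puts the final size above 1 and above
    \<open>d\<close>.\<close>
  obtain n1 where n1: "2 * c / min t' k < 2 ^ n1"
    using real_arch_pow[of 2] by auto
  obtain n2 where n2: "(1 + d) / \<rho> < 128 ^ n2"
    using real_arch_pow[of 128] by auto
  define J where "J = max n1 n2"
  have "(2::real) ^ n1 \<le> 2 ^ J" "(128::real) ^ n2 \<le> 128 ^ J"
    by (auto simp: J_def intro: power_increasing)
  then have "2 * c / min t' k < 2 ^ J" "(1 + d) / \<rho> < 128 ^ J"
    using n1 n2 by linarith+
  then have J: "2 * c / 2 ^ J < min t' k" "1 + d < \<rho> * 128 ^ J"
    using k t' \<rho> by (simp_all add: pos_divide_less_eq mult.commute del: min_less_iff_conj)
  have d: "0 \<le> d" using k assms(2) by (simp add: d_def)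
  have J1: "1 \<le> \<rho> * 128 ^ J" using J d by simp
  have J2: "d \<le> (\<rho> * 128 ^ J)\<^sup>2"
    using J d self_le_power[OF J1, of 2] by simp
  have J3: "c / 2 ^ J \<le> k"
  proof -
    have "c / 2 ^ J \<le> 2 * c / 2 ^ J" using c by (intro divide_right_mono) auto
    then show ?thesis using J(1) by simp
  qed
  \<comment> \<open>The added 1 makes the inequality strict and \<open>r\<close> positive.\<close>
  define r where "r = sqrt (2 * ((\<rho> * 128 ^ J)\<^sup>2 + d)) + 1"
  have "nm (S t u0) < r" if u0: "u0 \<in> space_H L" and t: "t' \<le> t" for u0 t
  proof -
    interpret weak_sol L \<nu> \<beta> \<gamma> f C "\<lambda>t. S t u0"
      using assms C fC u0 by unfold_locales (auto simp: solution_semigroup_def)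
    have hk: "h = k" and d0d: "d0 = d"
      by (simp_all add: h_def k_def \<kappa>_def d0_def d_def)
    have "(nm (S t u0))\<^sup>2 \<le> 2 * ((\<rho> * 128 ^ J)\<^sup>2 + d)"
      using absorbed[OF prof c \<rho>, of J "min t' k" t] J J1 J2 J3 t unfolding hk d0d by simp
    then have "sqrt ((nm (S t u0))\<^sup>2) \<le> sqrt (2 * ((\<rho> * 128 ^ J)\<^sup>2 + d))"
      by (rule real_sqrt_le_mono)
    then show ?thesis by (simp add: r_def)
  qed
  moreover have "0 < r" using d by (simp add: r_def add_nonneg_pos)
  ultimately show "\<exists>r>0. \<forall>u0\<in>space_H L. \<forall>t\<ge>t'. nm (S t u0) < r"
    by blast
qed

end
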